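(* Let $p>1$, $q>p$, and let $V(r)=e^{-r^{2p}+r^2}\sin(r^{2q})$, $r\ge0$, be regarded as the radial symbol $V(|z|)$ on $\mathbb{C}$. Then for the Toeplitz operators in the analytic Bargmann space $\mathcal{B}^{\mathbb{C}}$ over $\mathbb{C}$ (complex dimension $d=1$), $$\limsup_{\lambda\to0+} n(\lambda,T_V)\,\frac{\log|\log\lambda|}{|\log\lambda|}\le\frac{q}{q-1},$$ while $$n(\lambda,T_{|V|})\sim n(\lambda,T_{V_+})\sim n(\lambda,T_{V_-})\sim\frac{p}{p-1}\,\frac{|\log\lambda|}{\log|\log\lambda|},\qquad \lambda\to0+.$$
   Context: $\mathcal{B}^{\mathbb{C}}$ is the closed subspace of analytic functions in $L^2(\mathbb{C},e^{-|z|^2}dm)$, $m$ Lebesgue measure. For a bounded real function $W$ on $\mathbb{C}$, the Toeplitz operator $T_W$ in $\mathcal{B}^{\mathbb{C}}$ is $T_Wu=P(Wu)$, with $P$ the orthogonal projection of $L^2(\mathbb{C},e^{-|z|^2}dm)$ onto $\mathcal{B}^{\mathbb{C}}$. For a compact $T$, $n(\lambda,T)=\#\{n: s_n(T)>\lambda\}$, $\lambda>0$, where $s_n(T)$ are the singular numbers of $T$ counted with multiplicity. $V_\pm=\max(\pm V,0)$ are the positive and negative parts of $V$. $f\sim g$ means $f/g\to1$. *)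

theory Defs
  imports "HOL-Complex_Analysis.Complex_Analysis" "HOL-Library.Function_Algebras"
    "HOL-Library.Landau_Symbols"
begin

definition gauss_measure :: "complex measure" where
  "gauss_measure = density lborel (\<lambda>z. ennreal (exp (- (norm z)\<^sup>2)))"

text \<open>Square-integrable functions are represented by functions, not by almost-everywhere classes.
  In the Bargmann space this makes no difference: entire functions that agree almost everywhere
  are equal.\<close>

definition gauss_L2 :: "(complex \<Rightarrow> complex) set" where
  "gauss_L2 = {f \<in> borel_measurable gauss_measure. integrable gauss_measure (\<lambda>z. (norm (f z))\<^sup>2)}"

definition gauss_inner :: "(complex \<Rightarrow> complex) \<Rightarrow> (complex \<Rightarrow> complex) \<Rightarrow> complex" where
  "gauss_inner f g = (LINT z|gauss_measure. f z * cnj (g z))"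

definition gauss_norm :: "(complex \<Rightarrow> complex) \<Rightarrow> real" where
  "gauss_norm f = sqrt (LINT z|gauss_measure. (norm (f z))\<^sup>2)"

definition bargmann :: "(complex \<Rightarrow> complex) set" where
  "bargmann = {f \<in> gauss_L2. f holomorphic_on UNIV}"

definition bargmann_proj :: "(complex \<Rightarrow> complex) \<Rightarrow> complex \<Rightarrow> complex" where
  "bargmann_proj f =
     (THE g. g \<in> bargmann \<and> (\<forall>h\<in>bargmann. gauss_inner (\<lambda>z. f z - g z) h = 0))"

definition toeplitz :: "(complex \<Rightarrow> real) \<Rightarrow> (complex \<Rightarrow> complex) \<Rightarrow> complex \<Rightarrow> complex" where
  "toeplitz W u = bargmann_proj (\<lambda>z. of_real (W z) * u z)"

text \<open>Operators in the Bargmann space are functions of which only the values on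
  \<^term>\<open>bargmann\<close> matter.\<close>

definition bargmann_linear :: "((complex \<Rightarrow> complex) \<Rightarrow> complex \<Rightarrow> complex) \<Rightarrow> bool" where
  "bargmann_linear T \<longleftrightarrow>
     (\<forall>u\<in>bargmann. T u \<in> bargmann) \<and>
     (\<forall>u\<in>bargmann. \<forall>v\<in>bargmann. T (\<lambda>z. u z + v z) = (\<lambda>z. T u z + T v z)) \<and>
     (\<forall>c. \<forall>u\<in>bargmann. T (\<lambda>z. c * u z) = (\<lambda>z. c * T u z))"

definition bargmann_compact :: "((complex \<Rightarrow> complex) \<Rightarrow> complex \<Rightarrow> complex) \<Rightarrow> bool" where
  "bargmann_compact T \<longleftrightarrow> bargmann_linear T \<and>
     (\<forall>u :: nat \<Rightarrow> complex \<Rightarrow> complex.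
        (\<forall>k. u k \<in> bargmann) \<and> (\<exists>C. \<forall>k. gauss_norm (u k) \<le> C) \<longrightarrow>
        (\<exists>r g. strict_mono (r :: nat \<Rightarrow> nat) \<and> g \<in> bargmann \<and>
           (\<lambda>k. gauss_norm (\<lambda>z. T (u (r k)) z - g z)) \<longlonglongrightarrow> 0))"

definition bargmann_adjoint ::
  "((complex \<Rightarrow> complex) \<Rightarrow> complex \<Rightarrow> complex) \<Rightarrow> (complex \<Rightarrow> complex) \<Rightarrow> complex \<Rightarrow> complex" where
  "bargmann_adjoint T v =
     (THE w. w \<in> bargmann \<and> (\<forall>u\<in>bargmann. gauss_inner (T u) v = gauss_inner u w))"

global_interpretation cfun: vector_space "\<lambda>(c::complex) (f :: complex \<Rightarrow> complex) z. c * f z"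
  by unfold_locales (auto simp: fun_eq_iff algebra_simps)

definition singular_space ::
  "((complex \<Rightarrow> complex) \<Rightarrow> complex \<Rightarrow> complex) \<Rightarrow> real \<Rightarrow> (complex \<Rightarrow> complex) set" where
  "singular_space T t = {u \<in> bargmann. bargmann_adjoint T (T u) = (\<lambda>z. of_real (t\<^sup>2) * u z)}"

text \<open>The singular numbers of a compact operator \<open>T\<close> are the square roots of the eigenvalues of
  \<open>T\<^sup>*T\<close>, in nonincreasing order and counted with (complex) multiplicity; a sequence with only
  finitely many positive terms is continued by zeros. For compact \<open>T\<close> there is exactly one such
  sequence. The limit condition makes the set of indices below finite, so that its \<^const>\<open>card\<close> is
  its number of elements; likewise the eigenspaces are finite-dimensional for compact \<open>T\<close>. For
  noncompact \<open>T\<close> the definition is not meaningful.\<close>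

definition singular_numbers :: "((complex \<Rightarrow> complex) \<Rightarrow> complex \<Rightarrow> complex) \<Rightarrow> nat \<Rightarrow> real" where
  "singular_numbers T =
     (THE s. decseq s \<and> s \<longlonglongrightarrow> 0 \<and>
        (\<forall>t>0. card {n. s n = t} = cfun.dim (singular_space T t)))"

definition singular_count :: "real \<Rightarrow> ((complex \<Rightarrow> complex) \<Rightarrow> complex \<Rightarrow> complex) \<Rightarrow> nat" where
  "singular_count x T = card {n. singular_numbers T n > x}"

definition osc_symbol :: "real \<Rightarrow> real \<Rightarrow> real \<Rightarrow> real" where
  "osc_symbol p q r = exp (- (r powr (2 * p)) + r\<^sup>2) * sin (r powr (2 * q))"

end

theory Submission
  imports Defs "HOL-Real_Asymp.Real_Asymp" "HOL-Probability.Sinc_Integral"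
    "HOL-Library.Diagonal_Subsequence"
begin

text \<open>A radial symbol \<open>w (norm z)\<close> gives a Toeplitz operator that is diagonal in the monomials, with
  eigenvalues \<open>\<mu> n = (LBINT t:{0..}. w (sqrt t) * t ^ n * exp (- t)) / fact n\<close>. For
  \<open>V\<close>, its absolute value and its positive and negative parts, \<open>fact n * \<mu> n\<close> is the integral of
  \<open>t ^ n * exp (- (t powr p)) * s t\<close>, where \<open>s t\<close> is \<open>sin (t powr q)\<close>, its absolute value, or
  its positive or negative part. The integrand concentrates at \<open>t\<close> of order \<open>n powr (1 / p)\<close>. If \<open>s\<close> does not
  change sign, a single bump of \<open>s\<close> there shows that the integral is \<open>exp (n / p * ln n + O(n))\<close>, so
  \<open>- ln (\<mu> n)\<close> is \<open>(1 - 1 / p) * n * ln n + O(n)\<close>. For \<open>s t = sin (t powr q)\<close> rotating the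
  contour turns the oscillation into the decay \<open>exp (- (t powr q))\<close>, so that the integral is at most
  \<open>exp (n / q * ln n + O(n))\<close>. Inverting \<open>n * ln n\<close> gives the counting asymptotics.\<close>

section \<open>Counting superexponentially decaying sequences\<close>

text \<open>For \<open>V\<close> itself no control of the sign or the order of the eigenvalues is
  available, and some may vanish. The operator is diagonal and self-adjoint, so its singular numbers
  are the values \<open>\<bar>\<mu> n\<bar>\<close> rearranged, and \<open>singular_count x\<close>
  is the number of indices with \<open>\<bar>\<mu> n\<bar> > x\<close>, whatever their order.
  Reaching this from the definite descriptions in the definitions requires existence and uniqueness
  of the decreasing rearrangement and the dimension of every eigenspace of the square.

  All estimates may lose factors \<open>exp (O(n))\<close>, which is why crude bounds for the
  factorial, for the maximum of the integrand and for the length of a bump are enough. The factorial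
  contributes \<open>n * ln n\<close>, and the moment gives back the fraction \<open>1 / p\<close>
  of it, or \<open>1 / q\<close> after rotation; hence the constants \<open>p / (p - 1)\<close> and
  \<open>q / (q - 1)\<close>. The rotated contour bounds the moment of \<open>V\<close> only from
  above, so the result for \<open>V\<close> is a bound on a limsup. As \<open>p < q\<close>, this
  bound is smaller than the constant for the positive and negative parts: the difference is due to
  their cancellation.\<close>

lemma eventually_count_threshold_above:
  fixes c C d :: real
  assumes "c > 0" "d * c > 1" "d > 0"
  shows "eventually (\<lambda>L. d * (L / ln L) * (c * ln (d * (L / ln L)) - C) \<ge> L) at_top"
proof -
  have "((\<lambda>L. d / ln L * (c * ln (d * (L / ln L)) - C)) \<longlongrightarrow> d * c) at_top"
    using assms by (real_asymp simp: field_simps)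
  hence "eventually (\<lambda>L. d / ln L * (c * ln (d * (L / ln L)) - C) > 1) at_top"
    using assms(2) by (rule order_tendstoD)
  moreover have "eventually (\<lambda>L. (0::real) < L) at_top" by (rule eventually_gt_at_top)
  ultimately show ?thesis
  proof eventually_elim
    case (elim L)
    then show ?case using mult_left_mono[of 1 "d / ln L * (c * ln (d * (L / ln L)) - C)" L] by (simp add: algebra_simps)
  qed
qed

text \<open>Here and in the preceding lemma \<open>L\<close> stands for
  \<open>\<bar>ln x\<bar>\<close>, and the trial index is \<open>y = d * (L / ln L)\<close>. Since
  \<open>ln y\<close> grows like \<open>ln L\<close>, \<open>c * y * ln y\<close> is asymptotic to
  \<open>d * c * L\<close>. Comparing \<open>d * c\<close> with 1 thus decides on which side of
  \<open>L\<close> it falls, and the linear term \<open>C * y\<close> is of lower order.\<close>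

lemma eventually_count_threshold_below:
  fixes c C d :: real
  assumes "c > 0" "d * c < 1" "d > 0"
  shows "eventually (\<lambda>L. d * (L / ln L) * (c * ln (d * (L / ln L)) + C) < L) at_top"
proof -
  have "((\<lambda>L. d / ln L * (c * ln (d * (L / ln L)) + C)) \<longlongrightarrow> d * c) at_top"
    using assms by (real_asymp simp: field_simps)
  hence "eventually (\<lambda>L. d / ln L * (c * ln (d * (L / ln L)) + C) < 1) at_top"
    using assms(2) by (rule order_tendstoD)
  moreover have "eventually (\<lambda>L. (0::real) < L) at_top" by (rule eventually_gt_at_top)
  ultimately show ?thesis
  proof eventually_elim
    case (elim L)
    then show ?case using mult_strict_left_mono[of "d / ln L * (c * ln (d * (L / ln L)) + C)" 1 L] by (simp add: algebra_simps)
  qed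
qed

lemma filterlim_abs_ln_at_right_0: "filterlim (\<lambda>x::real. \<bar>ln x\<bar>) at_top (at_right 0)"
proof -
  have "filterlim (\<lambda>x::real. - ln x) at_top (at_right 0)" by real_asymp
  moreover have "eventually (\<lambda>x::real. - ln x = \<bar>ln x\<bar>) (at_right 0)"
    using eventually_at_right_real[OF zero_less_one[where ?'a = real]] by eventually_elim auto
  ultimately show ?thesis by (rule filterlim_mono_eventually[OF _ order_refl order_refl])
qed

lemma eventually_at_right_0_abs_ln:
  assumes "eventually P (at_top :: real filter)"
  shows "eventually (\<lambda>x. P \<bar>ln x\<bar>) (at_right (0::real))"
  using assms filterlim_abs_ln_at_right_0 by (rule eventually_compose_filterlim)

lemma eventually_at_right_0_exp_abs_ln: "eventually (\<lambda>x::real. x = exp (- \<bar>ln x\<bar>)) (at_right 0)"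
  using eventually_at_right_real[OF zero_less_one[where ?'a = real]] by eventually_elim auto

lemma eventually_superlevel_card_le:
  fixes a :: "nat \<Rightarrow> real"
  assumes "c > 0" "\<epsilon> > 0"
    and a: "\<And>n. n \<ge> N \<Longrightarrow> a n \<le> exp (- (c * real n * ln n) + C * real n)"
  shows "eventually (\<lambda>x. real (card {n. a n > x}) \<le> (1 / c + \<epsilon>) * (\<bar>ln x\<bar> / ln \<bar>ln x\<bar>)) (at_right 0)"
proof -
  \<comment> \<open>Half of \<open>\<epsilon>\<close> makes \<open>d * c > 1\<close>; the other half
    pays for rounding the threshold index up to an integer.\<close>
  define d where "d = 1 / c + \<epsilon> / 2"
  have d: "d > 0" "d * c > 1"
    using assms(1,2) by (simp_all add: d_def ring_distribs add_pos_pos)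
  have "filterlim (\<lambda>L. d * (L / ln L)) at_top (at_top :: real filter)"
    using d by real_asymp
  \<comment> \<open>The bound \<open>exp (C / c)\<close> makes \<open>c * ln y - C\<close>
    nonnegative, so that \<open>n * (c * ln n - C)\<close> stays above its value at \<open>y\<close>
    for all \<open>n \<ge> y\<close>.\<close>
  hence big: "eventually (\<lambda>L. d * (L / ln L) \<ge> max (max 1 (real N)) (exp (C / c))) (at_top :: real filter)"
    unfolding filterlim_at_top by blast
  have "filterlim (\<lambda>L. \<epsilon> / 2 * (L / ln L)) at_top (at_top :: real filter)"
    using assms(2) by real_asymp
  hence one: "eventually (\<lambda>L. \<epsilon> / 2 * (L / ln L) \<ge> 1) (at_top :: real filter)"
    unfolding filterlim_at_top by blast
  from big one eventually_count_threshold_above[OF assms(1) d(2,1), of C]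
  have "eventually (\<lambda>L::real. card {n. a n > exp (- L)} \<le> (1 / c + \<epsilon>) * (L / ln L)) at_top"
  proof eventually_elim
    case (elim L)
    define y where "y = d * (L / ln L)"
    have y: "y \<ge> 1" "y \<ge> real N" "y \<ge> exp (C / c)" "y * (c * ln y - C) \<ge> L"
      using elim by (simp_all add: y_def)
    have "C / c \<le> ln y" using y(1,3) by (simp add: ln_ge_iff)
    hence y': "c * ln y - C \<ge> 0" using assms(1) by (simp add: field_simps)
    have "real n < y" if "a n > exp (- L)" for n
    proof (rule ccontr)
      assume "\<not> real n < y"
      hence n: "real n \<ge> y" by simp
      hence "n \<ge> N" using y(2) by linarith
      from a[OF this] that have "exp (-L) < exp (- (c * real n * ln n) + C * real n)" by linarith
      hence "real n * (c * ln n - C) < L" by (simp add: algebra_simps)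
      moreover have "y * (c * ln y - C) \<le> real n * (c * ln n - C)"
        using n y y' assms(1) by (intro mult_mono diff_mono mult_left_mono) auto
      ultimately show False using y(4) by linarith
    qed
    hence "{n. a n > exp (- L)} \<subseteq> {..<nat \<lceil>y\<rceil>}"
      by (auto simp: zless_nat_eq_int_zless less_ceiling_iff)
    hence "card {n. a n > exp (- L)} \<le> nat \<lceil>y\<rceil>"
      by (metis card_lessThan card_mono finite_lessThan)
    hence "real (card {n. a n > exp (- L)}) \<le> y + 1" using y(1) by linarith
    moreover have "(1 / c + \<epsilon>) * F = d * F + \<epsilon> / 2 * F" for F by (simp add: d_def algebra_simps)
    from this[of "L / ln L"] have "y + 1 \<le> (1 / c + \<epsilon>) * (L / ln L)" using elim(2) by (simp only: y_def)
    ultimately show ?case by linarith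
  qed
  from eventually_at_right_0_abs_ln[OF this] eventually_at_right_0_exp_abs_ln
  show ?thesis by eventually_elim metis
qed

lemma eventually_superlevel_card_ge:
  fixes a :: "nat \<Rightarrow> real"
  assumes "c > 0" "\<epsilon> > 0" and fin: "\<And>x. x > 0 \<Longrightarrow> finite {n. a n > x}"
    and a: "\<And>n. n \<ge> N \<Longrightarrow> a n \<ge> exp (- (c * real n * ln n) - C * real n)"
  shows "eventually (\<lambda>x. real (card {n. a n > x}) \<ge> (1 / c - \<epsilon>) * (\<bar>ln x\<bar> / ln \<bar>ln x\<bar>)) (at_right 0)"
proof (cases "1 / c - \<epsilon> / 2 > 0")
  \<comment> \<open>The asserted lower bound is then nonpositive.\<close>
  case False
  have "eventually (\<lambda>L. L / ln L > 0) (at_top :: real filter)" by real_asymp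
  from eventually_at_right_0_abs_ln[OF this] show ?thesis
  proof eventually_elim
    case (elim x)
    have "1 / c - \<epsilon> \<le> 0" using False assms(2) by linarith
    hence "(1 / c - \<epsilon>) * (\<bar>ln x\<bar> / ln \<bar>ln x\<bar>) \<le> 0" using elim by (intro mult_nonpos_nonneg) auto
    thus ?case by (smt (verit) of_nat_0_le_iff)
  qed
next
  case True
  define d where "d = 1 / c - \<epsilon> / 2"
  have d: "d > 0" "d * c < 1"
    using assms True by (auto simp: d_def field_simps)
  have "filterlim (\<lambda>L. d * (L / ln L)) at_top (at_top :: real filter)"
    using d by real_asymp
  hence big: "eventually (\<lambda>L. d * (L / ln L) \<ge> 1) (at_top :: real filter)"
    unfolding filterlim_at_top by blast
  have "filterlim (\<lambda>L. \<epsilon> / 2 * (L / ln L)) at_top (at_top :: real filter)"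
    using assms(2) by real_asymp
  \<comment> \<open>This half of \<open>\<epsilon>\<close> pays for the initial indices, on which
    \<open>a\<close> is not estimated, and for rounding \<open>y\<close> down.\<close>
  hence one: "eventually (\<lambda>L. \<epsilon> / 2 * (L / ln L) \<ge> real (N + 2)) (at_top :: real filter)"
    unfolding filterlim_at_top by blast
  \<comment> \<open>With \<open>max C 0\<close> in place of \<open>C\<close> the factor
    \<open>c * ln y + max C 0\<close> is nonnegative, and the product increases with the
    index.\<close>
  from big one eventually_count_threshold_below[OF assms(1) d(2,1), of "max C 0"]
  have "eventually (\<lambda>L::real. card {n. a n > exp (- L)} \<ge> (1 / c - \<epsilon>) * (L / ln L)) at_top"
  proof eventually_elim
    case (elim L)
    define y where "y = d * (L / ln L)"
    have y: "y \<ge> 1" "y * (c * ln y + max C 0) < L"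
      using elim by (simp_all add: y_def)
    have "a n > exp (- L)" if "n \<in> {N + 1..nat \<lfloor>y\<rfloor>}" for n
    proof -
      have n: "n \<ge> N" "n \<ge> 1" "real n \<le> y" using that y(1) by (auto simp: le_nat_iff le_floor_iff)
      have "real n * (c * ln n + C) \<le> real n * (c * ln n + max C 0)" by (intro mult_left_mono) auto
      also have "\<dots> \<le> y * (c * ln y + max C 0)"
        using n y assms(1) by (intro mult_mono add_mono mult_left_mono add_nonneg_nonneg mult_nonneg_nonneg) auto
      also have "\<dots> < L" by (rule y(2))
      finally have "exp (- L) < exp (- (c * real n * ln n) - C * real n)" by (simp add: algebra_simps)
      also have "\<dots> \<le> a n" using a n(1) by simp
      finally show ?thesis .
    qed
    hence "{N + 1..nat \<lfloor>y\<rfloor>} \<subseteq> {n. a n > exp (- L)}" by blast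
    hence "card {N + 1..nat \<lfloor>y\<rfloor>} \<le> card {n. a n > exp (- L)}"
      by (intro card_mono fin) auto
    hence "nat \<lfloor>y\<rfloor> - N \<le> card {n. a n > exp (- L)}" by simp
    moreover have "y \<le> real (nat \<lfloor>y\<rfloor>) + 1" using y(1) by linarith
    ultimately have "y \<le> real (card {n. a n > exp (- L)}) + real N + 1" by linarith
    moreover have "(1 / c - \<epsilon>) * F = d * F - \<epsilon> / 2 * F" for F by (simp add: d_def algebra_simps)
    from this[of "L / ln L"] have "(1 / c - \<epsilon>) * (L / ln L) = y - \<epsilon> / 2 * (L / ln L)" by (simp only: y_def)
    ultimately show ?case using elim(2) by linarith
  qed
  from eventually_at_right_0_abs_ln[OF this] eventually_at_right_0_exp_abs_ln
  show ?thesis by eventually_elim metis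
qed

lemma superlevel_card_asymp_equiv:
  fixes a :: "nat \<Rightarrow> real"
  assumes "c > 0" and fin: "\<And>x. x > 0 \<Longrightarrow> finite {n. a n > x}"
    and le: "\<And>n. n \<ge> N \<Longrightarrow> a n \<le> exp (- (c * real n * ln n) + C * real n)"
    and ge: "\<And>n. n \<ge> N \<Longrightarrow> a n \<ge> exp (- (c * real n * ln n) - C * real n)"
  shows "(\<lambda>x. real (card {n. a n > x})) \<sim>[at_right 0] (\<lambda>x. 1 / c * (\<bar>ln x\<bar> / ln \<bar>ln x\<bar>))"
proof (rule asymp_equivI')
  have pos: "eventually (\<lambda>x. \<bar>ln x\<bar> / ln \<bar>ln x\<bar> > 0) (at_right (0::real))"
    by (rule eventually_at_right_0_abs_ln) real_asymp
  show "((\<lambda>x. real (card {n. a n > x}) / (1 / c * (\<bar>ln x\<bar> / ln \<bar>ln x\<bar>))) \<longlongrightarrow> 1) (at_right 0)"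
  proof (rule tendstoI)
    fix e :: real assume "e > 0"
    define \<epsilon> where "\<epsilon> = e / (2 * c)"
    have "\<epsilon> > 0" using \<open>e > 0\<close> assms(1) by (simp add: \<epsilon>_def)
    have "eventually (\<lambda>x. real (card {n. a n > x}) \<le> (1 / c + \<epsilon>) * (\<bar>ln x\<bar> / ln \<bar>ln x\<bar>)) (at_right 0)"
      by (rule eventually_superlevel_card_le[where N = N and C = C]) (use assms \<open>\<epsilon> > 0\<close> in auto)
    moreover have "eventually (\<lambda>x. real (card {n. a n > x}) \<ge> (1 / c - \<epsilon>) * (\<bar>ln x\<bar> / ln \<bar>ln x\<bar>)) (at_right 0)"
      by (rule eventually_superlevel_card_ge[where N = N and C = C]) (use assms \<open>\<epsilon> > 0\<close> in auto)
    moreover note pos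
    ultimately
    show "eventually (\<lambda>x. dist (real (card {n. a n > x}) / (1 / c * (\<bar>ln x\<bar> / ln \<bar>ln x\<bar>))) 1 < e) (at_right 0)"
    proof eventually_elim
      case (elim x)
      define F where "F = \<bar>ln x\<bar> / ln \<bar>ln x\<bar>"
      define K where "K = real (card {n. a n > x})"
      have F: "F > 0" and *: "K \<le> (1 / c + \<epsilon>) * F" "K \<ge> (1 / c - \<epsilon>) * F"
        using elim by (simp_all add: F_def K_def)
      have eq: "K / (1 / c * F) = c * (K / F)" by simp
      have "K / F \<le> 1 / c + \<epsilon>" "K / F \<ge> 1 / c - \<epsilon>"
        using * F by (simp_all only: pos_divide_le_eq pos_le_divide_eq)
      hence "c * (K / F) \<le> c * (1 / c + \<epsilon>)" "c * (K / F) \<ge> c * (1 / c - \<epsilon>)"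
        using assms(1) by (simp_all only: mult_le_cancel_left_pos)
      moreover have "c * (1 / c + \<epsilon>) = 1 + e / 2" "c * (1 / c - \<epsilon>) = 1 - e / 2"
        using assms(1) by (simp_all add: \<epsilon>_def ring_distribs)
      ultimately have "K / (1 / c * F) \<le> 1 + e / 2" "K / (1 / c * F) \<ge> 1 - e / 2"
        unfolding eq by linarith+
      hence "dist (K / (1 / c * F)) 1 < e"
        using \<open>e > 0\<close> unfolding dist_real_def by linarith
      thus ?case unfolding K_def F_def .
    qed
  qed
qed

lemma Limsup_superlevel_card_le:
  fixes a :: "nat \<Rightarrow> real"
  assumes "c > 0" and a: "\<And>n. n \<ge> N \<Longrightarrow> a n \<le> exp (- (c * real n * ln n) + C * real n)"
  shows "Limsup (at_right 0) (\<lambda>x. ereal (real (card {n. a n > x}) * (ln \<bar>ln x\<bar> / \<bar>ln x\<bar>))) \<le> ereal (1 / c)"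
proof (rule ereal_le_epsilon2)
  fix \<epsilon> :: real assume "\<epsilon> > 0"
  have pos: "eventually (\<lambda>x. \<bar>ln x\<bar> / ln \<bar>ln x\<bar> > 0) (at_right (0::real))"
    by (rule eventually_at_right_0_abs_ln) real_asymp
  have "Limsup (at_right 0) (\<lambda>x. ereal (real (card {n. a n > x}) * (ln \<bar>ln x\<bar> / \<bar>ln x\<bar>))) \<le> ereal (1 / c + \<epsilon>)"
  proof (rule Limsup_bounded)
    have "eventually (\<lambda>x. real (card {n. a n > x}) \<le> (1 / c + \<epsilon>) * (\<bar>ln x\<bar> / ln \<bar>ln x\<bar>)) (at_right 0)"
      by (rule eventually_superlevel_card_le[where N = N and C = C]) (use assms \<open>\<epsilon> > 0\<close> in auto)
    with pos
    show "eventually (\<lambda>x. ereal (real (card {n. a n > x}) * (ln \<bar>ln x\<bar> / \<bar>ln x\<bar>)) \<le> ereal (1 / c + \<epsilon>)) (at_right 0)"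
    proof eventually_elim
      case (elim x)
      define F where "F = \<bar>ln x\<bar> / ln \<bar>ln x\<bar>"
      have "ln \<bar>ln x\<bar> / \<bar>ln x\<bar> = 1 / F" by (simp add: F_def)
      thus ?case using elim by (simp add: F_def[symmetric] pos_divide_le_eq mult_imp_div_pos_le)
    qed
  qed
  thus "Limsup (at_right 0) (\<lambda>x. ereal (real (card {n. a n > x}) * (ln \<bar>ln x\<bar> / \<bar>ln x\<bar>))) \<le> ereal (1 / c) + ereal \<epsilon>"
    by simp
qed

section \<open>Singular numbers as a decreasing rearrangement\<close>

lemma finite_superlevel_tendsto_0:
  fixes a :: "nat \<Rightarrow> real"
  assumes "a \<longlonglongrightarrow> 0" "x > 0"
  shows "finite {n. a n > x}"
proof -
  have "eventually (\<lambda>n. a n < x) sequentially" using assms by (rule order_tendstoD)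
  then obtain N where "\<And>n. n \<ge> N \<Longrightarrow> a n < x" unfolding eventually_sequentially by blast
  hence "{n. a n > x} \<subseteq> {..<N}" by (force simp: not_less[symmetric])
  thus ?thesis by (rule finite_subset) simp
qed

text \<open>A null sequence takes only finitely many values above \<open>x\<close>, and these are
  the \<open>t > x\<close> with a nonempty level set. The superlevel set is therefore a finite
  disjoint union of level sets whose sizes agree for \<open>a\<close> and \<open>b\<close>.\<close>

lemma card_superlevel_eq:
  fixes a b :: "nat \<Rightarrow> real"
  assumes "a \<longlonglongrightarrow> 0" "b \<longlonglongrightarrow> 0" "x > 0"
    and eq: "\<And>t. t > 0 \<Longrightarrow> card {n. a n = t} = card {n. b n = t}"
  shows "card {n. a n > x} = card {n. b n > x}"
proof -
  have fin: "finite {n. c n > x}" if "c \<longlonglongrightarrow> 0" for c :: "nat \<Rightarrow> real"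
    using that assms(3) by (rule finite_superlevel_tendsto_0)
  have cnt: "card {n. c n > x} = (\<Sum>t\<in>c ` {n. c n > x}. card {n. c n = t})"
    if "c \<longlonglongrightarrow> 0" for c :: "nat \<Rightarrow> real"
  proof -
    have "card {n. c n > x} = (\<Sum>n\<in>{n. c n > x}. 1)" by simp
    also have "\<dots> = (\<Sum>t\<in>c ` {n. c n > x}. \<Sum>n\<in>{n \<in> {n. c n > x}. c n = t}. 1)"
      by (rule sum.image_gen[OF fin[OF that]])
    also have "\<dots> = (\<Sum>t\<in>c ` {n. c n > x}. card {n. c n = t})"
      by (intro sum.cong refl) (auto intro!: arg_cong[where f = card])
    finally show ?thesis .
  qed
  have im: "c ` {n. c n > x} = {t. t > x \<and> card {n. c n = t} \<noteq> 0}" if "c \<longlonglongrightarrow> 0" for c :: "nat \<Rightarrow> real"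
  proof -
    have "finite {n. c n = t}" if "t > x" for t
      using that by (intro finite_subset[OF _ fin[OF \<open>c \<longlonglongrightarrow> 0\<close>]]) auto
    thus ?thesis by (auto simp: card_eq_0_iff)
  qed
  have "a ` {n. a n > x} = b ` {n. b n > x}"
    unfolding im[OF assms(1)] im[OF assms(2)] using eq assms(3) by auto
  thus ?thesis
    unfolding cnt[OF assms(1)] cnt[OF assms(2)] using eq assms(3) by (auto intro!: sum.cong)
qed

lemma decseq_superlevel:
  fixes s :: "nat \<Rightarrow> real"
  assumes "decseq s" "finite {n. s n > x}"
  shows "s k > x \<longleftrightarrow> k < card {n. s n > x}"
proof -
  have "{n. s n > x} = {..<card {n. s n > x}}"
  proof (cases "{n. s n > x} = {}")
    case False
    define m where "m = Max {n. s n > x}"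
    have m: "s m > x" using Max_in[OF assms(2) False] by (simp add: m_def)
    have "{n. s n > x} = {..m}"
    proof safe
      fix n assume "n \<le> m"
      thus "s n > x" using m decseqD[OF assms(1)] by fastforce
    qed (auto simp: m_def assms(2))
    thus ?thesis by (simp add: lessThan_Suc_atMost)
  qed auto
  thus ?thesis by blast
qed

text \<open>Existence: \<open>s k\<close> is the infimum of the positive thresholds exceeded by at
  most \<open>k\<close> terms, a generalized inverse of the counting function \<open>N\<close>.
  Uniqueness: the superlevel counts at positive levels determine a decreasing sequence there, and
  the limit 0 makes it nonnegative, which fixes the rest.\<close>

lemma decreasing_rearrangement_ex1:
  fixes a :: "nat \<Rightarrow> real"
  assumes "a \<longlonglongrightarrow> 0" "\<And>n. a n \<ge> 0"
  shows "\<exists>!s. decseq s \<and> s \<longlonglongrightarrow> (0::real) \<and> (\<forall>t>0. card {n. s n = t} = card {n. a n = t})"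
proof (rule ex_ex1I)
  define N where "N t = card {n. a n > t}" for t
  define A where "A k = {t. t > 0 \<and> N t \<le> k}" for k
  define s where "s k = Inf (A k)" for k
  have mono: "N t' \<le> N t" if "t \<le> t'" "t > 0" for t t'
    unfolding N_def using that by (intro card_mono finite_superlevel_tendsto_0[OF assms(1)]) auto
  obtain B where B: "B > 0" "\<And>n. \<bar>a n\<bar> \<le> B"
    using convergent_imp_Bseq[of a] assms(1) by (auto simp: convergent_def Bseq_def)
  have "{n. a n > B} = {}" using B(2) by (force simp: not_less abs_le_iff)
  hence "N B = 0" by (simp add: N_def)
  hence ne: "B \<in> A k" for k using B(1) by (simp add: A_def)
  have bdd: "bdd_below (A k)" for k by (auto simp: A_def intro!: bdd_belowI[of _ 0])
  have s_nonneg: "s k \<ge> 0" for k unfolding s_def using ne by (intro cInf_greatest) (auto simp: A_def)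
  have key: "s k > t \<longleftrightarrow> k < N t" if "t > 0" for k t
  proof
    assume "s k > t"
    hence "t \<notin> A k" using cInf_lower[OF _ bdd, of t k] by (auto simp: s_def)
    thus "k < N t" using that by (auto simp: A_def)
  next
    assume k: "k < N t"
    have fin: "finite {n. a n > t}" using finite_superlevel_tendsto_0[OF assms(1) that] .
    have "{n. a n > t} \<noteq> {}" using k by (metis N_def card.empty not_less_zero)
    \<comment> \<open>\<open>N\<close> is constant on the interval from \<open>t\<close> up to the
      least value \<open>m\<close> above \<open>t\<close>. This right continuity makes the
      inequality \<open>s k > t\<close> strict.\<close>
    define m where "m = Min (a ` {n. a n > t})"
    have "m \<in> a ` {n. a n > t}" unfolding m_def using fin \<open>{n. a n > t} \<noteq> {}\<close> by (intro Min_in) auto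
    hence m: "m > t" by auto
    have N_eq: "N u = N t" if "t \<le> u" "u < m" for u
    proof -
      have "{n. a n > u} = {n. a n > t}"
      proof safe
        fix n assume "a n > t"
        hence "m \<le> a n" unfolding m_def using fin by (intro Min_le) auto
        thus "a n > u" using that by simp
      qed (use that in auto)
      thus ?thesis by (simp add: N_def)
    qed
    have ge_m: "u \<ge> m" if "u \<in> A k" for u
    proof (rule ccontr)
      assume "\<not> u \<ge> m"
      with N_eq[of u] mono[of u t] have "N t \<le> N u"
        using that by (cases "u < t") (auto simp: A_def)
      with k that show False by (auto simp: A_def)
    qed
    have "s k \<ge> m" unfolding s_def using ne ge_m by (intro cInf_greatest) auto
    thus "s k > t" using m by simp
  qed
  have "decseq s"
  proof (rule decseq_SucI)
    fix k show "s (Suc k) \<le> s k"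
      unfolding s_def using ne bdd by (intro cInf_superset_mono) (auto simp: A_def)
  qed
  moreover have "s \<longlonglongrightarrow> 0"
  proof (rule order_tendstoI)
    fix y :: real assume "y < 0" thus "eventually (\<lambda>k. s k > y) sequentially"
      using s_nonneg by (auto intro!: always_eventually elim: less_le_trans)
  next
    fix y :: real assume "y > 0"
    hence y: "y / 2 > 0" by simp
    have "s k < y" if "k \<ge> N (y / 2)" for k
      using key[OF y, of k] that \<open>y > 0\<close> by auto
    thus "eventually (\<lambda>k. s k < y) sequentially" unfolding eventually_sequentially by blast
  qed
  moreover have "card {n. s n = t} = card {n. a n = t}" if "t > 0" for t
  proof -
    have sup: "card {k. s k > u} = N u" if "u > 0" for u
      using key[OF that] by simp
    have fin: "finite {k. s k > u}" if "u > 0" for u using key[OF that] by simp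
    have fin': "finite {n. a n > u}" if "u > 0" for u using finite_superlevel_tendsto_0[OF assms(1) that] .
    \<comment> \<open>The largest element \<open>u\<close> of \<open>F\<close> lies so close below
      \<open>t\<close> that neither sequence has a value strictly between \<open>u\<close> and
      \<open>t\<close>. The counts above \<open>u\<close> and above \<open>t\<close> then differ by
      the multiplicity of \<open>t\<close>. The entry \<open>t / 2\<close> keeps \<open>F\<close>
      nonempty and \<open>u\<close> positive.\<close>
    define F where "F = insert (t / 2) ((a ` {n. a n > t / 2} \<union> s ` {n. s n > t / 2}) \<inter> {..<t})"
    have F: "finite F" "F \<noteq> {}" using fin[of "t / 2"] fin'[of "t / 2"] \<open>t > 0\<close> by (simp_all add: F_def del: less_divide_eq_numeral1)
    define u where "u = Max F"
    have "u \<in> F" unfolding u_def using F by (rule Max_in)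
    hence u: "u < t" "u \<ge> t / 2" "u > 0" using \<open>t > 0\<close> by (auto simp: F_def)
    have F_le: "v \<le> u" if "v \<in> F" for v unfolding u_def using F that by auto
    have a_gt: "a n > u \<longleftrightarrow> a n = t \<or> a n > t" for n
      using u F_le[of "a n"] by (force simp: F_def)
    have s_gt: "s n > u \<longleftrightarrow> s n = t \<or> s n > t" for n
      using u F_le[of "s n"] by (force simp: F_def)
    have "card {n. a n > u} = card {n. a n = t} + card {n. a n > t}"
      unfolding a_gt Collect_disj_eq
      by (rule card_Un_disjoint) (use fin'[OF \<open>t > 0\<close>] fin'[OF u(3)] a_gt in \<open>auto intro: finite_subset[of _ "{n. a n > u}"]\<close>)
    moreover have "card {n. s n > u} = card {n. s n = t} + card {n. s n > t}"
      unfolding s_gt Collect_disj_eq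
      by (rule card_Un_disjoint) (use fin[OF \<open>t > 0\<close>] fin[OF u(3)] s_gt in \<open>auto intro: finite_subset[of _ "{n. s n > u}"]\<close>)
    ultimately show ?thesis using sup[OF u(3)] sup[OF \<open>t > 0\<close>] by (simp add: N_def)
  qed
  ultimately show "\<exists>s. decseq s \<and> s \<longlonglongrightarrow> (0::real) \<and> (\<forall>t>0. card {n. s n = t} = card {n. a n = t})" by blast
next
  fix s r :: "nat \<Rightarrow> real"
  assume s: "decseq s \<and> s \<longlonglongrightarrow> 0 \<and> (\<forall>t>0. card {n. s n = t} = card {n. a n = t})"
  assume r: "decseq r \<and> r \<longlonglongrightarrow> 0 \<and> (\<forall>t>0. card {n. r n = t} = card {n. a n = t})"
  have iff: "s k > x \<longleftrightarrow> r k > x" if "x > 0" for k x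
    using s r that decseq_superlevel[of s x k] decseq_superlevel[of r x k]
      finite_superlevel_tendsto_0[of s x] finite_superlevel_tendsto_0[of r x]
      card_superlevel_eq[of s r x] by simp
  have nonneg: "s k \<ge> 0" "r k \<ge> 0" for k
    using s r decseq_ge[of s 0 k] decseq_ge[of r 0 k] by auto
  show "s = r"
  proof
    fix k show "s k = r k"
    proof (rule linorder_cases[of "s k" "r k"])
      assume "s k < r k"
      \<comment> \<open>The midpoint is a positive level separating the two values.\<close>
      with iff[of "(s k + r k) / 2" k] nonneg[of k] show ?thesis by (auto simp: field_simps)
    next
      assume "s k > r k"
      with iff[of "(s k + r k) / 2" k] nonneg[of k] show ?thesis by (auto simp: field_simps)
    qed
  qed
qed

text \<open>Identifies the definite description in \<open>singular_numbers\<close> with the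
  rearrangement of \<open>a\<close>. Counting above \<open>x\<close> does not see the order, so from
  here on only the unsorted sequence \<open>a\<close> matters.\<close>

lemma singular_count_eq_card:
  assumes "a \<longlonglongrightarrow> 0" "\<And>n. a n \<ge> 0" "x > 0"
    and dim: "\<And>t. t > 0 \<Longrightarrow> cfun.dim (singular_space T t) = card {n::nat. a n = t}"
  shows "singular_count x T = card {n. a n > x}"
proof -
  have "singular_numbers T =
      (THE s. decseq s \<and> s \<longlonglongrightarrow> 0 \<and> (\<forall>t>0. card {n. s n = t} = card {n. a n = t}))"
    unfolding singular_numbers_def using dim by (intro arg_cong[where f = The] ext) auto
  with theI'[OF decreasing_rearrangement_ex1[OF assms(1,2)]]
  have "singular_numbers T \<longlonglongrightarrow> 0 \<and> (\<forall>t>0. card {n. singular_numbers T n = t} = card {n. a n = t})"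
    by simp
  thus ?thesis unfolding singular_count_def
    using assms(1,3) by (intro card_superlevel_eq) auto
qed

section \<open>Moments\<close>

lemma powr_superlinear:
  fixes p :: real
  assumes "p > 1"
  obtains K where "\<And>t. t \<ge> 0 \<Longrightarrow> t - K \<le> t powr p / 2"
proof
  fix t :: real assume "t \<ge> 0"
  \<comment> \<open>The positive solution of \<open>t = t powr p / 2\<close>.\<close>
  define K where "K = 2 powr (1 / (p - 1))"
  show "t - 2 powr (1 / (p - 1)) \<le> t powr p / 2"
  proof (cases "t \<le> K")
    case False
    have "K > 0" by (simp add: K_def)
    hence "t > 0" using False by linarith
    have "2 = K powr (p - 1)" using assms by (simp add: K_def powr_powr)
    also have "\<dots> \<le> t powr (p - 1)" using False assms \<open>K > 0\<close> by (intro powr_mono2) auto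
    finally have "t * 2 \<le> t * t powr (p - 1)" using \<open>t > 0\<close> by simp
    also have "\<dots> = t powr p" using \<open>t > 0\<close> by (simp add: powr_mult_base)
    finally show ?thesis using powr_ge_zero[of 2 "1 / (p - 1)"] by linarith
  qed (simp add: K_def[symmetric] order.trans[of _ 0])
qed

text \<open>The weight is split in two. One half of \<open>t powr p\<close> yields the integrable
  factor \<open>exp (- t)\<close>; the other half is left to control \<open>t ^ n\<close>. With
  \<open>y = t powr p\<close> the latter asks for the maximum of
  \<open>y powr (n / p) * exp (- y / 2)\<close>, attained at \<open>m = 2 * n / p\<close>, and the
  tangent of \<open>ln\<close> at \<open>m\<close> gives the bound.\<close>

lemma power_times_exp_minus_powr_le:
  fixes p t K :: real
  assumes "p > 1" "t \<ge> 0" "n > 0" and K: "t - K \<le> t powr p / 2"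
  shows "t ^ n * exp (- (t powr p)) \<le> exp K * (2 * real n / p) powr (real n / p) * exp (- t)"
proof (cases "t = 0")
  case True
  thus ?thesis using assms(3) by (simp add: zero_power)
next
  case False
  hence t: "t > 0" using assms(2) by simp
  define y where "y = t powr p"
  have y: "y > 0" "ln y = p * ln t" using t by (simp_all add: y_def ln_powr)
  define m where "m = 2 * real n / p"
  have m: "m > 0" using assms by (simp add: m_def)
  have "ln (y / m) \<le> y / m - 1" using y m by (intro ln_le_minus_one) auto
  hence "ln y \<le> ln m + y / m - 1" using y m by (simp add: ln_div)
  hence "real n / p * ln y \<le> real n / p * (ln m + y / m - 1)"
    using assms by (intro mult_left_mono) auto
  moreover have "real n / p * ln y = real n * ln t" using y assms by simp
  moreover have "real n / p * (y / m) = y / 2" using assms by (simp add: m_def)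
  moreover have "real n / p \<ge> 0" using assms by simp
  moreover have "real n / p * (ln m + y / m - 1) = real n / p * ln m + real n / p * (y / m) - real n / p"
    by (simp only: distrib_left right_diff_distrib mult_1_right)
  ultimately have "real n * ln t - y \<le> real n / p * ln m - y / 2"
    by linarith
  also have "\<dots> \<le> K + real n / p * ln m - t" using K by (simp add: y_def)
  finally have "exp (real n * ln t - y) \<le> exp (K + real n / p * ln m - t)" by simp
  moreover have "exp (real n * ln t - y) = t ^ n * exp (- (t powr p))"
    using t by (simp add: exp_diff exp_minus divide_inverse y_def exp_of_nat_mult)
  moreover have "exp (K + real n / p * ln m - t) = exp K * m powr (real n / p) * exp (- t)"
    using m by (simp add: powr_def exp_diff exp_add exp_minus divide_inverse)
  ultimately show ?thesis by (simp only: m_def)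
qed

text \<open>The remaining integral of \<open>exp (- t)\<close> is 1, so \<open>K\<close> depends
  neither on \<open>n\<close> nor on \<open>f\<close>. The general \<open>f\<close> covers every
  bounded factor \<open>s\<close>, and the exponent \<open>p\<close> is later replaced by
  \<open>q\<close> as well.\<close>

lemma set_integral_power_times_exp_minus_powr_bound:
  fixes p :: real
  assumes "p > 1"
  obtains K where "K > 0"
    "\<And>n f. n > 0 \<Longrightarrow> f \<in> borel_measurable borel \<Longrightarrow>
       (\<And>t. t \<ge> 0 \<Longrightarrow> \<bar>f t\<bar> \<le> t ^ n * exp (- (t powr p))) \<Longrightarrow>
       set_integrable lborel {0..} f \<and> \<bar>LBINT t:{0..}. f t\<bar> \<le> K * (2 * real n / p) powr (real n / p)"
proof -
  obtain K where K: "\<And>t. t \<ge> 0 \<Longrightarrow> t - K \<le> t powr p / 2"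
    using powr_superlinear[OF assms] by blast
  show ?thesis
  proof (rule that[of "exp K"])
    fix n :: nat and f :: "real \<Rightarrow> real"
    assume n: "n > 0" and [measurable]: "f \<in> borel_measurable borel"
      and f: "\<And>t. t \<ge> 0 \<Longrightarrow> \<bar>f t\<bar> \<le> t ^ n * exp (- (t powr p))"
    define B where "B = exp K * (2 * real n / p) powr (real n / p)"
    have g: "has_bochner_integral lborel (\<lambda>x. B * (exp (- x) * indicator {0..} x)) (B * 1)"
      using has_bochner_integral_I0i_power_exp_m'[of 0] by (intro has_bochner_integral_mult_right) simp
    have le: "norm (indicator {0..} t *\<^sub>R f t) \<le> B * (exp (- t) * indicator {0..} t)" for t
      using order.trans[OF f power_times_exp_minus_powr_le[OF assms _ n K], of t]
      by (auto simp: indicator_def B_def)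
    have int: "integrable lborel (\<lambda>t. indicator {0..} t *\<^sub>R f t)"
      by (rule Bochner_Integration.integrable_bound[OF integrable.intros[OF g]]) (use le in \<open>auto intro!: AE_I2 intro: order.trans[OF _ abs_ge_self]\<close>)
    have "\<bar>LBINT t:{0..}. f t\<bar> \<le> (LBINT t. norm (indicator {0..} t *\<^sub>R f t))"
      unfolding set_lebesgue_integral_def real_norm_def[symmetric] by (rule integral_norm_bound)
    also have "\<dots> \<le> (LBINT x. B * (exp (- x) * indicator {0..} x))"
      using int integrable.intros[OF g] le by (intro integral_mono integrable_norm) auto
    also have "\<dots> = B" using has_bochner_integral_integral_eq[OF g] by simp
    finally show "set_integrable lborel {0..} f \<and> \<bar>LBINT t:{0..}. f t\<bar> \<le> exp K * (2 * real n / p) powr (real n / p)"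
      using int by (simp add: set_integrable_def B_def)
  qed simp
qed

text \<open>The series of \<open>exp n\<close> is at least its single term
  \<open>n ^ n / fact n\<close>.\<close>

lemma fact_ge_exp: "n > 0 \<Longrightarrow> exp (real n * ln n - n) \<le> fact n"
proof -
  assume n: "n > 0"
  have "(\<lambda>k. real n ^ k /\<^sub>R fact k) sums exp (real n)" by (rule exp_converges)
  hence "(\<Sum>k\<in>{n}. real n ^ k /\<^sub>R fact k) \<le> exp (real n)"
    by (metis (no_types, lifting) finite.emptyI finite_insert sums_iff sum_le_suminf divideR_right
        scaleR_nonneg_nonneg fact_ge_zero inverse_nonnegative_iff_nonnegative of_nat_0_le_iff zero_le_power)
  hence "real n ^ n \<le> exp (real n) * fact n" by (simp add: field_simps)
  moreover have "exp (real n * ln n) = real n ^ n" using n by (simp add: exp_of_nat_mult)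
  ultimately show ?thesis by (simp add: exp_diff field_simps)
qed

lemma fact_le_exp: "n > 0 \<Longrightarrow> fact n \<le> exp (real n * ln n)"
proof -
  assume n: "n > 0"
  have "fact n \<le> real n ^ n" using fact_le_power[where 'a = real, of n] by simp
  also have "\<dots> = exp (real n * ln n)" using n by (simp add: exp_of_nat_mult)
  finally show ?thesis .
qed

lemma moment_ratio_le:
  fixes p K :: real
  assumes "p > 1" "K > 0"
  obtains C where "\<And>n. n > 0 \<Longrightarrow>
    K * (2 * real n / p) powr (real n / p) / fact n \<le> exp (- ((1 - 1 / p) * real n * ln n) + C * real n)"
proof
  fix n :: nat assume n: "n > 0"
  have "K * (2 * real n / p) powr (real n / p) / fact n \<le>
      K * (2 * real n / p) powr (real n / p) / exp (real n * ln n - n)"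
    using fact_ge_exp[OF n] assms by (intro divide_left_mono) auto
  also have "\<dots> = exp (ln K + real n / p * ln (2 * real n / p) - (real n * ln n - n))"
    using assms n by (simp add: exp_add exp_diff powr_def)
  \<comment> \<open>The linear term collects \<open>ln K\<close>, at most
    \<open>\<bar>ln K\<bar> * n\<close> as \<open>n \<ge> 1\<close>, the factor \<open>2 / p\<close>
    inside the power, and the \<open>n\<close> from the bound for the factorial.\<close>
  also have "\<dots> \<le> exp (- ((1 - 1 / p) * real n * ln n) + (\<bar>ln K\<bar> + ln (2 / p) / p + 1) * real n)"
  proof -
    have "ln (2 * real n / p) = ln (2 / p) + ln n" using assms n by (simp add: ln_mult ln_div)
    moreover have "ln K \<le> \<bar>ln K\<bar> * real n"
      using n mult_left_mono[of 1 "real n" "\<bar>ln K\<bar>"] by simp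
    ultimately show ?thesis by (simp add: algebra_simps)
  qed
  finally show "K * (2 * real n / p) powr (real n / p) / fact n \<le>
    exp (- ((1 - 1 / p) * real n * ln n) + (\<bar>ln K\<bar> + ln (2 / p) / p + 1) * real n)" .
qed

text \<open>In the variable \<open>t = exp w\<close> the oscillatory moment is the integral of the following entire
  function over the real line. On the line \<open>Im w = pi / (2 * q)\<close> the oscillating factor has become
  \<open>exp (- (t powr q))\<close>, and the other factor is still bounded by 1 because \<open>p < q\<close>.\<close>

definition osc_exponential :: "real \<Rightarrow> real \<Rightarrow> nat \<Rightarrow> complex \<Rightarrow> complex" where
  "osc_exponential p q n w = exp (of_nat (Suc n) * w - exp (of_real p * w) + \<i> * exp (of_real q * w))"

lemma osc_exponential_holomorphic [holomorphic_intros]: "osc_exponential p q n holomorphic_on A"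
  unfolding osc_exponential_def by (intro holomorphic_intros)

lemma norm_osc_exponential:
  "norm (osc_exponential p q n w) =
     exp (real (Suc n) * Re w - exp (p * Re w) * cos (p * Im w) - exp (q * Re w) * sin (q * Im w))"
  by (simp add: osc_exponential_def norm_exp_eq_Re Re_exp Im_exp)

text \<open>In the closed strip \<open>sin (q * Im w)\<close> is nonnegative, so the rotated factor
  never grows, while \<open>cos (p * Im w)\<close> is smallest on the upper edge. This controls the
  vertical sides of the contour.\<close>

lemma norm_osc_exponential_strip_le:
  assumes "1 < p" "p < q" "0 \<le> Im w" "Im w \<le> pi / (2 * q)"
  shows "norm (osc_exponential p q n w) \<le> exp (real (Suc n) * Re w - cos (pi * p / (2 * q)) * exp (p * Re w))"
proof -
  have q: "q > 0" using assms by linarith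
  have "q * Im w \<le> pi / 2" using assms(4) q by (simp add: field_simps)
  moreover have "0 \<le> q * Im w" using q assms(3) by simp
  ultimately have "sin (q * Im w) \<ge> 0" using pi_ge_zero by (intro sin_ge_zero) linarith+
  moreover have "cos (p * Im w) \<ge> cos (pi * p / (2 * q))"
  proof (rule cos_monotone_0_pi_le)
    show "0 \<le> p * Im w" using assms by simp
    have "p * Im w \<le> p * (pi / (2 * q))" using assms by (intro mult_left_mono) auto
    thus "p * Im w \<le> pi * p / (2 * q)" by (simp add: mult_ac)
    have "pi * p \<le> pi * (2 * q)" using assms by (intro mult_left_mono) auto
    thus "pi * p / (2 * q) \<le> pi" using q by (simp add: field_simps)
  qed
  ultimately have "cos (pi * p / (2 * q)) * exp (p * Re w) \<le> exp (p * Re w) * cos (p * Im w)"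
    "0 \<le> exp (q * Re w) * sin (q * Im w)"
    by simp_all
  thus ?thesis unfolding norm_osc_exponential exp_le_cancel_iff by linarith
qed

lemma norm_osc_exponential_top_le:
  assumes "1 < p" "p < q" "Im w = pi / (2 * q)"
  shows "norm (osc_exponential p q n w) \<le> exp (real (Suc n) * Re w - exp (q * Re w))"
proof -
  have q: "q > 0" using assms by linarith
  have "q * Im w = pi / 2" using assms(3) q by (simp add: field_simps)
  moreover have "cos (p * Im w) \<ge> 0"
  proof (rule cos_ge_zero)
    have "p * Im w \<le> q * Im w" using assms by (intro mult_right_mono) auto
    thus "p * Im w \<le> pi / 2" using \<open>q * Im w = pi / 2\<close> by simp
    have "p * Im w \<ge> 0" using assms by simp
    thus "- (pi / 2) \<le> p * Im w" using pi_gt_zero by linarith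
  qed
  ultimately show ?thesis unfolding norm_osc_exponential by (simp only: sin_pi_half) simp
qed

text \<open>The place where \<open>p < q\<close> is decisive: the rotation stays inside the sector
  in which \<open>exp (- (t powr p))\<close> decays, so the far vertical side disappears in the
  limit.\<close>

lemma cos_half_pi_ratio_pos:
  assumes "1 < p" "p < q"
  shows "cos (pi * p / (2 * q)) > 0"
proof (rule cos_gt_zero_pi)
  have q: "q > 0" using assms by linarith
  have "pi * p < pi * q" using assms by simp
  thus "pi * p / (2 * q) < pi / 2" using q by (simp add: field_simps)
  have "pi * p / (2 * q) > 0" using assms q by simp
  thus "- (pi / 2) < pi * p / (2 * q)" using pi_gt_zero by linarith
qed

text \<open>Division by \<open>t\<close> is the Jacobian of \<open>w = ln t\<close> and is the
  reason for \<open>Suc n\<close> in the exponent. The imaginary part is the oscillatory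
  integrand.\<close>

lemma osc_exponential_ln:
  assumes "t > 0"
  shows "osc_exponential p q n (of_real (ln t)) / of_real t =
    of_real (t ^ n * exp (- (t powr p))) * cis (t powr q)"
proof -
  have "exp (of_nat (Suc n) * of_real (ln t) :: complex) = of_real t * of_real t ^ n"
    using assms by (simp only: exp_of_nat_mult exp_of_real exp_ln power_Suc)
  moreover have "exp (of_real r * of_real (ln t) :: complex) = of_real (t powr r)" for r
    using assms by (simp add: powr_def exp_of_real flip: of_real_mult)
  ultimately show ?thesis
    using assms by (simp add: osc_exponential_def exp_add exp_diff cis_conv_exp exp_minus divide_inverse flip: exp_of_real)
qed

text \<open>Cauchy's theorem on a rectangle of height \<open>\<theta>\<close>, written with a
  primitive \<open>G\<close> instead of contour integrals. The horizontal sides are differences of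
  \<open>G\<close> computed by the fundamental theorem of calculus; the vertical ones are estimated
  by the mean value inequality, so \<open>\<epsilon>\<close> is the length of a side times the bound
  in the strip.\<close>

lemma osc_exponential_segment_bound:
  fixes p q :: real
  assumes pq: "1 < p" "p < q" and ab: "0 < a" "a \<le> b"
    and int: "set_integrable lborel {0..} (\<lambda>t. t ^ n * exp (- (t powr q)))"
  defines "\<epsilon> \<equiv> \<lambda>x. pi / (2 * q) * exp (real (Suc n) * ln x - cos (pi * p / (2 * q)) * exp (p * ln x))"
  shows "\<bar>LBINT t:{a..b}. t ^ n * exp (- (t powr p)) * sin (t powr q)\<bar> \<le>
    (LBINT t:{0..}. t ^ n * exp (- (t powr q))) + \<epsilon> a + \<epsilon> b"
proof -
  define \<theta> where "\<theta> = pi / (2 * q)"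
  have \<theta>: "\<theta> > 0" using pq by (simp add: \<theta>_def)
  let ?g = "osc_exponential p q n"
  obtain G where G: "\<And>w. (G has_field_derivative ?g w) (at w)"
    using holomorphic_convex_primitive'[of UNIV ?g] osc_exponential_holomorphic[of p q n UNIV] by auto
  have I: "((\<lambda>t. ?g (of_real (ln t) + z) / of_real t) has_integral
      G (of_real (ln b) + z) - G (of_real (ln a) + z)) {a..b}" for z
  proof (rule fundamental_theorem_of_calculus[OF ab(2)])
    fix t assume "t \<in> {a..b}"
    hence t: "t > 0" using ab by simp
    have "((\<lambda>t. complex_of_real (ln t) + z) has_vector_derivative of_real (1 / t)) (at t within {a..b})"
      using t by (auto intro!: derivative_eq_intros simp: has_real_derivative_iff_has_vector_derivative[symmetric])
    from field_vector_diff_chain_within[OF this, of G "?g (of_real (ln t) + z)"] G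
    show "((\<lambda>t. G (of_real (ln t) + z)) has_vector_derivative ?g (of_real (ln t) + z) / of_real t) (at t within {a..b})"
      by (simp add: o_def has_field_derivative_at_within)
  qed
  have vert: "norm (G (of_real x + \<i> * of_real \<theta>) - G (of_real x)) \<le> \<epsilon> (exp x)" for x
  proof -
    define S where "S = closed_segment (of_real x) (of_real x + \<i> * of_real \<theta>)"
    have "norm (G (of_real x + \<i> * of_real \<theta>) - G (of_real x)) \<le>
        exp (real (Suc n) * x - cos (pi * p / (2 * q)) * exp (p * x)) * norm (of_real x + \<i> * of_real \<theta> - of_real x)"
    proof (rule field_differentiable_bound[where S = S])
      fix w assume "w \<in> S"
      hence "Re w = x" "0 \<le> Im w" "Im w \<le> \<theta>"
        using \<theta> by (auto simp: S_def closed_segment_def algebra_simps mult_le_cancel_right1 intro: mult_left_le)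
      thus "norm (?g w) \<le> exp (real (Suc n) * x - cos (pi * p / (2 * q)) * exp (p * x))"
        using norm_osc_exponential_strip_le[OF pq, of w n] by (simp add: \<theta>_def)
    qed (use G in \<open>auto simp: S_def intro: has_field_derivative_at_within\<close>)
    moreover have "norm (complex_of_real x + \<i> * of_real \<theta> - of_real x) = \<theta>"
      using \<theta> by (simp add: norm_mult)
    ultimately show ?thesis by (simp only: \<epsilon>_def \<theta>_def ln_exp mult.commute[of "pi / (2 * q)"])
  qed
  have top: "norm (G (of_real (ln b) + \<i> * of_real \<theta>) - G (of_real (ln a) + \<i> * of_real \<theta>)) \<le>
      (LBINT t:{0..}. t ^ n * exp (- (t powr q)))"
  proof -
    have int': "set_integrable lborel {a..b} (\<lambda>t. t ^ n * exp (- (t powr q)))"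
      by (rule set_integrable_subset[OF int]) (use ab in auto)
    have "norm (integral {a..b} (\<lambda>t. ?g (of_real (ln t) + \<i> * of_real \<theta>) / of_real t)) \<le>
        integral {a..b} (\<lambda>t. t ^ n * exp (- (t powr q)))"
    proof (rule integral_norm_bound_integral)
      fix t assume "t \<in> {a..b}"
      hence t: "t > 0" using ab by simp
      have "norm (?g (of_real (ln t) + \<i> * of_real \<theta>)) \<le> exp (real (Suc n) * ln t - exp (q * ln t))"
        using norm_osc_exponential_top_le[OF pq, of "of_real (ln t) + \<i> * of_real \<theta>" n] by (simp add: \<theta>_def)
      also have "\<dots> = t * (t ^ n * exp (- (t powr q)))"
        using t by (simp only: exp_diff exp_of_nat_mult exp_ln power_Suc powr_def)
           (simp add: exp_minus divide_inverse)
      finally show "norm (?g (of_real (ln t) + \<i> * of_real \<theta>) / of_real t) \<le> t ^ n * exp (- (t powr q))"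
        using t by (simp add: norm_divide pos_divide_le_eq mult_ac)
    qed (use I int' set_borel_integral_eq_integral in \<open>auto simp: integrable_on_def\<close>)
    also have "\<dots> = (LBINT t:{a..b}. t ^ n * exp (- (t powr q)))"
      using int' set_borel_integral_eq_integral by metis
    also have "\<dots> \<le> (LBINT t:{0..}. t ^ n * exp (- (t powr q)))"
      unfolding set_lebesgue_integral_def
      by (rule integral_mono) (use ab int int' in \<open>auto simp: set_integrable_def indicator_def\<close>)
    finally show ?thesis using integral_unique[OF I] by simp
  qed
  have "(LBINT t:{a..b}. t ^ n * exp (- (t powr p)) * sin (t powr q)) = Im (G (of_real (ln b)) - G (of_real (ln a)))"
  proof -
    have cont: "continuous_on {a..b} (\<lambda>t. t ^ n * exp (- (t powr p)) * sin (t powr q))"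
      using ab by (intro continuous_intros) auto
    have "((\<lambda>t. Im (?g (of_real (ln t) + 0) / of_real t)) has_integral Im (G (of_real (ln b) + 0) - G (of_real (ln a) + 0))) {a..b}"
      by (rule has_integral_Im[OF I])
    also have "?this \<longleftrightarrow> ((\<lambda>t. t ^ n * exp (- (t powr p)) * sin (t powr q)) has_integral Im (G (of_real (ln b) + 0) - G (of_real (ln a) + 0))) {a..b}"
      by (rule has_integral_cong) (use ab in \<open>auto simp: osc_exponential_ln\<close>)
    finally show ?thesis
      using set_borel_integral_eq_integral(2)[OF borel_integrable_atLeastAtMost'[OF cont]]
      by (simp add: integral_unique)
  qed
  also have "\<bar>\<dots>\<bar> \<le> norm (G (of_real (ln b)) - G (of_real (ln a)))" by (rule abs_Im_le_cmod)
  \<comment> \<open>The bottom side is replaced by the path over the other three sides of the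
    rectangle.\<close>
  also have "\<dots> \<le> norm (G (of_real (ln b) + \<i> * of_real \<theta>) - G (of_real (ln b))) +
      norm (G (of_real (ln b) + \<i> * of_real \<theta>) - G (of_real (ln a) + \<i> * of_real \<theta>)) +
      norm (G (of_real (ln a) + \<i> * of_real \<theta>) - G (of_real (ln a)))"
    by norm
  also have "\<dots> \<le> \<epsilon> b + (LBINT t:{0..}. t ^ n * exp (- (t powr q))) + \<epsilon> a"
    using vert[of "ln b"] vert[of "ln a"] top ab by simp
  finally show ?thesis by simp
qed

text \<open>The half line is exhausted by the intervals from \<open>1 / Suc k\<close> to
  \<open>Suc k\<close>. The vertical side on the right vanishes in the limit by the decay with rate
  \<open>\<kappa> > 0\<close>, the one on the left by the power \<open>Suc n\<close> of the
  endpoint.\<close>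

lemma oscillatory_moment_le:
  fixes p q :: real
  assumes pq: "1 < p" "p < q" and n: "n > 0"
    and intp: "set_integrable lborel {0..} (\<lambda>t. t ^ n * exp (- (t powr p)) * sin (t powr q))"
    and int: "set_integrable lborel {0..} (\<lambda>t. t ^ n * exp (- (t powr q)))"
  shows "\<bar>LBINT t:{0..}. t ^ n * exp (- (t powr p)) * sin (t powr q)\<bar> \<le>
    (LBINT t:{0..}. t ^ n * exp (- (t powr q)))"
proof (rule LIMSEQ_le)
  define f where "f = (\<lambda>t. t ^ n * exp (- (t powr p)) * sin (t powr q))"
  define \<epsilon> where "\<epsilon> x = pi / (2 * q) * exp (real (Suc n) * ln x - cos (pi * p / (2 * q)) * exp (p * ln x))" for x
  define \<kappa> where "\<kappa> = cos (pi * p / (2 * q))"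
  have \<kappa>: "\<kappa> > 0" using cos_half_pi_ratio_pos[OF pq] by (simp add: \<kappa>_def)
  have lim: "(\<lambda>k. LBINT t:{1 / real (Suc k)..real (Suc k)}. f t) \<longlonglongrightarrow> (LBINT t:{0..}. f t)"
    unfolding set_lebesgue_integral_def
  proof (rule integral_dominated_convergence[where w = "\<lambda>t. norm (indicator {0..} t *\<^sub>R f t)"])
    show "AE t in lborel. (\<lambda>k. indicator {1 / real (Suc k)..real (Suc k)} t *\<^sub>R f t) \<longlonglongrightarrow> indicator {0..} t *\<^sub>R f t"
    proof (rule AE_I2)
      fix t :: real
      show "(\<lambda>k. indicator {1 / real (Suc k)..real (Suc k)} t *\<^sub>R f t) \<longlonglongrightarrow> indicator {0..} t *\<^sub>R f t"
      proof (cases "t > 0")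
        case True
        have "eventually (\<lambda>k. 1 / real (Suc k) \<le> t) sequentially" "eventually (\<lambda>k. t \<le> real (Suc k)) sequentially"
          using True by real_asymp+
        hence "eventually (\<lambda>k. indicator {1 / real (Suc k)..real (Suc k)} t *\<^sub>R f t = indicator {0..} t *\<^sub>R f t) sequentially"
          by eventually_elim (use True in auto)
        thus ?thesis by (rule tendsto_eventually)
      next
        case False
        \<comment> \<open>The point 0 lies in none of the intervals; \<open>n > 0\<close> makes the
          integrand vanish there.\<close>
        have "f 0 = 0" using n by (simp add: f_def)
        have "indicator {1 / real (Suc k)..real (Suc k)} t = (0::real)" for k
          using False order.strict_trans2[of 0 "1 / real (Suc k)" t] by (auto simp: indicator_def)
        moreover have "indicator {0..} t *\<^sub>R f t = 0"
          using False \<open>f 0 = 0\<close> by (cases "t = 0") auto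
        ultimately show ?thesis by (simp only: scaleR_zero_left tendsto_const)
      qed
    qed
    show "AE t in lborel. norm (indicator {1 / real (Suc k)..real (Suc k)} t *\<^sub>R f t) \<le> norm (indicator {0..} t *\<^sub>R f t)" for k
      by (intro AE_I2) (auto simp: indicator_def intro: order.trans[rotated])
    show "integrable lborel (\<lambda>t. norm (indicator {0..} t *\<^sub>R f t))"
      using intp by (intro integrable_norm) (simp add: set_integrable_def f_def)
  qed (auto simp: f_def)
  show "(\<lambda>k. \<bar>LBINT t:{1 / real (Suc k)..real (Suc k)}. f t\<bar>) \<longlonglongrightarrow>
      \<bar>LBINT t:{0..}. t ^ n * exp (- (t powr p)) * sin (t powr q)\<bar>"
    using tendsto_rabs[OF lim] by (simp add: f_def)
  have e1: "(\<lambda>k. \<epsilon> (real (Suc k))) \<longlonglongrightarrow> 0"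
    unfolding \<epsilon>_def \<kappa>_def[symmetric] using \<kappa> pq n by real_asymp
  \<comment> \<open>This is \<open>\<epsilon>\<close> at \<open>1 / Suc k\<close> with
    \<open>ln (1 / Suc k)\<close> written as \<open>- ln (Suc k)\<close>.\<close>
  have "(\<lambda>k. pi / (2 * q) * exp (- real (Suc n) * ln (real (Suc k)) - \<kappa> * exp (- p * ln (real (Suc k))))) \<longlonglongrightarrow> 0"
    using \<kappa> pq n by real_asymp
  hence e2: "(\<lambda>k. \<epsilon> (1 / real (Suc k))) \<longlonglongrightarrow> 0"
    unfolding \<epsilon>_def \<kappa>_def[symmetric] by (simp add: ln_div del: of_nat_Suc)
  show "(\<lambda>k. (LBINT t:{0..}. t ^ n * exp (- (t powr q))) + \<epsilon> (1 / real (Suc k)) + \<epsilon> (real (Suc k))) \<longlonglongrightarrow>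
      (LBINT t:{0..}. t ^ n * exp (- (t powr q)))"
    using tendsto_add[OF tendsto_add[OF tendsto_const e2] e1] by simp
  show "\<exists>N. \<forall>k\<ge>N. \<bar>LBINT t:{1 / real (Suc k)..real (Suc k)}. f t\<bar> \<le>
      (LBINT t:{0..}. t ^ n * exp (- (t powr q))) + \<epsilon> (1 / real (Suc k)) + \<epsilon> (real (Suc k))"
    using osc_exponential_segment_bound[OF pq _ _ int] unfolding f_def \<epsilon>_def
    by (intro exI[of _ 0] allI impI) (auto simp: divide_le_eq mult_ge1_I)
qed

section \<open>Lower bounds from a single bump of the sine\<close>

lemma half_le_sin:
  fixes u :: real
  assumes "pi / 6 \<le> u" "u \<le> pi / 6 + 1"
  shows "1 / 2 \<le> sin u"
proof (cases "u \<le> pi / 2")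
  case True
  have "sin (pi / 6) \<le> sin u" using assms True pi_gt_zero by (intro sin_monotone_2pi_le) linarith+
  thus ?thesis by (simp add: sin_30)
next
  case False
  \<comment> \<open>Reflection at \<open>pi / 2\<close>; since \<open>1 < 2 * pi / 3\<close>, the
    point \<open>pi - u\<close> is still at least \<open>pi / 6\<close>.\<close>
  have "sin (pi / 6) \<le> sin (pi - u)" using assms False pi_gt3 by (intro sin_monotone_2pi_le) linarith+
  thus ?thesis by (simp add: sin_30)
qed

text \<open>In the variable \<open>t powr q\<close> the bump is a window
  \<open>[\<alpha>, \<alpha> + 1]\<close> starting at phase \<open>pi / 6\<close> in the first
  admissible period after \<open>x powr q\<close>. The mean value theorem converts its unit length
  into a length in \<open>t\<close>. The phase \<open>\<phi>\<close> is 0 for the positive part of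
  the sine and \<open>pi\<close> for the negative part.\<close>

lemma sine_bump_interval:
  fixes q x \<phi> :: real
  assumes "q > 1" "x \<ge> 14" "0 \<le> \<phi>" "\<phi> \<le> pi"
  obtains a b where "x \<le> a" "a \<le> b" "b \<le> 2 * x" "1 / (q * (2 * x) powr (q - 1)) \<le> b - a"
    "\<And>t. t \<in> {a..b} \<Longrightarrow> 1 / 2 \<le> sin (t powr q - \<phi>)"
proof -
  define k where "k = \<lceil>x powr q / (2 * pi)\<rceil>"
  define \<alpha> where "\<alpha> = 2 * pi * k + \<phi> + pi / 6"
  have "x powr q / (2 * pi) \<le> k" "k \<le> x powr q / (2 * pi) + 1" unfolding k_def by linarith+
  hence "x powr q \<le> 2 * pi * k" "2 * pi * k \<le> x powr q + 2 * pi"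
    using pi_gt_zero by (simp_all add: field_simps)
  hence \<alpha>: "x powr q \<le> \<alpha>" "\<alpha> + 1 \<le> x powr q + 4 * pi + 1"
    using assms(3,4) pi_gt_zero unfolding \<alpha>_def by linarith+
  have "x \<le> x powr q" using powr_mono[of 1 q x] assms by simp
  \<comment> \<open>Hence \<open>4 * pi + 1 < 14 \<le> x \<le> x powr q\<close>, which explains the
    threshold 14.\<close>
  moreover have "pi < 13 / 4" using pi_approx by simp
  ultimately have \<alpha>2: "\<alpha> + 1 \<le> 2 * x powr q" using \<alpha> assms(2) by linarith
  have \<alpha>0: "\<alpha> > 0" using \<alpha>(1) assms(2) less_le_trans[of 0 "x powr q" \<alpha>] by simp
  define a where "a = \<alpha> powr (1 / q)"
  define b where "b = (\<alpha> + 1) powr (1 / q)"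
  have aq: "a powr q = \<alpha>" "b powr q = \<alpha> + 1" using assms(1) \<alpha>0 by (simp_all add: a_def b_def powr_powr)
  have "x = (x powr q) powr (1 / q)" using assms by (simp add: powr_powr)
  also have "\<dots> \<le> a" unfolding a_def using \<alpha> assms by (intro powr_mono2) auto
  finally have xa: "x \<le> a" .
  have ab: "a \<le> b" unfolding a_def b_def using \<alpha>0 assms by (intro powr_mono2) auto
  \<comment> \<open>Doubling \<open>x powr q\<close> costs no more than doubling \<open>x\<close>,
    and this keeps the bump below \<open>2 * x\<close>.\<close>
  have "2 \<le> 2 powr q" using powr_mono[of 1 q "2 :: real"] assms by simp
  hence "2 * x powr q \<le> 2 powr q * x powr q" by (intro mult_right_mono) auto
  with \<alpha>2 have "\<alpha> + 1 \<le> 2 powr q * x powr q" by (rule order.trans)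
  hence "\<alpha> + 1 \<le> (2 * x) powr q" by (simp only: powr_mult)
  hence "b \<le> ((2 * x) powr q) powr (1 / q)" unfolding b_def using \<alpha>0 assms by (intro powr_mono2) auto
  also have "\<dots> = 2 * x" using assms by (simp add: powr_powr)
  finally have b2x: "b \<le> 2 * x" .
  have a0: "a > 0" using xa assms by linarith
  have "a < b" unfolding a_def b_def using \<alpha>0 assms by (intro powr_less_mono2) auto
  then obtain z where z: "a < z" "z < b" "b powr q - a powr q = (b - a) * (q * z powr (q - 1))"
    using MVT2[of a b "\<lambda>t. t powr q" "\<lambda>t. q * t powr (q - 1)"] a0 has_real_derivative_powr[of _ q]
    by auto
  have "1 = (b - a) * (q * z powr (q - 1))" using z(3) aq by simp
  also have "\<dots> \<le> (b - a) * (q * (2 * x) powr (q - 1))"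
    using z a0 b2x assms ab by (intro mult_left_mono powr_mono2) auto
  finally have len: "1 / (q * (2 * x) powr (q - 1)) \<le> b - a"
    using assms by (simp add: divide_le_eq)
  have "1 / 2 \<le> sin (t powr q - \<phi>)" if "t \<in> {a..b}" for t
  proof -
    have "a powr q \<le> t powr q" "t powr q \<le> b powr q" using that a0 assms by (auto intro!: powr_mono2)
    hence "1 / 2 \<le> sin (t powr q - \<phi> - 2 * pi * k)" unfolding aq \<alpha>_def by (intro half_le_sin) linarith+
    also have "\<dots> = sin (t powr q - \<phi>)"
      using sin.plus_of_int[of "t powr q - \<phi> - 2 * pi * k" k] by (simp add: mult_ac)
    finally show ?thesis .
  qed
  with xa ab b2x len show ?thesis by (rule that)
qed

text \<open>Only one bump in \<open>[x, 2 * x]\<close> with \<open>x = n powr (1 / p)\<close> is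
  kept. There \<open>t ^ n \<ge> x ^ n\<close> supplies the full main term
  \<open>exp (n / p * ln n)\<close>, the weight costs at most \<open>exp (2 powr p * n)\<close>, and
  the length of the bump is a power of \<open>n\<close>, negligible at this precision.\<close>

lemma positive_part_moment_ge:
  fixes p q \<phi> :: real
  assumes "p > 1" "q > 1" "0 \<le> \<phi>" "\<phi> \<le> pi"
  obtains C N where
    "\<And>n. n \<ge> N \<Longrightarrow> set_integrable lborel {0..} (\<lambda>t. t ^ n * exp (- (t powr p)) * max (sin (t powr q - \<phi>)) 0) \<Longrightarrow>
      exp (- ((1 - 1 / p) * real n * ln n) - C * real n) \<le>
        (LBINT t:{0..}. t ^ n * exp (- (t powr p)) * max (sin (t powr q - \<phi>)) 0) / fact n"
proof -
  \<comment> \<open>The summands come from the factor \<open>q\<close> in the bump length with the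
    lower bound \<open>1 / 2\<close> of the sine, from \<open>2 powr (q - 1)\<close>, from
    \<open>x powr (q - 1)\<close> through \<open>ln n \<le> n\<close>, and from the weight at
    \<open>2 * x\<close>.\<close>
  define D where "D = ln (2 * q) + (q - 1) * ln 2 + (q - 1) / p + 2 powr p"
  have "\<exists>N. \<forall>n\<ge>N. real n powr (1 / p) \<ge> 14"
  proof -
    have "filterlim (\<lambda>n. real n powr (1 / p)) at_top sequentially" using assms(1) by real_asymp
    thus ?thesis unfolding filterlim_at_top eventually_sequentially by blast
  qed
  then obtain N where N: "\<And>n. n \<ge> N \<Longrightarrow> real n powr (1 / p) \<ge> 14" by blast
  show ?thesis
  proof (rule that[of "max N 1" D])
    fix n
    let ?f = "\<lambda>t. t ^ n * exp (- (t powr p)) * max (sin (t powr q - \<phi>)) 0"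
    assume n: "n \<ge> max N 1" and int: "set_integrable lborel {0..} ?f"
    define x where "x = real n powr (1 / p)"
    have x: "x \<ge> 14" using N n by (simp add: x_def)
    have xp: "x powr p = real n" using assms n by (simp add: x_def powr_powr)
    have lnx: "ln x = ln n / p" using assms n by (simp add: x_def ln_powr)
    obtain a b where ab: "x \<le> a" "a \<le> b" "b \<le> 2 * x" "1 / (q * (2 * x) powr (q - 1)) \<le> b - a"
      and sin: "\<And>t. t \<in> {a..b} \<Longrightarrow> 1 / 2 \<le> sin (t powr q - \<phi>)"
      using sine_bump_interval[OF assms(2) x assms(3,4)] by blast
    define c where "c = x ^ n * exp (- (2 powr p * real n)) / 2"
    have c: "c \<ge> 0" using x by (simp add: c_def)
    have le: "indicator {a..b} t *\<^sub>R c \<le> indicator {0..} t *\<^sub>R ?f t" for t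
    proof (cases "t \<in> {a..b}")
      case True
      have t: "x \<le> t" "t \<le> 2 * x" using True ab by auto
      have "t powr p \<le> (2 * x) powr p" using t x assms by (intro powr_mono2) auto
      also have "\<dots> = 2 powr p * real n" using x by (simp add: powr_mult xp)
      finally have "x ^ n * exp (- (2 powr p * real n)) * (1 / 2) \<le> ?f t"
        using sin[OF True] t x by (intro mult_mono power_mono) auto
      thus ?thesis using True t x by (simp add: c_def)
    next
      case False
      have "0 \<le> ?f t" if "t \<ge> 0" using that by simp
      thus ?thesis using False by (cases "t \<ge> 0") simp_all
    qed
    have "(b - a) * c = (LBINT t:{a..b}. c)"
      using ab by (simp add: set_lebesgue_integral_def)
    also have "\<dots> \<le> (LBINT t:{0..}. ?f t)"
      unfolding set_lebesgue_integral_def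
      by (rule integral_mono) (use le int ab in \<open>auto simp: set_integrable_def\<close>)
    finally have *: "1 / (q * (2 * x) powr (q - 1)) * c \<le> (LBINT t:{0..}. ?f t)"
      using mult_right_mono[OF ab(4) c] by linarith
    have n1: "real n \<ge> 1" using n by simp
    have "exp (- ((1 - 1 / p) * real n * ln n) - D * real n) * exp (real n * ln n) \<le>
      exp (- ln (2 * q) - (q - 1) * (ln 2 + ln x) + real n * ln x - 2 powr p * real n)"
    proof -
      have "ln (2 * q) \<le> ln (2 * q) * real n" using n1 assms by (simp add: mult_le_cancel_left1)
      moreover have "(q - 1) * ln 2 \<le> (q - 1) * ln 2 * real n"
        using n1 assms mult_left_mono[of 1 "real n" "(q - 1) * ln 2"] by simp
      moreover have "(q - 1) / p * ln n \<le> (q - 1) / p * real n"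
        using ln_bound[of "real n"] n1 assms by (intro mult_left_mono) auto
      moreover have "(q - 1) * (ln 2 + ln x) = (q - 1) * ln 2 + (q - 1) / p * ln n"
        by (simp add: lnx ring_distribs)
      moreover have "D * real n = ln (2 * q) * real n + (q - 1) * ln 2 * real n + (q - 1) / p * real n + 2 powr p * real n"
        by (simp only: D_def distrib_right)
      moreover have "(1 - 1 / p) * real n * ln n = real n * ln n - real n * ln x"
        by (simp add: lnx algebra_simps)
      ultimately show ?thesis unfolding exp_add[symmetric] exp_le_cancel_iff by linarith
    qed
    also have "\<dots> = 1 / (q * (2 * x) powr (q - 1)) * c"
    proof -
      have "exp (ln (2 * q)) = 2 * q" using assms by simp
      moreover have "exp ((q - 1) * (ln 2 + ln x)) = (2 * x) powr (q - 1)"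
        using x by (simp add: powr_def ln_mult)
      moreover have "exp (real n * ln x) = x ^ n" using x by (simp add: exp_of_nat_mult)
      ultimately show ?thesis
        unfolding exp_add exp_diff exp_minus c_def by (simp add: field_simps)
    qed
    also note *
    finally have "exp (- ((1 - 1 / p) * real n * ln n) - D * real n) * exp (real n * ln n) \<le> (LBINT t:{0..}. ?f t)" .
    moreover have "exp (- ((1 - 1 / p) * real n * ln n) - D * real n) * fact n \<le>
        exp (- ((1 - 1 / p) * real n * ln n) - D * real n) * exp (real n * ln n)"
      using fact_le_exp[of n] n by (intro mult_left_mono) auto
    ultimately have "exp (- ((1 - 1 / p) * real n * ln n) - D * real n) * fact n \<le> (LBINT t:{0..}. ?f t)"
      by (rule order.trans[rotated])
    thus "exp (- ((1 - 1 / p) * real n * ln n) - D * real n) \<le> (LBINT t:{0..}. ?f t) / fact n"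
      by (simp only: pos_le_divide_eq[OF fact_gt_zero])
  qed
qed

section \<open>Rotations and radial functions in the plane\<close>

lemma borel_measurable_Complex [measurable (raw)]:
  assumes [measurable]: "f \<in> borel_measurable M" "g \<in> borel_measurable M"
  shows "(\<lambda>x. Complex (f x) (g x)) \<in> borel_measurable M"
  unfolding Complex_eq by measurable

text \<open>Makes Tonelli's theorem available in the real coordinates; agreement on boxes
  suffices.\<close>

lemma lborel_complex_eq_distr:
  "(lborel :: complex measure) = distr (lborel \<Otimes>\<^sub>M lborel) borel (\<lambda>(x, y). Complex x y)"
proof (rule lborel_eqI)
  fix l u :: complex assume lu: "\<And>b. b \<in> Basis \<Longrightarrow> l \<bullet> b \<le> u \<bullet> b"
  have le: "Re l \<le> Re u" "Im l \<le> Im u" using lu[of 1] lu[of \<i>] by (simp_all add: Basis_complex_def)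
  have "(\<lambda>(x, y). Complex x y) -` box l u \<inter> space (lborel \<Otimes>\<^sub>M lborel) = {Re l<..<Re u} \<times> {Im l<..<Im u}"
    by (auto simp: box_def Basis_complex_def space_pair_measure)
  hence "emeasure (distr (lborel \<Otimes>\<^sub>M lborel) borel (\<lambda>(x, y). Complex x y)) (box l u) =
      emeasure (lborel \<Otimes>\<^sub>M lborel) ({Re l<..<Re u} \<times> {Im l<..<Im u})"
    by (subst emeasure_distr) auto
  also have "\<dots> = ennreal (Re u - Re l) * ennreal (Im u - Im l)"
    using le by (subst lborel.emeasure_pair_measure_Times) auto
  also have "\<dots> = ennreal (\<Prod>b\<in>Basis. (u - l) \<bullet> b)"
    using le by (simp add: Basis_complex_def ennreal_mult)
  finally show "emeasure (distr (lborel \<Otimes>\<^sub>M lborel) borel (\<lambda>(x, y). Complex x y)) (box l u) =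
    ennreal (\<Prod>b\<in>Basis. (u - l) \<bullet> b)" .
qed simp

lemma nn_integral_lborel_complex:
  assumes [measurable]: "F \<in> borel_measurable borel"
  shows "(\<integral>\<^sup>+z. F z \<partial>lborel) = (\<integral>\<^sup>+x. \<integral>\<^sup>+y. F (Complex x y) \<partial>lborel \<partial>lborel)"
    and "(\<integral>\<^sup>+z. F z \<partial>lborel) = (\<integral>\<^sup>+y. \<integral>\<^sup>+x. F (Complex x y) \<partial>lborel \<partial>lborel)"
proof -
  have "(\<integral>\<^sup>+z. F z \<partial>lborel) = (\<integral>\<^sup>+z. F (Complex (fst z) (snd z)) \<partial>(lborel \<Otimes>\<^sub>M lborel))"
    by (subst lborel_complex_eq_distr, subst nn_integral_distr) (auto simp: case_prod_beta)
  also have "\<dots> = (\<integral>\<^sup>+x. \<integral>\<^sup>+y. F (Complex x y) \<partial>lborel \<partial>lborel)"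
    by (subst lborel.nn_integral_fst[symmetric]) auto
  finally show 1: "(\<integral>\<^sup>+z. F z \<partial>lborel) = (\<integral>\<^sup>+x. \<integral>\<^sup>+y. F (Complex x y) \<partial>lborel \<partial>lborel)" .
  show "(\<integral>\<^sup>+z. F z \<partial>lborel) = (\<integral>\<^sup>+y. \<integral>\<^sup>+x. F (Complex x y) \<partial>lborel \<partial>lborel)"
    unfolding 1 by (rule lborel_pair.Fubini'[symmetric]) measurable
qed

lemma nn_integral_lborel_translate:
  fixes F :: "real \<Rightarrow> ennreal"
  assumes [measurable]: "F \<in> borel_measurable borel"
  shows "(\<integral>\<^sup>+x. F (x + c) \<partial>lborel) = (\<integral>\<^sup>+x. F x \<partial>lborel)"
  using nn_integral_real_affine[of F 1 c] by (simp add: add.commute)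

text \<open>With one coordinate fixed a shear is a translation in the other, so Tonelli reduces the
  claim to translation invariance on the line.\<close>

lemma nn_integral_shear:
  assumes [measurable]: "F \<in> borel_measurable borel"
  shows "(\<integral>\<^sup>+z. F (Complex (Re z + s * Im z) (Im z)) \<partial>lborel) = (\<integral>\<^sup>+z. F z \<partial>lborel)"
    and "(\<integral>\<^sup>+z. F (Complex (Re z) (Im z + s * Re z)) \<partial>lborel) = (\<integral>\<^sup>+z. F z \<partial>lborel)"
proof -
  have "(\<integral>\<^sup>+z. F (Complex (Re z + s * Im z) (Im z)) \<partial>lborel) =
      (\<integral>\<^sup>+y. \<integral>\<^sup>+x. F (Complex (x + s * y) y) \<partial>lborel \<partial>lborel)"
    by (subst nn_integral_lborel_complex(2)) auto
  also have "\<dots> = (\<integral>\<^sup>+y. \<integral>\<^sup>+x. F (Complex x y) \<partial>lborel \<partial>lborel)"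
    by (intro nn_integral_cong nn_integral_lborel_translate) measurable
  finally show "(\<integral>\<^sup>+z. F (Complex (Re z + s * Im z) (Im z)) \<partial>lborel) = (\<integral>\<^sup>+z. F z \<partial>lborel)"
    by (subst nn_integral_lborel_complex(2)) auto
  have "(\<integral>\<^sup>+z. F (Complex (Re z) (Im z + s * Re z)) \<partial>lborel) =
      (\<integral>\<^sup>+x. \<integral>\<^sup>+y. F (Complex x (y + s * x)) \<partial>lborel \<partial>lborel)"
    by (subst nn_integral_lborel_complex(1)) auto
  also have "\<dots> = (\<integral>\<^sup>+x. \<integral>\<^sup>+y. F (Complex x y) \<partial>lborel \<partial>lborel)"
    by (intro nn_integral_cong nn_integral_lborel_translate) measurable
  finally show "(\<integral>\<^sup>+z. F (Complex (Re z) (Im z + s * Re z)) \<partial>lborel) = (\<integral>\<^sup>+z. F z \<partial>lborel)"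
    by (subst nn_integral_lborel_complex(1)) auto
qed

text \<open>A rotation other than the half turn is a product of three shears.\<close>

lemma nn_integral_rotate:
  fixes F :: "complex \<Rightarrow> ennreal"
  assumes [measurable]: "F \<in> borel_measurable borel" and c: "norm c = 1"
  shows "(\<integral>\<^sup>+z. F (c * z) \<partial>lborel) = (\<integral>\<^sup>+z. F z \<partial>lborel)"
proof -
  have *: "(\<integral>\<^sup>+z. F (c * z) \<partial>lborel) = (\<integral>\<^sup>+z. F z \<partial>lborel)"
    if "norm c = 1" "c \<noteq> -1" and [measurable]: "F \<in> borel_measurable borel" for c and F :: "complex \<Rightarrow> ennreal"
  proof -
    define a b where "a = Re c" and "b = Im c"
    have ab: "a\<^sup>2 + b\<^sup>2 = 1" using that(1) by (simp add: a_def b_def cmod_def)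
    have a: "1 + a \<noteq> 0"
    proof
      assume "1 + a = 0"
      hence "a = -1" by simp
      hence "b = 0" using ab by simp
      thus False using that(2) \<open>a = -1\<close> by (auto simp: a_def b_def complex_eq_iff)
    qed
    \<comment> \<open>For \<open>c = cis t\<close> this is \<open>- tan (t / 2)\<close>, which is
      where the half turn has to be excluded.\<close>
    define s where "s = - b / (1 + a)"
    have sb: "1 + s * b = a" and sa: "s + s * a = - b"
    proof -
      have "b * b = (1 - a) * (1 + a)" using ab by (simp add: power2_eq_square algebra_simps)
      thus "1 + s * b = a" using a by (simp add: s_def field_simps)
      have "s * (1 + a) = - b" using a by (simp add: s_def)
      thus "s + s * a = - b" by (simp add: algebra_simps)
    qed
    let ?X = "\<lambda>z. Complex (Re z + s * Im z) (Im z)" and ?Y = "\<lambda>z. Complex (Re z) (Im z + b * Re z)"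
    have "c * z = ?X (?Y (?X z))" for z
    proof (rule complex_eqI)
      have "Re (?X (?Y (?X z))) = (1 + s * b) * Re z + (s + s * (1 + s * b)) * Im z" by (simp add: algebra_simps)
      thus "Re (c * z) = Re (?X (?Y (?X z)))" by (simp add: sb sa a_def[symmetric] b_def[symmetric])
      have "Im (?X (?Y (?X z))) = b * Re z + (1 + s * b) * Im z" by (simp add: algebra_simps)
      thus "Im (c * z) = Im (?X (?Y (?X z)))" by (simp add: sb a_def[symmetric] b_def[symmetric])
    qed
    hence "(\<integral>\<^sup>+z. F (c * z) \<partial>lborel) = (\<integral>\<^sup>+z. F (?X (?Y (?X z))) \<partial>lborel)" by simp
    also have "\<dots> = (\<integral>\<^sup>+z. F (?X (?Y z)) \<partial>lborel)"
      by (rule nn_integral_shear(1)) measurable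
    also have "\<dots> = (\<integral>\<^sup>+z. F (?X z) \<partial>lborel)"
      by (rule nn_integral_shear(2)) measurable
    also have "\<dots> = (\<integral>\<^sup>+z. F z \<partial>lborel)"
      by (rule nn_integral_shear(1)) measurable
    finally show ?thesis .
  qed
  show ?thesis
  proof (cases "c = -1")
    case True
    \<comment> \<open>The half turn is two quarter turns.\<close>
    have "(\<integral>\<^sup>+z. F (c * z) \<partial>lborel) = (\<integral>\<^sup>+z. F (\<i> * (\<i> * z)) \<partial>lborel)"
      by (simp add: True mult.assoc[symmetric])
    also have "\<dots> = (\<integral>\<^sup>+z. F (\<i> * z) \<partial>lborel)"
      by (rule *) (auto simp: complex_eq_iff)
    also have "\<dots> = (\<integral>\<^sup>+z. F z \<partial>lborel)"
      by (rule *) (auto simp: complex_eq_iff)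
    finally show ?thesis .
  qed (use * assms in auto)
qed

text \<open>A disc of squared radius \<open>t\<close> has area \<open>pi * t\<close>, so the
  variable \<open>t = (norm z)\<^sup>2\<close> has constant density. This takes the place of polar
  coordinates.\<close>

lemma distr_norm_square:
  "distr lborel borel (\<lambda>z::complex. (norm z)\<^sup>2) = density lborel (\<lambda>t. ennreal (pi * indicator {0..} t))"
proof -
  let ?N = "density lborel (\<lambda>t. ennreal (pi * indicator {0..} t))"
  \<comment> \<open>The sign makes all upper rays have finite measure, as the uniqueness lemma requires.\<close>
  have eq: "distr lborel borel (\<lambda>z::complex. - (norm z)\<^sup>2) = distr ?N borel uminus"
  proof (rule measure_eqI_lessThan)
    fix x :: real
    have "emeasure (distr lborel borel (\<lambda>z::complex. - (norm z)\<^sup>2)) {x<..} =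
        emeasure lborel {z::complex. (norm z)\<^sup>2 < - x}"
      by (subst emeasure_distr) (auto intro!: arg_cong2[where f = emeasure])
    also have "\<dots> = ennreal (pi * max 0 (- x))"
    proof (cases "x < 0")
      case True
      have "{z::complex. (norm z)\<^sup>2 < - x} = ball 0 (sqrt (- x))"
      proof (intro set_eqI)
        fix z :: complex
        show "z \<in> {z. (norm z)\<^sup>2 < - x} \<longleftrightarrow> z \<in> ball 0 (sqrt (- x))"
          using real_sqrt_less_iff[of "(norm z)\<^sup>2" "- x"] by simp
      qed
      thus ?thesis using True by (simp add: emeasure_ball unit_ball_vol_2)
    next
      case False
      hence "{z::complex. (norm z)\<^sup>2 < - x} = {}" 
        by (auto simp: not_less intro: order.trans[OF _ zero_le_power2])
      thus ?thesis using False by simp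
    qed
    finally have 1: "emeasure (distr lborel borel (\<lambda>z::complex. - (norm z)\<^sup>2)) {x<..} = ennreal (pi * max 0 (- x))" .
    have "emeasure (distr ?N borel uminus) {x<..} = emeasure ?N {..< - x}"
      by (subst emeasure_distr) (auto intro!: arg_cong2[where f = emeasure])
    also have "\<dots> = (\<integral>\<^sup>+t. ennreal pi * indicator {0..< - x} t \<partial>lborel)"
      by (subst emeasure_density) (auto intro!: nn_integral_cong simp: indicator_def)
    also have "\<dots> = ennreal (pi * max 0 (- x))"
      by (subst nn_integral_cmult_indicator) (auto simp: ennreal_mult max_def)
    finally have 2: "emeasure (distr ?N borel uminus) {x<..} = ennreal (pi * max 0 (- x))" .
    show "emeasure (distr lborel borel (\<lambda>z::complex. - (norm z)\<^sup>2)) {x<..} = emeasure (distr ?N borel uminus) {x<..}"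
      unfolding 1 2 ..
    show "emeasure (distr lborel borel (\<lambda>z::complex. - (norm z)\<^sup>2)) {x<..} < \<infinity>" unfolding 1 by simp
  qed simp_all
  have "distr lborel borel (\<lambda>z::complex. (norm z)\<^sup>2) = distr (distr lborel borel (\<lambda>z::complex. - (norm z)\<^sup>2)) borel uminus"
    by (subst distr_distr) (auto simp: o_def)
  also have "\<dots> = distr ?N borel (\<lambda>x. x)" unfolding eq by (subst distr_distr) (auto simp: o_def)
  also have "\<dots> = ?N" by (rule distr_id2) simp
  finally show ?thesis .
qed

section \<open>The Gaussian measure: rotation invariance and radial integrals\<close>

lemma sets_gauss_measure [simp, measurable_cong]: "sets gauss_measure = sets borel"
  by (simp add: gauss_measure_def)

lemma space_gauss_measure [simp]: "space gauss_measure = UNIV"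
  by (simp add: gauss_measure_def)

lemma borel_measurable_gauss_measure [simp]: "borel_measurable gauss_measure = borel_measurable borel"
  by (rule measurable_cong_sets) simp_all

lemma borel_measurable_cnj [measurable (raw)]:
  "f \<in> borel_measurable M \<Longrightarrow> (\<lambda>x. cnj (f x)) \<in> borel_measurable M"
  by (rule borel_measurable_continuous_on[where f = cnj]) (auto intro: continuous_intros)

lemma distr_gauss_measure_rotate:
  assumes "norm c = 1"
  shows "distr gauss_measure gauss_measure ((*) c) = gauss_measure"
proof (rule measure_eqI)
  fix A assume "A \<in> sets (distr gauss_measure gauss_measure ((*) c))"
  hence [measurable]: "A \<in> sets borel" by simp
  have [measurable]: "(*) c -` A \<in> sets borel"
    using measurable_sets[of "(*) c" borel borel A] by simp
  have "emeasure (distr gauss_measure gauss_measure ((*) c)) A = emeasure gauss_measure ((*) c -` A)"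
    by (subst emeasure_distr) auto
  also have "\<dots> = (\<integral>\<^sup>+z. ennreal (exp (- (norm z)\<^sup>2)) * indicator ((*) c -` A) z \<partial>lborel)"
    unfolding gauss_measure_def by (subst emeasure_density) auto
  also have "\<dots> = (\<integral>\<^sup>+z. ennreal (exp (- (norm (c * z))\<^sup>2)) * indicator A (c * z) \<partial>lborel)"
    using assms by (simp add: norm_mult indicator_def)
  also have "\<dots> = (\<integral>\<^sup>+z. ennreal (exp (- (norm z)\<^sup>2)) * indicator A z \<partial>lborel)"
    by (rule nn_integral_rotate[OF _ assms]) measurable
  also have "\<dots> = emeasure gauss_measure A"
    unfolding gauss_measure_def by (subst emeasure_density) auto
  finally show "emeasure (distr gauss_measure gauss_measure ((*) c)) A = emeasure gauss_measure A" .
qed simp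

lemma gauss_measure_radial:
  fixes g :: "real \<Rightarrow> real"
  assumes [measurable]: "g \<in> borel_measurable borel"
  shows "integrable gauss_measure (\<lambda>z. g ((norm z)\<^sup>2)) \<longleftrightarrow> set_integrable lborel {0..} (\<lambda>t. g t * exp (- t))"
    and "(LINT z|gauss_measure. g ((norm z)\<^sup>2)) = pi * (LBINT t:{0..}. g t * exp (- t))"
proof -
  have "integrable gauss_measure (\<lambda>z. g ((norm z)\<^sup>2)) \<longleftrightarrow>
      integrable lborel (\<lambda>z::complex. exp (- (norm z)\<^sup>2) * g ((norm z)\<^sup>2))"
    unfolding gauss_measure_def by (subst integrable_density) auto
  also have "\<dots> \<longleftrightarrow> integrable (distr lborel borel (\<lambda>z::complex. (norm z)\<^sup>2)) (\<lambda>t. exp (- t) * g t)"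
    by (subst integrable_distr_eq) auto
  also have "\<dots> \<longleftrightarrow> integrable lborel (\<lambda>t. pi * (indicator {0..} t * (g t * exp (- t))))"
    unfolding distr_norm_square by (subst integrable_density) (auto simp: mult_ac)
  also have "\<dots> \<longleftrightarrow> set_integrable lborel {0..} (\<lambda>t. g t * exp (- t))"
    by (simp add: set_integrable_def)
  finally show "integrable gauss_measure (\<lambda>z. g ((norm z)\<^sup>2)) \<longleftrightarrow> set_integrable lborel {0..} (\<lambda>t. g t * exp (- t))" .
  have "(LINT z|gauss_measure. g ((norm z)\<^sup>2)) = (LBINT z::complex. exp (- (norm z)\<^sup>2) * g ((norm z)\<^sup>2))"
    unfolding gauss_measure_def by (subst integral_density) auto
  also have "\<dots> = (LINT t|distr lborel borel (\<lambda>z::complex. (norm z)\<^sup>2). exp (- t) * g t)"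
    by (subst integral_distr) auto
  also have "\<dots> = (LBINT t. pi * (indicator {0..} t * (g t * exp (- t))))"
    unfolding distr_norm_square by (subst integral_density) (auto simp: mult_ac)
  also have "\<dots> = pi * (LBINT t:{0..}. g t * exp (- t))"
    by (simp add: set_lebesgue_integral_def)
  finally show "(LINT z|gauss_measure. g ((norm z)\<^sup>2)) = pi * (LBINT t:{0..}. g t * exp (- t))" .
qed

text \<open>Rotation by \<open>pi / (m - n)\<close> preserves the measure and the radial factor but
  multiplies \<open>z ^ m * cnj (z ^ n)\<close> by -1, so the integral is its own negative.\<close>

lemma gauss_monomial_offdiagonal:
  fixes w :: "real \<Rightarrow> complex"
  assumes "m \<noteq> n" and [measurable]: "w \<in> borel_measurable borel"
  shows "(LINT z|gauss_measure. w (norm z) * z ^ m * cnj (z ^ n)) = 0"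
proof -
  define \<theta> where "\<theta> = pi / (real m - real n)"
  define c where "c = cis \<theta>"
  have "c ^ m * cnj c ^ n = cis (real m * \<theta> - real n * \<theta>)"
    by (simp add: c_def cis_cnj Complex.DeMoivre cis_mult)
  also have "real m * \<theta> - real n * \<theta> = (real m - real n) * \<theta>" by (simp add: left_diff_distrib)
  also have "\<dots> = pi" using assms(1) by (simp add: \<theta>_def)
  finally have c: "c ^ m * cnj c ^ n = -1" by simp
  define I where "I = (LINT z|gauss_measure. w (norm z) * z ^ m * cnj (z ^ n))"
  have "I = (LINT z|distr gauss_measure gauss_measure ((*) c). w (norm z) * z ^ m * cnj (z ^ n))"
    unfolding I_def by (subst distr_gauss_measure_rotate) (auto simp: c_def)
  also have "\<dots> = (LINT z|gauss_measure. w (norm (c * z)) * (c * z) ^ m * cnj ((c * z) ^ n))"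
    by (subst integral_distr) auto
  also have "\<dots> = (LINT z|gauss_measure. (c ^ m * cnj c ^ n) * (w (norm z) * z ^ m * cnj (z ^ n)))"
    by (intro Bochner_Integration.integral_cong refl) (simp add: norm_mult c_def power_mult_distrib mult_ac)
  also have "\<dots> = - I" unfolding c by (simp add: I_def)
  finally show ?thesis by (simp add: I_def)
qed

lemma gauss_monomial_diagonal:
  fixes w :: "real \<Rightarrow> real"
  assumes [measurable]: "w \<in> borel_measurable borel"
  shows "(LINT z|gauss_measure. of_real (w (norm z)) * z ^ n * cnj (z ^ n)) =
    of_real (pi * (LBINT t:{0..}. w (sqrt t) * t ^ n * exp (- t)))"
proof -
  have "(LINT z|gauss_measure. of_real (w (norm z)) * z ^ n * cnj (z ^ n)) =
      (LINT z|gauss_measure. complex_of_real (w (sqrt ((norm z)\<^sup>2)) * ((norm z)\<^sup>2) ^ n))"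
  proof (intro Bochner_Integration.integral_cong refl)
    fix z :: complex
    have "z ^ n * cnj (z ^ n) = (z * cnj z) ^ n" by (simp add: power_mult_distrib)
    also have "\<dots> = of_real (((norm z)\<^sup>2) ^ n)" by (simp only: complex_norm_square[symmetric] of_real_power)
    finally have "z ^ n * cnj (z ^ n) = of_real (((norm z)\<^sup>2) ^ n)" .
    thus "of_real (w (norm z)) * z ^ n * cnj (z ^ n) = of_real (w (sqrt ((norm z)\<^sup>2)) * ((norm z)\<^sup>2) ^ n)"
      by (simp add: mult.assoc)
  qed
  also have "\<dots> = of_real (LINT z|gauss_measure. w (sqrt ((norm z)\<^sup>2)) * ((norm z)\<^sup>2) ^ n)"
    by (rule integral_complex_of_real)
  also have "(LINT z|gauss_measure. w (sqrt ((norm z)\<^sup>2)) * ((norm z)\<^sup>2) ^ n) =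
      pi * (LBINT t:{0..}. w (sqrt t) * t ^ n * exp (- t))"
    by (rule gauss_measure_radial(2)) measurable
  finally show ?thesis .
qed

lemma LBINT_power_exp: "(LBINT t:{0..}. t ^ n * exp (- t :: real)) = fact n"
  and set_integrable_power_exp: "set_integrable lborel {0..} (\<lambda>t::real. t ^ n * exp (- t))"
  using has_bochner_integral_I0i_power_exp_m'[of n]
  by (auto simp: set_lebesgue_integral_def set_integrable_def has_bochner_integral_iff real_scaleR_def mult_ac)

section \<open>Square-integrable functions and their pairing\<close>

lemma gauss_L2_measurable [measurable_dest]: "f \<in> gauss_L2 \<Longrightarrow> f \<in> borel_measurable borel"
  by (simp add: gauss_L2_def)

lemma gauss_L2_integrable: "f \<in> gauss_L2 \<Longrightarrow> integrable gauss_measure (\<lambda>z. (norm (f z))\<^sup>2)"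
  by (simp add: gauss_L2_def)

lemma gauss_L2_bound:
  assumes "f \<in> gauss_L2" "g \<in> gauss_L2" and [measurable]: "h \<in> borel_measurable borel"
    and "\<And>z. (norm (h z))\<^sup>2 \<le> A * (norm (f z))\<^sup>2 + B * (norm (g z))\<^sup>2"
  shows "h \<in> gauss_L2"
proof -
  have "integrable gauss_measure (\<lambda>z. (norm (h z))\<^sup>2)"
  proof (rule Bochner_Integration.integrable_bound)
    show "integrable gauss_measure (\<lambda>z. A * (norm (f z))\<^sup>2 + B * (norm (g z))\<^sup>2)"
      using assms(1,2)[THEN gauss_L2_integrable] by simp
    show "AE z in gauss_measure. norm ((norm (h z))\<^sup>2) \<le> norm (A * (norm (f z))\<^sup>2 + B * (norm (g z))\<^sup>2)"
      using assms(4) by (auto intro!: AE_I2 order.trans[OF _ abs_ge_self])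
  qed measurable
  thus ?thesis by (simp add: gauss_L2_def)
qed

lemma gauss_L2_mult_bounded:
  fixes W :: "complex \<Rightarrow> complex"
  assumes f: "f \<in> gauss_L2" and [measurable]: "W \<in> borel_measurable borel" and W: "\<And>z. norm (W z) \<le> B"
  shows "(\<lambda>z. W z * f z) \<in> gauss_L2"
proof (rule gauss_L2_bound[OF f f, where A = "B\<^sup>2" and B = 0])
  show "(\<lambda>z. W z * f z) \<in> borel_measurable borel" using f by measurable
  show "(norm (W z * f z))\<^sup>2 \<le> B\<^sup>2 * (norm (f z))\<^sup>2 + 0 * (norm (f z))\<^sup>2" for z
    using W[of z] by (simp add: norm_mult power_mult_distrib power_mono mult_right_mono)
qed

lemma gauss_L2_cmult: "f \<in> gauss_L2 \<Longrightarrow> (\<lambda>z. c * f z) \<in> gauss_L2"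
  by (rule gauss_L2_mult_bounded[where B = "norm c"]) auto

lemma gauss_L2_add:
  assumes "f \<in> gauss_L2" "g \<in> gauss_L2"
  shows "(\<lambda>z. f z + g z) \<in> gauss_L2"
proof (rule gauss_L2_bound[OF assms, where A = 2 and B = 2])
  show "(\<lambda>z. f z + g z) \<in> borel_measurable borel" using assms by measurable
  fix z
  have "(norm (f z + g z))\<^sup>2 \<le> (norm (f z) + norm (g z))\<^sup>2" by (intro power_mono norm_triangle_ineq) auto
  also have "\<dots> \<le> 2 * (norm (f z))\<^sup>2 + 2 * (norm (g z))\<^sup>2"
    using sum_squares_bound[of "norm (f z)" "norm (g z)"] by (simp add: power2_sum)
  finally show "(norm (f z + g z))\<^sup>2 \<le> 2 * (norm (f z))\<^sup>2 + 2 * (norm (g z))\<^sup>2" .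
qed

lemma gauss_L2_diff:
  assumes "f \<in> gauss_L2" "g \<in> gauss_L2"
  shows "(\<lambda>z. f z - g z) \<in> gauss_L2"
  using gauss_L2_add[OF assms(1) gauss_L2_cmult[OF assms(2), of "-1"]] by simp

lemma gauss_inner_integrable:
  assumes "f \<in> gauss_L2" "g \<in> gauss_L2"
  shows "integrable gauss_measure (\<lambda>z. f z * cnj (g z))"
proof (rule Bochner_Integration.integrable_bound)
  show "integrable gauss_measure (\<lambda>z. (norm (f z))\<^sup>2 + (norm (g z))\<^sup>2)"
    using assms[THEN gauss_L2_integrable] by simp
  show "(\<lambda>z. f z * cnj (g z)) \<in> borel_measurable gauss_measure" using assms by measurable
  show "AE z in gauss_measure. norm (f z * cnj (g z)) \<le> norm ((norm (f z))\<^sup>2 + (norm (g z))\<^sup>2)"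
  proof (rule AE_I2)
    fix z
    have "norm (f z) * norm (g z) \<ge> 0" by simp
    with sum_squares_bound[of "norm (f z)" "norm (g z)"]
    have "norm (f z) * norm (g z) \<le> (norm (f z))\<^sup>2 + (norm (g z))\<^sup>2" by linarith
    thus "norm (f z * cnj (g z)) \<le> norm ((norm (f z))\<^sup>2 + (norm (g z))\<^sup>2)" by (simp add: norm_mult)
  qed
qed

lemma gauss_inner_diff_left:
  assumes "f \<in> gauss_L2" "g \<in> gauss_L2" "h \<in> gauss_L2"
  shows "gauss_inner (\<lambda>z. f z - g z) h = gauss_inner f h - gauss_inner g h"
  unfolding gauss_inner_def using assms gauss_inner_integrable
  by (simp add: left_diff_distrib)

lemma gauss_inner_commute: "gauss_inner g f = cnj (gauss_inner f g)"
proof -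
  have "cnj (gauss_inner f g) = (LINT z|gauss_measure. cnj (f z * cnj (g z)))"
    unfolding gauss_inner_def by (rule Bochner_Integration.integral_cnj[symmetric])
  thus ?thesis by (simp add: gauss_inner_def mult.commute)
qed

lemma gauss_inner_self: "gauss_inner f f = of_real (LINT z|gauss_measure. (norm (f z))\<^sup>2)"
  unfolding gauss_inner_def integral_complex_of_real[symmetric] complex_norm_square ..

text \<open>A weighted arithmetic-geometric mean inequality standing in for Cauchy-Schwarz.
  Continuity of the pairing in \<open>g\<close> follows by fixing a small \<open>s\<close> first and
  then letting the norm of \<open>g\<close> tend to 0.\<close>

lemma norm_gauss_inner_le:
  assumes "f \<in> gauss_L2" "g \<in> gauss_L2" "s > 0"
  shows "norm (gauss_inner f g) \<le> s * (LINT z|gauss_measure. (norm (f z))\<^sup>2) + (LINT z|gauss_measure. (norm (g z))\<^sup>2) / s"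
proof -
  have "norm (gauss_inner f g) \<le> (LINT z|gauss_measure. norm (f z * cnj (g z)))"
    unfolding gauss_inner_def by (rule integral_norm_bound)
  also have "\<dots> \<le> (LINT z|gauss_measure. s * (norm (f z))\<^sup>2 + (norm (g z))\<^sup>2 / s)"
  proof (rule integral_mono)
    fix z
    have "0 \<le> (s * norm (f z) - norm (g z))\<^sup>2" by simp
    hence "2 * (s * (norm (f z) * norm (g z))) \<le> s * (s * (norm (f z))\<^sup>2) + (norm (g z))\<^sup>2"
      by (simp add: power2_eq_square algebra_simps)
    moreover have "0 \<le> s * (norm (f z) * norm (g z))" using assms(3) by simp
    moreover have "s * (s * (norm (f z))\<^sup>2 + (norm (g z))\<^sup>2 / s) = s * (s * (norm (f z))\<^sup>2) + (norm (g z))\<^sup>2"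
      using assms(3) by (simp add: distrib_left)
    ultimately have "s * (norm (f z) * norm (g z)) \<le> s * (s * (norm (f z))\<^sup>2 + (norm (g z))\<^sup>2 / s)"
      by linarith
    thus "norm (f z * cnj (g z)) \<le> s * (norm (f z))\<^sup>2 + (norm (g z))\<^sup>2 / s"
      using assms(3) by (simp add: norm_mult)
  qed (use assms gauss_inner_integrable[of f g] gauss_L2_integrable in auto)
  also have "\<dots> = s * (LINT z|gauss_measure. (norm (f z))\<^sup>2) + (LINT z|gauss_measure. (norm (g z))\<^sup>2) / s"
    using assms(1,2)[THEN gauss_L2_integrable] by simp
  finally show ?thesis .
qed

section \<open>Power series in the Bargmann space\<close>

lemma taylor_coeffs_ex:
  assumes "f holomorphic_on UNIV"
  obtains a :: "nat \<Rightarrow> complex" where "\<And>z. (\<lambda>n. a n * z ^ n) sums f z"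
proof
  fix z :: complex
  show "(\<lambda>n. (deriv ^^ n) f 0 / fact n * z ^ n) sums f z"
    using holomorphic_power_series[of f 0 "norm z + 1" z] holomorphic_on_subset[OF assms] by simp
qed

lemma holomorphic_sums:
  fixes a :: "nat \<Rightarrow> complex"
  assumes "\<And>z. (\<lambda>n. a n * z ^ n) sums f z"
  shows "f holomorphic_on UNIV"
proof -
  have "f holomorphic_on ball 0 (norm z + 1)" for z :: complex
    by (rule power_series_holomorphic[where a = a]) (use assms in simp)
  hence "f field_differentiable (at z)" for z
    using holomorphic_on_imp_differentiable_at[of f "ball 0 (norm z + 1)" z] by simp
  thus ?thesis by (simp add: holomorphic_on_def field_differentiable_at_within)
qed

lemma bargmannD: "f \<in> bargmann \<Longrightarrow> f \<in> gauss_L2" "f \<in> bargmann \<Longrightarrow> f holomorphic_on UNIV"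
  by (simp_all add: bargmann_def)

lemma holomorphic_borel_measurable: "f holomorphic_on UNIV \<Longrightarrow> f \<in> borel_measurable borel"
  by (intro borel_measurable_continuous_onI holomorphic_on_imp_continuous_on)

lemma monomial_in_bargmann: "(\<lambda>z. z ^ n) \<in> bargmann"
proof -
  have "integrable gauss_measure (\<lambda>z. ((norm z)\<^sup>2) ^ n)"
    using gauss_measure_radial(1)[of "\<lambda>t. t ^ n"] set_integrable_power_exp[of n] by simp
  thus ?thesis
    by (auto simp: bargmann_def gauss_L2_def norm_power power_mult[symmetric] mult.commute intro!: holomorphic_intros)
qed

lemma bargmann_cmult: "f \<in> bargmann \<Longrightarrow> (\<lambda>z. c * f z) \<in> bargmann"
  by (auto simp: bargmann_def gauss_L2_cmult intro!: holomorphic_intros)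

lemma bargmann_add: "f \<in> bargmann \<Longrightarrow> g \<in> bargmann \<Longrightarrow> (\<lambda>z. f z + g z) \<in> bargmann"
  by (auto simp: bargmann_def gauss_L2_add intro!: holomorphic_intros)

lemma bargmann_diff: "f \<in> bargmann \<Longrightarrow> g \<in> bargmann \<Longrightarrow> (\<lambda>z. f z - g z) \<in> bargmann"
  by (auto simp: bargmann_def gauss_L2_diff intro!: holomorphic_intros)

lemma polynomial_in_bargmann: "(\<lambda>z. \<Sum>n<N. a n * z ^ n) \<in> bargmann"
proof (induction N)
  case 0
  show ?case by (auto simp: bargmann_def gauss_L2_def)
next
  case (Suc N)
  thus ?case using bargmann_add bargmann_cmult[OF monomial_in_bargmann] by simp
qed

text \<open>On a disc the partial sums are uniformly bounded, so dominated convergence applies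
  although \<open>f\<close> need not be square-integrable on the plane. Cutting off by a radial
  indicator preserves the orthogonality of the monomials and only truncates their norms.\<close>

lemma disc_parseval:
  fixes a :: "nat \<Rightarrow> complex" and R :: real
  assumes sums: "\<And>z. (\<lambda>n. a n * z ^ n) sums f z" and R: "R \<ge> 0"
  shows "(\<integral>\<^sup>+z. ennreal ((norm (f z))\<^sup>2) * indicator (cball 0 R) z \<partial>gauss_measure) =
    (\<Sum>n. ennreal ((norm (a n))\<^sup>2 * pi * (LBINT t:{0..}. (t ^ n * indicator {..R} (sqrt t)) * exp (- t))))"
proof -
  define S where "S N = (\<lambda>z. \<Sum>n<N. a n * z ^ n)" for N
  define c where "c n = (LBINT t:{0..}. indicator {..R} (sqrt t) * t ^ n * exp (- t))" for n
  define M where "M = (\<Sum>n. norm (a n) * R ^ n)"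
  have [measurable]: "f \<in> borel_measurable borel" "S N \<in> borel_measurable borel" for N
    using holomorphic_borel_measurable[OF holomorphic_sums[OF sums]] by (auto simp: S_def)
  have M: "summable (\<lambda>n. norm (a n) * R ^ n)"
  proof -
    \<comment> \<open>Convergence at the larger radius \<open>R + 1\<close> yields absolute
      convergence at \<open>R\<close>.\<close>
    have "summable (\<lambda>n. a n * of_real (R + 1) ^ n)" using sums by (rule sums_summable)
    hence "summable (\<lambda>n. norm (a n * of_real R ^ n))" by (rule powser_insidea) (use R in auto)
    thus ?thesis using R by (simp add: norm_mult norm_power)
  qed
  have S_le: "norm (S N z) \<le> M" if "norm z \<le> R" for N z
  proof -
    have "norm (S N z) \<le> (\<Sum>n<N. norm (a n) * R ^ n)"
      unfolding S_def by (intro sum_norm_le) (use that in \<open>auto simp: norm_mult norm_power intro!: mult_left_mono power_mono\<close>)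
    also have "\<dots> \<le> M" unfolding M_def using M R by (intro sum_le_suminf) auto
    finally show ?thesis .
  qed
  have S_lim: "(\<lambda>N. S N z) \<longlonglongrightarrow> f z" for z using sums[of z] by (simp add: S_def sums_def)
  have f_le: "norm (f z) \<le> M" if "norm z \<le> R" for z
    by (rule LIMSEQ_le_const2[OF tendsto_norm[OF S_lim]]) (use S_le that in auto)
  have w: "integrable gauss_measure (\<lambda>z. B * indicator (cball 0 R) z :: real)" for B
  proof -
    have "integrable gauss_measure (\<lambda>z. 1 :: real)"
      using bargmannD(1)[OF monomial_in_bargmann[of 0]] by (simp add: gauss_L2_def)
    hence "integrable gauss_measure (\<lambda>z. indicator (cball 0 R) z *\<^sub>R (1 :: real))"
      by (intro integrable_mult_indicator) auto
    thus ?thesis by simp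
  qed
  have int_term: "integrable gauss_measure (\<lambda>z. indicator (cball 0 R) z * z ^ m * cnj (z ^ n))" for m n
  proof -
    have "integrable gauss_measure (\<lambda>z. (indicator (cball 0 R) z * z ^ m) * cnj (z ^ n))"
      by (intro gauss_inner_integrable gauss_L2_mult_bounded[where B = 1] bargmannD(1) monomial_in_bargmann)
        (auto simp: indicator_def)
    thus ?thesis .
  qed
  have eq: "(indicator (cball 0 R) z :: complex) = indicator {..R} (norm z)" for z :: complex
    by (simp add: indicator_def)
  have val: "(LINT z|gauss_measure. indicator (cball 0 R) z * z ^ m * cnj (z ^ n)) =
      (if m = n then of_real (pi * c n) else 0)" for m n
    unfolding eq using gauss_monomial_offdiagonal[of m n "indicator {..R}"]
      gauss_monomial_diagonal[of "indicator {..R}" n]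
    by (simp add: c_def of_real_indicator)
  have int_S: "(LINT z|gauss_measure. indicator (cball 0 R) z * (norm (S N z))\<^sup>2) = (\<Sum>n<N. (norm (a n))\<^sup>2 * pi * c n)" for N
  proof -
    have "complex_of_real (LINT z|gauss_measure. indicator (cball 0 R) z * (norm (S N z))\<^sup>2) =
        (LINT z|gauss_measure. (\<Sum>m<N. \<Sum>n<N. a m * cnj (a n) * (indicator (cball 0 R) z * z ^ m * cnj (z ^ n))))"
      unfolding integral_complex_of_real[symmetric]
    proof (intro Bochner_Integration.integral_cong refl)
      fix z
      have "complex_of_real ((norm (S N z))\<^sup>2) = (\<Sum>m<N. \<Sum>n<N. (a m * z ^ m) * cnj (a n * z ^ n))"
        unfolding complex_norm_square S_def cnj_sum by (rule sum_product)
      thus "complex_of_real (indicator (cball 0 R) z * (norm (S N z))\<^sup>2) =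
          (\<Sum>m<N. \<Sum>n<N. a m * cnj (a n) * (indicator (cball 0 R) z * z ^ m * cnj (z ^ n)))"
        by (simp add: of_real_indicator sum_distrib_left mult_ac)
    qed
    also have "\<dots> = (\<Sum>m<N. \<Sum>n<N. a m * cnj (a n) * (if m = n then of_real (pi * c n) else 0))"
      using int_term by (simp add: val[simplified complex_cnj_power])
    also have "\<dots> = (\<Sum>n<N. a n * cnj (a n) * of_real (pi * c n))"
      by (simp add: if_distrib[of "\<lambda>x. _ * x"] cong: if_cong)
    also have "\<dots> = of_real (\<Sum>n<N. (norm (a n))\<^sup>2 * pi * c n)"
      by (simp add: complex_norm_square[symmetric] mult.assoc flip: of_real_power)
    finally show ?thesis unfolding of_real_eq_iff .
  qed
  have [measurable]: "cball 0 R \<in> sets (borel :: complex measure)" by simp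
  have meas: "(\<lambda>z. indicat_real (cball 0 R) z * (norm (g z))\<^sup>2) \<in> borel_measurable borel"
    if [measurable]: "g \<in> borel_measurable borel" for g :: "complex \<Rightarrow> complex"
    by measurable
  have "(\<lambda>N. LINT z|gauss_measure. indicator (cball 0 R) z * (norm (S N z))\<^sup>2) \<longlonglongrightarrow>
      (LINT z|gauss_measure. indicator (cball 0 R) z * (norm (f z))\<^sup>2)"
  proof (rule integral_dominated_convergence[where w = "\<lambda>z. M\<^sup>2 * indicator (cball 0 R) z"])
    show "AE z in gauss_measure. (\<lambda>N. indicator (cball 0 R) z * (norm (S N z))\<^sup>2) \<longlonglongrightarrow> indicator (cball 0 R) z * (norm (f z))\<^sup>2"
      by (intro AE_I2 tendsto_intros S_lim)
    show "AE z in gauss_measure. norm (indicator (cball 0 R) z * (norm (S N z))\<^sup>2) \<le> M\<^sup>2 * indicator (cball 0 R) z" for N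
      using S_le by (intro AE_I2) (auto simp: indicator_def intro!: power_mono)
  qed (use w meas in auto)
  hence *: "(\<lambda>n. (norm (a n))\<^sup>2 * pi * c n) sums (LINT z|gauss_measure. indicator (cball 0 R) z * (norm (f z))\<^sup>2)"
    unfolding int_S sums_def .
  have c_nonneg: "c n \<ge> 0" for n
    unfolding c_def set_lebesgue_integral_def by (intro Bochner_Integration.integral_nonneg) (auto simp: indicator_def)
  have int_f: "integrable gauss_measure (\<lambda>z. indicator (cball 0 R) z * (norm (f z))\<^sup>2)"
    by (rule Bochner_Integration.integrable_bound[OF w[of "M\<^sup>2"]])
      (use f_le meas in \<open>auto simp: indicator_def intro!: AE_I2 power_mono\<close>)
  have "(\<integral>\<^sup>+z. ennreal ((norm (f z))\<^sup>2) * indicator (cball 0 R) z \<partial>gauss_measure) =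
      (\<integral>\<^sup>+z. ennreal (indicator (cball 0 R) z * (norm (f z))\<^sup>2) \<partial>gauss_measure)"
    by (intro nn_integral_cong) (simp add: indicator_def)
  also have "\<dots> = ennreal (LINT z|gauss_measure. indicator (cball 0 R) z * (norm (f z))\<^sup>2)"
    using int_f by (rule nn_integral_eq_integral) (auto simp: indicator_def)
  also have "\<dots> = (\<Sum>n. ennreal ((norm (a n))\<^sup>2 * pi * c n))"
    using * c_nonneg by (subst suminf_ennreal_eq[OF _ *]) auto
  finally show ?thesis by (simp add: c_def mult_ac)
qed

text \<open>Both sides of the identity on discs increase with the radius, so monotone convergence
  gives it in the extended reals. It can therefore decide whether \<open>f\<close> belongs to the
  space, before square integrability is known.\<close>

theorem bargmann_parseval_nn:
  fixes a :: "nat \<Rightarrow> complex"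
  assumes sums: "\<And>z. (\<lambda>n. a n * z ^ n) sums f z"
  shows "(\<integral>\<^sup>+z. ennreal ((norm (f z))\<^sup>2) \<partial>gauss_measure) = (\<Sum>n. ennreal ((norm (a n))\<^sup>2 * pi * fact n))"
proof -
  define c where "c n k = (LBINT t:{0..}. (t ^ n * indicator {..real k} (sqrt t)) * exp (- t))" for n k
  have [measurable]: "f \<in> borel_measurable borel"
    using holomorphic_borel_measurable[OF holomorphic_sums[OF sums]] .
  have int: "set_integrable lborel {0..} (\<lambda>t. (t ^ n * indicator {..real k} (sqrt t)) * exp (- t))" for n k
    unfolding set_integrable_def
    by (rule Bochner_Integration.integrable_bound[OF set_integrable_power_exp[of n, unfolded set_integrable_def]])
      (auto simp: indicator_def)
  have mono: "c n k \<le> c n l" if "k \<le> l" for n k l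
    unfolding c_def set_lebesgue_integral_def
    by (rule integral_mono) (use int[unfolded set_integrable_def] that in \<open>auto simp: indicator_def\<close>)
  have c_nonneg: "c n k \<ge> 0" for n k
    unfolding c_def set_lebesgue_integral_def by (intro Bochner_Integration.integral_nonneg) (auto simp: indicator_def)
  have c_lim: "(\<lambda>k. c n k) \<longlonglongrightarrow> fact n" for n
    unfolding c_def LBINT_power_exp[symmetric] set_lebesgue_integral_def
  proof (rule integral_dominated_convergence[where w = "\<lambda>t. indicator {0..} t *\<^sub>R (t ^ n * exp (- t))"])
    show "integrable lborel (\<lambda>t::real. indicator {0..} t *\<^sub>R (t ^ n * exp (- t)))"
      using set_integrable_power_exp[of n] by (simp add: set_integrable_def)
    show "AE t in lborel. (\<lambda>k. indicator {0..} t *\<^sub>R (t ^ n * indicator {..real k} (sqrt t) * exp (- t))) \<longlonglongrightarrow>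
        indicator {0..} t *\<^sub>R (t ^ n * exp (- t))"
    proof (rule AE_I2)
      fix t :: real
      have "eventually (\<lambda>k. real k \<ge> sqrt t) sequentially" by real_asymp
      hence "eventually (\<lambda>k. indicator {0..} t *\<^sub>R (t ^ n * indicator {..real k} (sqrt t) * exp (- t)) =
          indicator {0..} t *\<^sub>R (t ^ n * exp (- t))) sequentially"
        by eventually_elim simp
      thus "(\<lambda>k. indicator {0..} t *\<^sub>R (t ^ n * indicator {..real k} (sqrt t) * exp (- t))) \<longlonglongrightarrow>
        indicator {0..} t *\<^sub>R (t ^ n * exp (- t))" by (rule tendsto_eventually)
    qed
  qed (auto simp: indicator_def)
  have [measurable]: "cball 0 r \<in> sets (borel :: complex measure)" for r by simp
  have "(\<lambda>k. \<integral>\<^sup>+z. ennreal ((norm (f z))\<^sup>2) * indicator (cball 0 (real k)) z \<partial>gauss_measure) \<longlonglongrightarrow>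
      (\<integral>\<^sup>+z. ennreal ((norm (f z))\<^sup>2) \<partial>gauss_measure)"
  proof (rule nn_integral_LIMSEQ)
    show "incseq (\<lambda>k z. ennreal ((norm (f z))\<^sup>2) * indicator (cball 0 (real k)) z)"
      by (auto simp: incseq_def le_fun_def indicator_def)
    fix z :: complex
    have "eventually (\<lambda>k. real k \<ge> norm z) sequentially" by real_asymp
    hence "eventually (\<lambda>k. ennreal ((norm (f z))\<^sup>2) * indicator (cball 0 (real k)) z = ennreal ((norm (f z))\<^sup>2)) sequentially"
      by eventually_elim simp
    thus "(\<lambda>k. ennreal ((norm (f z))\<^sup>2) * indicator (cball 0 (real k)) z) \<longlonglongrightarrow> ennreal ((norm (f z))\<^sup>2)"
      by (rule tendsto_eventually)
  qed measurable
  \<comment> \<open>The series is an integral over the counting measure, so monotone convergence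
    serves here too.\<close>
  moreover have "(\<lambda>k. \<Sum>n. ennreal ((norm (a n))\<^sup>2 * pi * c n k)) \<longlonglongrightarrow> (\<Sum>n. ennreal ((norm (a n))\<^sup>2 * pi * fact n))"
    unfolding nn_integral_count_space_nat[symmetric]
  proof (rule nn_integral_LIMSEQ)
    show "incseq (\<lambda>k n. ennreal ((norm (a n))\<^sup>2 * pi * c n k))"
      by (auto simp: incseq_def le_fun_def intro!: ennreal_leI mult_left_mono mono)
    show "(\<lambda>k. ennreal ((norm (a n))\<^sup>2 * pi * c n k)) \<longlonglongrightarrow> ennreal ((norm (a n))\<^sup>2 * pi * fact n)" for n
      by (intro tendsto_ennrealI tendsto_intros c_lim)
  qed simp
  moreover have "(\<integral>\<^sup>+z. ennreal ((norm (f z))\<^sup>2) * indicator (cball 0 (real k)) z \<partial>gauss_measure) =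
      (\<Sum>n. ennreal ((norm (a n))\<^sup>2 * pi * c n k))" for k
    unfolding c_def by (rule disc_parseval[OF sums]) simp
  ultimately show ?thesis by (auto intro: LIMSEQ_unique)
qed

lemma bargmann_coeffs:
  fixes a :: "nat \<Rightarrow> complex"
  assumes sums: "\<And>z. (\<lambda>n. a n * z ^ n) sums f z"
  shows "f \<in> bargmann \<longleftrightarrow> summable (\<lambda>n. (norm (a n))\<^sup>2 * fact n)"
    and "f \<in> bargmann \<Longrightarrow> (\<lambda>n. pi * ((norm (a n))\<^sup>2 * fact n)) sums (LINT z|gauss_measure. (norm (f z))\<^sup>2)"
proof -
  have hol: "f holomorphic_on UNIV" by (rule holomorphic_sums[OF sums])
  hence [measurable]: "f \<in> borel_measurable borel" by (rule holomorphic_borel_measurable)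
  have P: "(\<integral>\<^sup>+z. ennreal ((norm (f z))\<^sup>2) \<partial>gauss_measure) = (\<Sum>n. ennreal (pi * ((norm (a n))\<^sup>2 * fact n)))"
    using bargmann_parseval_nn[OF sums] by (simp add: mult_ac)
  show iff: "f \<in> bargmann \<longleftrightarrow> summable (\<lambda>n. (norm (a n))\<^sup>2 * fact n)"
  proof
    assume "f \<in> bargmann"
    hence "(\<integral>\<^sup>+z. ennreal ((norm (f z))\<^sup>2) \<partial>gauss_measure) \<noteq> \<infinity>"
      using nn_integral_eq_integral[OF gauss_L2_integrable[OF bargmannD(1)]] by simp
    hence "summable (\<lambda>n. pi * ((norm (a n))\<^sup>2 * fact n))"
      unfolding P by (intro summable_suminf_not_top) (auto simp: top_unique)
    thus "summable (\<lambda>n. (norm (a n))\<^sup>2 * fact n)" by (simp add: summable_cmult_iff)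
  next
    assume "summable (\<lambda>n. (norm (a n))\<^sup>2 * fact n)"
    hence "summable (\<lambda>n. pi * ((norm (a n))\<^sup>2 * fact n))" by (rule summable_mult)
    hence "(\<integral>\<^sup>+z. ennreal ((norm (f z))\<^sup>2) \<partial>gauss_measure) < \<infinity>"
      unfolding P by (subst suminf_ennreal2) auto
    hence "integrable gauss_measure (\<lambda>z. (norm (f z))\<^sup>2)"
      by (intro integrableI_nonneg) auto
    thus "f \<in> bargmann" using hol by (simp add: bargmann_def gauss_L2_def)
  qed
  assume f: "f \<in> bargmann"
  hence s: "summable (\<lambda>n. pi * ((norm (a n))\<^sup>2 * fact n))" using iff by (intro summable_mult) simp
  have "ennreal (LINT z|gauss_measure. (norm (f z))\<^sup>2) = (\<integral>\<^sup>+z. ennreal ((norm (f z))\<^sup>2) \<partial>gauss_measure)"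
    by (rule nn_integral_eq_integral[OF gauss_L2_integrable[OF bargmannD(1)[OF f]], symmetric]) simp
  also have "\<dots> = (\<Sum>n. ennreal (pi * ((norm (a n))\<^sup>2 * fact n)))" by (rule P)
  also have "\<dots> = ennreal (\<Sum>n. pi * ((norm (a n))\<^sup>2 * fact n))" by (rule suminf_ennreal2[OF _ s]) simp
  finally have "(LINT z|gauss_measure. (norm (f z))\<^sup>2) = (\<Sum>n. pi * ((norm (a n))\<^sup>2 * fact n))"
    by (subst (asm) ennreal_inj) (auto intro!: suminf_nonneg[OF s])
  thus "(\<lambda>n. pi * ((norm (a n))\<^sup>2 * fact n)) sums (LINT z|gauss_measure. (norm (f z))\<^sup>2)"
    using summable_sums[OF s] by simp
qed

lemma bargmann_series_exists:
  fixes a :: "nat \<Rightarrow> complex"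
  assumes "summable (\<lambda>n. (norm (a n))\<^sup>2 * fact n)"
  obtains f where "f \<in> bargmann" "\<And>z. (\<lambda>n. a n * z ^ n) sums f z"
proof -
  have "summable (\<lambda>n. a n * z ^ n)" for z
  proof (rule summable_comparison_test')
    show "summable (\<lambda>n. (norm (a n))\<^sup>2 * fact n + ((norm z)\<^sup>2) ^ n / fact n)"
      using assms summable_exp[of "(norm z)\<^sup>2"] by (intro summable_add) (simp_all add: divide_inverse mult.commute)
    fix n
    \<comment> \<open>The split by \<open>sqrt (fact n)\<close> makes the squares of
      \<open>x\<close> and \<open>y\<close> the terms of the assumed series and of the exponential
      series at \<open>(norm z)\<^sup>2\<close>.\<close>
    define x y :: real where "x = norm (a n) * sqrt (fact n)" and "y = norm z ^ n / sqrt (fact n)"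
    have "norm (a n * z ^ n) = x * y" by (simp add: x_def y_def norm_mult norm_power)
    also have "\<dots> \<le> x\<^sup>2 + y\<^sup>2"
    proof -
      have "0 \<le> x * y" by (simp add: x_def y_def)
      thus ?thesis using sum_squares_bound[of x y] by linarith
    qed
    also have "\<dots> = (norm (a n))\<^sup>2 * fact n + ((norm z)\<^sup>2) ^ n / fact n"
      by (simp add: x_def y_def power_mult_distrib power_divide power_mult[symmetric] mult.commute)
    finally show "norm (a n * z ^ n) \<le> (norm (a n))\<^sup>2 * fact n + ((norm z)\<^sup>2) ^ n / fact n" .
  qed
  hence sums: "(\<lambda>n. a n * z ^ n) sums (\<Sum>n. a n * z ^ n)" for z by (rule summable_sums)
  with bargmann_coeffs(1)[OF sums] assms that show ?thesis by blast
qed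

text \<open>Parseval's identity for the zero function, expanded with the coefficients
  \<open>a n - b n\<close>, forces each of them to vanish.\<close>

lemma coeffs_unique:
  fixes a b :: "nat \<Rightarrow> complex"
  assumes "\<And>z. (\<lambda>n. a n * z ^ n) sums f z" "\<And>z. (\<lambda>n. b n * z ^ n) sums f z"
  shows "a = b"
proof
  fix n
  have "(\<lambda>n. (a n - b n) * z ^ n) sums 0" for z
    using sums_diff[OF assms(1)[of z] assms(2)[of z]] by (simp add: left_diff_distrib)
  from bargmann_parseval_nn[of "\<lambda>n. a n - b n" "\<lambda>_. 0", OF this]
  have "(\<Sum>n. ennreal ((norm (a n - b n))\<^sup>2 * pi * fact n)) = 0" by simp
  hence "ennreal ((norm (a n - b n))\<^sup>2 * pi * fact n) = 0"
    by (subst (asm) suminf_eq_zero_iff) auto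
  hence "(norm (a n - b n))\<^sup>2 * (pi * fact n) \<le> 0" by (simp add: ennreal_eq_0_iff mult.assoc)
  moreover have "pi * fact n > 0" by simp
  ultimately have "(norm (a n - b n))\<^sup>2 \<le> 0" by (meson mult_le_0_iff not_le)
  thus "a n = b n" by simp
qed

lemma bargmann_eq_zero:
  assumes "f \<in> bargmann" "(LINT z|gauss_measure. (norm (f z))\<^sup>2) = 0"
  shows "f = (\<lambda>z. 0)"
proof -
  obtain a where a: "\<And>z. (\<lambda>n. a n * z ^ n) sums f z"
    using taylor_coeffs_ex[OF bargmannD(2)[OF assms(1)]] by blast
  have "(\<lambda>n. pi * ((norm (a n))\<^sup>2 * fact n)) sums 0"
    using bargmann_coeffs(2)[OF a assms(1)] assms(2) by simp
  hence "a n = 0" for n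
    using suminf_eq_zero_iff[of "\<lambda>n. pi * ((norm (a n))\<^sup>2 * fact n)"] by (auto simp: sums_iff)
  hence "(\<lambda>n. 0) sums f z" for z using a[of z] by simp
  thus ?thesis by (auto simp: fun_eq_iff intro: sums_unique2)
qed

lemma bargmann_eq_if_inner_eq:
  assumes "f \<in> bargmann" "g \<in> bargmann" "\<And>h. h \<in> bargmann \<Longrightarrow> gauss_inner f h = gauss_inner g h"
  shows "f = g"
proof -
  have d: "(\<lambda>z. f z - g z) \<in> bargmann" using assms by (intro bargmann_diff)
  have "gauss_inner (\<lambda>z. f z - g z) (\<lambda>z. f z - g z) = 0"
    using assms d by (subst gauss_inner_diff_left) (auto dest: bargmannD)
  hence "(LINT z|gauss_measure. (norm (f z - g z))\<^sup>2) = 0" by (simp add: gauss_inner_self)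
  from bargmann_eq_zero[OF d this] show ?thesis by (simp add: fun_eq_iff)
qed

text \<open>Only \<open>h\<close> is expanded, since \<open>F\<close> will be a symbol times an
  entire function and has no power series. The Taylor polynomials of \<open>h\<close> converge to it
  in norm by Parseval, and the pairing is continuous.\<close>

lemma gauss_inner_sums:
  fixes b :: "nat \<Rightarrow> complex"
  assumes F: "F \<in> gauss_L2" and h: "h \<in> bargmann" and b: "\<And>z. (\<lambda>n. b n * z ^ n) sums h z"
  shows "(\<lambda>n. cnj (b n) * gauss_inner F (\<lambda>z. z ^ n)) sums gauss_inner F h"
  unfolding sums_def
proof (rule LIM_zero_cancel, rule tendstoI)
  fix e :: real assume e: "e > 0"
  define A where "A = (LINT z|gauss_measure. (norm (F z))\<^sup>2)"
  define B where "B N = (LINT z|gauss_measure. (norm ((\<Sum>n<N. b n * z ^ n) - h z))\<^sup>2)" for N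
  have A: "A \<ge> 0" by (simp add: A_def)
  have B: "B \<longlonglongrightarrow> 0"
  proof -
    have s: "summable (\<lambda>n. pi * ((norm (b n))\<^sup>2 * fact n))"
      using bargmann_coeffs(2)[OF b h] by (rule sums_summable)
    have B_eq: "B N = (\<Sum>n. pi * ((norm (b n))\<^sup>2 * fact n)) - (\<Sum>n<N. pi * ((norm (b n))\<^sup>2 * fact n))" for N
    proof -
      \<comment> \<open>These are the coefficients of the Taylor polynomial minus \<open>h\<close>,
        so its squared norm \<open>B N\<close> is a tail of the Parseval series.\<close>
      define b' where "b' n = (if n < N then 0 else - b n)" for n
      have b': "(\<lambda>n. b' n * z ^ n) sums ((\<Sum>n<N. b n * z ^ n) - h z)" for z
      proof -
        have "(\<lambda>n. if n \<in> {..<N} then b n * z ^ n else 0) sums (\<Sum>n<N. b n * z ^ n)" by (rule sums_If_finite_set) simp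
        from sums_diff[OF this b[of z]] show ?thesis
          by (rule sums_cong[THEN iffD1, rotated]) (simp add: b'_def)
      qed
      have "(\<lambda>n. pi * ((norm (b' n))\<^sup>2 * fact n)) sums B N"
        unfolding B_def
        by (rule bargmann_coeffs(2)[OF b']) (intro bargmann_diff polynomial_in_bargmann h)
      moreover have "(\<lambda>n. pi * ((norm (b n))\<^sup>2 * fact n) - (if n \<in> {..<N} then pi * ((norm (b n))\<^sup>2 * fact n) else 0)) sums
          ((\<Sum>n. pi * ((norm (b n))\<^sup>2 * fact n)) - (\<Sum>n<N. pi * ((norm (b n))\<^sup>2 * fact n)))"
        by (intro sums_diff summable_sums s sums_If_finite_set) simp
      moreover have "pi * ((norm (b' n))\<^sup>2 * fact n) = pi * ((norm (b n))\<^sup>2 * fact n) - (if n \<in> {..<N} then pi * ((norm (b n))\<^sup>2 * fact n) else 0)" for n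
        by (simp add: b'_def)
      ultimately show ?thesis by (simp only: sums_unique2)
    qed
    show ?thesis unfolding B_eq
      using tendsto_diff[OF tendsto_const summable_LIMSEQ[OF s], of "\<Sum>n. pi * ((norm (b n))\<^sup>2 * fact n)"] by simp
  qed
  \<comment> \<open>The weight makes \<open>s * A \<le> e / 2\<close>, also for
    \<open>A = 0\<close>; the other half of \<open>e\<close> is left for
    \<open>B N / s\<close>.\<close>
  define s where "s = e / (2 * (A + 1))"
  have s: "s > 0" using e A by (simp add: s_def)
  have sA: "s * A \<le> e / 2" using e A by (simp add: s_def field_simps)
  have "eventually (\<lambda>N. B N < s * e / 2) sequentially"
    using B by (rule order_tendstoD) (use s e in simp)
  thus "eventually (\<lambda>N. dist ((\<Sum>n<N. cnj (b n) * gauss_inner F (\<lambda>z. z ^ n)) - gauss_inner F h) 0 < e) sequentially"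
  proof eventually_elim
    case (elim N)
    let ?P = "\<lambda>z. \<Sum>n<N. b n * z ^ n"
    have P1: "gauss_inner F ?P = (\<Sum>n<N. cnj (b n) * gauss_inner F (\<lambda>z. z ^ n))"
    proof -
      have "gauss_inner F ?P = (LINT z|gauss_measure. (\<Sum>n<N. cnj (b n) * (F z * cnj (z ^ n))))"
        unfolding gauss_inner_def by (simp add: cnj_sum sum_distrib_left mult_ac)
      also have "\<dots> = (\<Sum>n<N. cnj (b n) * gauss_inner F (\<lambda>z. z ^ n))"
        unfolding gauss_inner_def
        by (subst Bochner_Integration.integral_sum)
          (use gauss_inner_integrable[OF F bargmannD(1)[OF monomial_in_bargmann]] in auto)
      finally show ?thesis .
    qed
    have P2: "gauss_inner F ?P - gauss_inner F h = gauss_inner F (\<lambda>z. ?P z - h z)"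
    proof -
      have "gauss_inner (\<lambda>z. ?P z - h z) F = gauss_inner ?P F - gauss_inner h F"
        by (rule gauss_inner_diff_left) (use F h bargmannD(1) polynomial_in_bargmann in auto)
      thus ?thesis by (simp only: gauss_inner_commute[where g = F] complex_cnj_diff)
    qed
    have "norm (gauss_inner F (\<lambda>z. ?P z - h z)) \<le> s * A + B N / s"
      unfolding A_def B_def
      by (rule norm_gauss_inner_le[OF F _ s]) (intro bargmannD(1) bargmann_diff polynomial_in_bargmann h)
    moreover have "B N / s < e / 2" using elim s by (simp add: field_simps)
    ultimately have "norm (gauss_inner F (\<lambda>z. ?P z - h z)) < e" using sA by linarith
    thus ?case unfolding P1[symmetric] P2 by simp
  qed
qed

lemma gauss_inner_bargmann_monomial:
  fixes a :: "nat \<Rightarrow> complex"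
  assumes "f \<in> bargmann" "\<And>z. (\<lambda>n. a n * z ^ n) sums f z"
  shows "gauss_inner f (\<lambda>z. z ^ n) = of_real (pi * fact n) * a n"
proof -
  \<comment> \<open>Here \<open>f\<close> is expanded in the second slot against a monomial; the
    order is reversed at the end by conjugation.\<close>
  have "(\<lambda>k. cnj (a k) * gauss_inner (\<lambda>z. z ^ n) (\<lambda>z. z ^ k)) sums gauss_inner (\<lambda>z. z ^ n) f"
    by (rule gauss_inner_sums[OF bargmannD(1)[OF monomial_in_bargmann] assms])
  moreover have "gauss_inner (\<lambda>z. z ^ n) (\<lambda>z. z ^ k) = (if k = n then of_real (pi * fact n) else 0)" for k
    using gauss_monomial_offdiagonal[of n k "\<lambda>_. 1"] gauss_monomial_diagonal[of "\<lambda>_. 1" n]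
    by (simp add: gauss_inner_def LBINT_power_exp)
  moreover have "(\<lambda>k. cnj (a k) * (if k = n then of_real (pi * fact n) else 0)) =
      (\<lambda>k. if k = n then cnj (a n) * of_real (pi * fact n) else 0)" by auto
  ultimately have "(\<lambda>k. if k = n then cnj (a n) * of_real (pi * fact n) else 0) sums gauss_inner (\<lambda>z. z ^ n) f"
    by simp
  hence "gauss_inner (\<lambda>z. z ^ n) f = cnj (a n) * of_real (pi * fact n)"
    using sums_unique2 sums_single[of n "\<lambda>_. cnj (a n) * of_real (pi * fact n)"] by metis
  thus ?thesis by (subst gauss_inner_commute) simp
qed

lemma gauss_inner_bargmann_sums:
  fixes a b :: "nat \<Rightarrow> complex"
  assumes "f \<in> bargmann" "\<And>z. (\<lambda>n. a n * z ^ n) sums f z" "g \<in> bargmann" "\<And>z. (\<lambda>n. b n * z ^ n) sums g z"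
  shows "(\<lambda>n. of_real (pi * fact n) * (a n * cnj (b n))) sums gauss_inner f g"
  using gauss_inner_sums[OF bargmannD(1)[OF assms(1)] assms(3,4)]
  by (simp add: gauss_inner_bargmann_monomial[OF assms(1,2)] mult_ac)

section \<open>Diagonal operators\<close>

text \<open>Formulated on all Taylor series and not just on monomials: \<open>T\<close> is an
  arbitrary map on functions, without linearity or continuity by which values on monomials would
  extend.\<close>

definition diagonal_operator ::
  "((complex \<Rightarrow> complex) \<Rightarrow> complex \<Rightarrow> complex) \<Rightarrow> (nat \<Rightarrow> real) \<Rightarrow> bool" where
  "diagonal_operator T \<mu> \<longleftrightarrow> (\<forall>u\<in>bargmann. \<forall>a. (\<forall>z. (\<lambda>n. a n * z ^ n) sums u z) \<longrightarrow>
     T u \<in> bargmann \<and> (\<forall>z. (\<lambda>n. of_real (\<mu> n) * a n * z ^ n) sums T u z))"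

lemma diagonal_operatorD:
  assumes "diagonal_operator T \<mu>" "u \<in> bargmann" "\<And>z. (\<lambda>n. a n * z ^ n) sums u z"
  shows "T u \<in> bargmann" "(\<lambda>n. of_real (\<mu> n) * a n * z ^ n) sums T u z"
  using assms unfolding diagonal_operator_def by blast+

lemma bargmann_taylor:
  assumes "u \<in> bargmann"
  obtains a :: "nat \<Rightarrow> complex" where "\<And>z. (\<lambda>n. a n * z ^ n) sums u z"
    "summable (\<lambda>n. (norm (a n))\<^sup>2 * fact n)"
proof -
  obtain a where a: "\<And>z. (\<lambda>n. a n * z ^ n) sums u z"
    using taylor_coeffs_ex[OF bargmannD(2)[OF assms]] by blast
  from this bargmann_coeffs(1)[OF a] assms show ?thesis using that by blast
qed

lemma bargmann_projI:
  assumes f: "f \<in> gauss_L2" and g: "g \<in> bargmann"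
    and orth: "\<And>h. h \<in> bargmann \<Longrightarrow> gauss_inner f h = gauss_inner g h"
  shows "bargmann_proj f = g"
  unfolding bargmann_proj_def
proof (rule the_equality)
  show "g \<in> bargmann \<and> (\<forall>h\<in>bargmann. gauss_inner (\<lambda>z. f z - g z) h = 0)"
    using f g orth by (auto simp: gauss_inner_diff_left bargmannD)
  fix g' assume "g' \<in> bargmann \<and> (\<forall>h\<in>bargmann. gauss_inner (\<lambda>z. f z - g' z) h = 0)"
  thus "g' = g" using f g orth
    by (intro bargmann_eq_if_inner_eq) (auto simp: gauss_inner_diff_left bargmannD)
qed

text \<open>The candidate image \<open>g\<close> is built from the coefficients
  \<open>\<mu> n * a n\<close>, which are admissible because
  \<open>\<bar>\<mu> n\<bar> \<le> B\<close>. It is the projection of the product since both have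
  the same pairing with every monomial, and thus with every \<open>h\<close> in the space.\<close>

lemma toeplitz_radial_diagonal:
  fixes w :: "real \<Rightarrow> real"
  assumes [measurable]: "w \<in> borel_measurable borel" and w: "\<And>r. r \<ge> 0 \<Longrightarrow> \<bar>w r\<bar> \<le> B"
  shows "diagonal_operator (toeplitz (\<lambda>z. w (norm z))) (\<lambda>n. (LBINT t:{0..}. w (sqrt t) * t ^ n * exp (- t)) / fact n)"
  unfolding diagonal_operator_def
proof (intro ballI allI impI)
  fix u :: "complex \<Rightarrow> complex" and a :: "nat \<Rightarrow> complex"
  assume u: "u \<in> bargmann" and "\<forall>z. (\<lambda>n. a n * z ^ n) sums u z"
  hence a: "\<And>z. (\<lambda>n. a n * z ^ n) sums u z" by blast
  define \<mu> where "\<mu> n = (LBINT t:{0..}. w (sqrt t) * t ^ n * exp (- t)) / fact n" for n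
  let ?W = "\<lambda>z. complex_of_real (w (norm z))"
  have W: "(\<lambda>z. ?W z * v z) \<in> gauss_L2" if "v \<in> gauss_L2" for v
    using that by (rule gauss_L2_mult_bounded[where B = B]) (use w in auto)
  have \<mu>_bound: "\<bar>\<mu> n\<bar> \<le> B" for n
  proof -
    have "\<bar>LBINT t:{0..}. w (sqrt t) * t ^ n * exp (- t)\<bar> \<le> (LBINT t:{0..}. B * (t ^ n * exp (- t)))"
    proof -
      have int: "integrable lborel (\<lambda>t. indicator {0..} t *\<^sub>R (B * (t ^ n * exp (- t))))"
        using set_integrable_power_exp[of n] unfolding set_integrable_def
        by (subst mult_scaleR_right[symmetric]) (rule integrable_mult_right)
      have le: "norm (indicator {0..} t *\<^sub>R (w (sqrt t) * t ^ n * exp (- t))) \<le>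
          indicator {0..} t *\<^sub>R (B * (t ^ n * exp (- t)))" for t
        using w[of "sqrt t"] by (auto simp: abs_mult indicator_def mult.assoc intro!: mult_right_mono)
      have int': "integrable lborel (\<lambda>t. indicator {0..} t *\<^sub>R (w (sqrt t) * t ^ n * exp (- t)))"
        by (rule Bochner_Integration.integrable_bound[OF int])
          (use le in \<open>auto intro!: AE_I2 intro: order.trans[OF _ abs_ge_self]\<close>)
      show ?thesis
        unfolding set_lebesgue_integral_def real_norm_def[symmetric]
        by (rule order.trans[OF integral_norm_bound integral_mono[OF integrable_norm[OF int'] int le]])
    qed
    also have "\<dots> = B * fact n" by (simp add: LBINT_power_exp)
    finally show ?thesis by (simp add: \<mu>_def field_simps)
  qed
  have "summable (\<lambda>n. (norm (of_real (\<mu> n) * a n))\<^sup>2 * fact n)"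
  proof (rule summable_comparison_test')
    show "summable (\<lambda>n. B\<^sup>2 * ((norm (a n))\<^sup>2 * fact n))"
      using u bargmann_coeffs(1)[OF a] by (intro summable_mult) simp
    show "norm ((norm (of_real (\<mu> n) * a n))\<^sup>2 * fact n) \<le> B\<^sup>2 * ((norm (a n))\<^sup>2 * fact n)" for n
      using power_mono[OF \<mu>_bound abs_ge_zero, of n 2]
      by (simp add: norm_mult power_mult_distrib mult.assoc mult_right_mono)
  qed
  from bargmann_series_exists[OF this]
  obtain g where g: "g \<in> bargmann" and g_sums: "\<And>z. (\<lambda>n. of_real (\<mu> n) * a n * z ^ n) sums g z"
    by metis
  \<comment> \<open>The symbol is real and moves to the monomial. Then \<open>u\<close> can be
    expanded, and radial symmetry leaves a single term.\<close>
  have W_monomial: "gauss_inner (\<lambda>z. ?W z * u z) (\<lambda>z. z ^ n) = of_real (pi * fact n) * (of_real (\<mu> n) * a n)" for n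
  proof -
    have "(\<lambda>k. cnj (a k) * gauss_inner (\<lambda>z. ?W z * z ^ n) (\<lambda>z. z ^ k)) sums gauss_inner (\<lambda>z. ?W z * z ^ n) u"
      by (rule gauss_inner_sums[OF W[OF bargmannD(1)[OF monomial_in_bargmann]] u a])
    moreover have "(\<lambda>k. cnj (a k) * gauss_inner (\<lambda>z. ?W z * z ^ n) (\<lambda>z. z ^ k)) =
        (\<lambda>k. if k = n then cnj (a n) * of_real (pi * (fact n * \<mu> n)) else 0)"
      using gauss_monomial_offdiagonal[of n _ "\<lambda>r. of_real (w r)"] gauss_monomial_diagonal[of w n]
      by (auto simp: gauss_inner_def \<mu>_def)
    ultimately have "(\<lambda>k. if k = n then cnj (a n) * of_real (pi * (fact n * \<mu> n)) else 0) sums gauss_inner (\<lambda>z. ?W z * z ^ n) u"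
      by (simp only:)
    hence "gauss_inner (\<lambda>z. ?W z * z ^ n) u = cnj (a n) * of_real (pi * (fact n * \<mu> n))"
      by (rule sums_unique2[OF _ sums_single[of n "\<lambda>_. cnj (a n) * of_real (pi * (fact n * \<mu> n))"]])
    moreover have "gauss_inner (\<lambda>z. ?W z * u z) (\<lambda>z. z ^ n) = gauss_inner u (\<lambda>z. ?W z * z ^ n)"
      by (simp add: gauss_inner_def mult_ac)
    moreover have "gauss_inner u (\<lambda>z. ?W z * z ^ n) = cnj (gauss_inner (\<lambda>z. ?W z * z ^ n) u)"
      by (rule gauss_inner_commute)
    ultimately show ?thesis by (simp add: mult_ac)
  qed
  have "toeplitz (\<lambda>z. w (norm z)) u = g"
    unfolding toeplitz_def
  proof (rule bargmann_projI[OF W[OF bargmannD(1)[OF u]] g])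
    fix h assume h: "h \<in> bargmann"
    obtain b where b: "\<And>z. (\<lambda>n. b n * z ^ n) sums h z" using bargmann_taylor[OF h] by blast
    have "(\<lambda>n. cnj (b n) * gauss_inner (\<lambda>z. ?W z * u z) (\<lambda>z. z ^ n)) sums gauss_inner (\<lambda>z. ?W z * u z) h"
      by (rule gauss_inner_sums[OF W[OF bargmannD(1)[OF u]] h b])
    moreover have "(\<lambda>n. cnj (b n) * gauss_inner g (\<lambda>z. z ^ n)) sums gauss_inner g h"
      by (rule gauss_inner_sums[OF bargmannD(1)[OF g] h b])
    ultimately show "gauss_inner (\<lambda>z. ?W z * u z) h = gauss_inner g h"
      unfolding W_monomial gauss_inner_bargmann_monomial[OF g g_sums] by (rule sums_unique2)
  qed
  thus "toeplitz (\<lambda>z. w (norm z)) u \<in> bargmann \<and>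
    (\<forall>z. (\<lambda>n. of_real ((LBINT t:{0..}. w (sqrt t) * t ^ n * exp (- t)) / fact n) * a n * z ^ n) sums toeplitz (\<lambda>z. w (norm z)) u z)"
    using g g_sums by (simp add: \<mu>_def)
qed

lemma diagonal_operator_linear:
  assumes T: "diagonal_operator T \<mu>"
  shows "bargmann_linear T"
  unfolding bargmann_linear_def
proof (intro conjI ballI allI)
  fix u v c assume u: "u \<in> bargmann"
  obtain a where a: "\<And>z. (\<lambda>n. a n * z ^ n) sums u z" using bargmann_taylor[OF u] by blast
  note Tu = diagonal_operatorD[OF T u a]
  show "T u \<in> bargmann" by (rule Tu(1))
  have "(\<lambda>n. (c * a n) * z ^ n) sums (c * u z)" for z
    using sums_mult[OF a, of c] by (simp add: mult.assoc)
  from diagonal_operatorD(2)[OF T bargmann_cmult[OF u] this] sums_mult[OF Tu(2), of c]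
  show "T (\<lambda>z. c * u z) = (\<lambda>z. c * T u z)" by (intro ext sums_unique2) (simp_all add: mult_ac)
  assume v: "v \<in> bargmann"
  obtain b where b: "\<And>z. (\<lambda>n. b n * z ^ n) sums v z" using bargmann_taylor[OF v] by blast
  have "(\<lambda>n. (a n + b n) * z ^ n) sums (u z + v z)" for z
    using sums_add[OF a b] by (simp add: distrib_right)
  from diagonal_operatorD(2)[OF T bargmann_add[OF u v] this] sums_add[OF Tu(2) diagonal_operatorD(2)[OF T v b]]
  show "T (\<lambda>z. u z + v z) = (\<lambda>z. T u z + T v z)" by (intro ext sums_unique2) (simp_all add: algebra_simps)
qed

text \<open>Real eigenvalues make the operator its own adjoint, so \<open>singular_space\<close> is
  an eigenspace of the square of \<open>T\<close>.\<close>

lemma diagonal_operator_adjoint: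
  assumes T: "diagonal_operator T \<mu>" and v: "v \<in> bargmann"
  shows "bargmann_adjoint T v = T v"
  unfolding bargmann_adjoint_def
proof (rule the_equality)
  obtain b where b: "\<And>z. (\<lambda>n. b n * z ^ n) sums v z" using bargmann_taylor[OF v] by blast
  note Tv = diagonal_operatorD[OF T v b]
  have adj: "gauss_inner (T u) v = gauss_inner u (T v)" if u: "u \<in> bargmann" for u
  proof -
    obtain a where a: "\<And>z. (\<lambda>n. a n * z ^ n) sums u z" using bargmann_taylor[OF u] by blast
    note Tu = diagonal_operatorD[OF T u a]
    from gauss_inner_bargmann_sums[OF Tu v b] gauss_inner_bargmann_sums[OF u a Tv]
    show ?thesis by (intro sums_unique2) (simp_all add: mult_ac)
  qed
  show "T v \<in> bargmann \<and> (\<forall>u\<in>bargmann. gauss_inner (T u) v = gauss_inner u (T v))" using Tv(1) adj by blast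
  fix w assume w: "w \<in> bargmann \<and> (\<forall>u\<in>bargmann. gauss_inner (T u) v = gauss_inner u w)"
  show "w = T v"
  proof (rule bargmann_eq_if_inner_eq)
    fix u assume "u \<in> bargmann"
    hence "gauss_inner u w = gauss_inner u (T v)" using w adj by metis
    thus "gauss_inner w u = gauss_inner (T v) u" by (metis gauss_inner_commute)
  qed (use w Tv in auto)
qed

section \<open>Multiplicities of the singular numbers\<close>

lemma sum_function_apply: "(\<Sum>x\<in>A. f x) z = (\<Sum>x\<in>A. f x (z :: 'a) :: 'b :: comm_monoid_add)"
  by (induction A rule: infinite_finite_induct) auto

lemma inj_on_monomial: "inj_on (\<lambda>n (z :: complex). z ^ n) I"
proof (rule inj_onI)
  fix m n assume "(\<lambda>z :: complex. z ^ m) = (\<lambda>z. z ^ n)"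
  hence "(2 :: complex) ^ m = 2 ^ n" by (rule fun_cong)
  hence "(2 :: real) ^ m = 2 ^ n" by (metis norm_power norm_numeral)
  thus "m = n" by simp
qed

text \<open>A vanishing linear combination of monomials is a power series of 0, so its coefficients
  vanish by uniqueness.\<close>

lemma monomial_independent:
  assumes "finite I"
  shows "cfun.independent ((\<lambda>n z. z ^ n) ` I)"
proof (rule cfun.independent_if_scalars_zero)
  fix f :: "(complex \<Rightarrow> complex) \<Rightarrow> complex" and x :: "complex \<Rightarrow> complex"
  let ?e = "\<lambda>n (z :: complex). z ^ n"
  assume eq: "(\<Sum>x\<in>?e ` I. (\<lambda>z. f x * x z)) = 0" and x: "x \<in> ?e ` I"
  note inj = inj_on_monomial[of I]
  define a where "a n = (if n \<in> I then f (?e n) else 0)" for n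
  have "(\<lambda>n. a n * z ^ n) sums 0" for z
  proof -
    have "(\<lambda>n. if n \<in> I then f (?e n) * z ^ n else 0) sums (\<Sum>n\<in>I. f (?e n) * z ^ n)"
      by (rule sums_If_finite_set[OF assms])
    also have "(\<Sum>n\<in>I. f (?e n) * z ^ n) = (\<Sum>x\<in>?e ` I. f x * x z)"
      by (subst sum.reindex[OF inj]) simp
    also have "\<dots> = 0" using fun_cong[OF eq, of z] by (simp add: sum_function_apply)
    finally show ?thesis by (simp add: a_def if_distrib[of "\<lambda>x. x * _"] cong: if_cong)
  qed
  from coeffs_unique[of a "\<lambda>_. 0", OF this] have "a = (\<lambda>_. 0)" by simp
  thus "f x = 0" using x by (auto simp: a_def fun_eq_iff split: if_splits)
qed (use assms in simp)

text \<open>Comparing coefficients, the eigenvalue equation says that \<open>a n = 0\<close> unless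
  \<open>(\<mu> n)\<^sup>2 = t\<^sup>2\<close>. The space is thus spanned by the monomials with
  \<open>\<bar>\<mu> n\<bar> = t\<close>, finitely many because \<open>\<mu>\<close> tends to
  0.\<close>

lemma dim_singular_space_diagonal:
  assumes T: "diagonal_operator T \<mu>" and \<mu>: "\<mu> \<longlonglongrightarrow> 0" and t: "t > 0"
  shows "cfun.dim (singular_space T t) = card {n. \<bar>\<mu> n\<bar> = t}"
proof -
  define I where "I = {n. \<bar>\<mu> n\<bar> = t}"
  let ?e = "\<lambda>n (z :: complex). z ^ n"
  have I: "finite I"
    using finite_superlevel_tendsto_0[OF tendsto_rabs_zero[OF \<mu>], of "t / 2"] t
    by (rule_tac finite_subset[of _ "{n. \<bar>\<mu> n\<bar> > t / 2}"]) (auto simp: I_def)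
  note inj = inj_on_monomial[of I]
  have mem: "u \<in> singular_space T t \<longleftrightarrow> (\<forall>n. n \<notin> I \<longrightarrow> a n = 0)"
    if u: "u \<in> bargmann" and a: "\<And>z. (\<lambda>n. a n * z ^ n) sums u z" for u a
  proof -
    note Tu = diagonal_operatorD[OF T u a]
    note TTu = diagonal_operatorD[OF T Tu]
    have t2u: "(\<lambda>n. (of_real (t\<^sup>2) * a n) * z ^ n) sums (of_real (t\<^sup>2) * u z)" for z
      using sums_mult[OF a, of "of_real (t\<^sup>2)"] by (simp add: mult.assoc)
    have "u \<in> singular_space T t \<longleftrightarrow> T (T u) = (\<lambda>z. of_real (t\<^sup>2) * u z)"
      using u by (simp add: singular_space_def diagonal_operator_adjoint[OF T Tu(1)])
    also have "\<dots> \<longleftrightarrow> (\<forall>n. of_real (\<mu> n) * (of_real (\<mu> n) * a n) = of_real (t\<^sup>2) * a n)"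
    proof
      assume "T (T u) = (\<lambda>z. of_real (t\<^sup>2) * u z)"
      with t2u have "\<And>z. (\<lambda>n. (of_real (t\<^sup>2) * a n) * z ^ n) sums T (T u) z" by simp
      from fun_cong[OF coeffs_unique[OF TTu(2) this]]
      show "\<forall>n. of_real (\<mu> n) * (of_real (\<mu> n) * a n) = of_real (t\<^sup>2) * a n" by blast
    next
      assume eq: "\<forall>n. of_real (\<mu> n) * (of_real (\<mu> n) * a n) = of_real (t\<^sup>2) * a n"
      show "T (T u) = (\<lambda>z. of_real (t\<^sup>2) * u z)"
      proof (intro ext sums_unique2[OF TTu(2)])
        fix z show "(\<lambda>n. of_real (\<mu> n) * (of_real (\<mu> n) * a n) * z ^ n) sums (of_real (t\<^sup>2) * u z)"
          using t2u[of z] by (simp only: eq[rule_format])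
      qed
    qed
    also have "\<dots> \<longleftrightarrow> (\<forall>n. n \<notin> I \<longrightarrow> a n = 0)"
    proof -
      have "of_real (\<mu> n) * (of_real (\<mu> n) * a n) = of_real (t\<^sup>2) * a n \<longleftrightarrow> a n = 0 \<or> n \<in> I" for n
      proof -
        have "of_real (\<mu> n) * (of_real (\<mu> n) * a n) = of_real (t\<^sup>2) * a n \<longleftrightarrow>
            of_real ((\<mu> n)\<^sup>2) * a n = of_real (t\<^sup>2) * a n" by (simp add: power2_eq_square)
        also have "\<dots> \<longleftrightarrow> a n = 0 \<or> (\<mu> n)\<^sup>2 = t\<^sup>2" by (simp only: mult_cancel_right of_real_eq_iff)
        also have "(\<mu> n)\<^sup>2 = t\<^sup>2 \<longleftrightarrow> n \<in> I" using t power2_eq_iff_nonneg[of "\<bar>\<mu> n\<bar>" t] by (simp add: I_def)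
        finally show ?thesis .
      qed
      thus ?thesis by blast
    qed
    finally show ?thesis .
  qed
  have "cfun.dim (singular_space T t) = card (?e ` I)"
  proof (rule cfun.dim_unique[OF _ _ monomial_independent[OF I] refl])
    show "?e ` I \<subseteq> singular_space T t"
    proof safe
      fix n assume n: "n \<in> I"
      have "(\<lambda>k. (if k = n then 1 else 0) * z ^ k) sums z ^ n" for z :: complex
        using sums_single[of n "\<lambda>k. z ^ k"] by (simp add: if_distrib[of "\<lambda>x. x * _"] cong: if_cong)
      from mem[OF monomial_in_bargmann this] n show "?e n \<in> singular_space T t" by auto
    qed
    show "singular_space T t \<subseteq> cfun.span (?e ` I)"
    proof
      fix u assume s: "u \<in> singular_space T t"
      hence u: "u \<in> bargmann" by (simp add: singular_space_def)
      obtain a where a: "\<And>z. (\<lambda>n. a n * z ^ n) sums u z" using bargmann_taylor[OF u] by blast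
      have "a n = 0" if "n \<notin> I" for n using mem[OF u a] s that by blast
      hence "(\<lambda>n. a n * z ^ n) sums (\<Sum>n\<in>I. a n * z ^ n)" for z by (intro sums_finite I) auto
      hence "u = (\<lambda>z. \<Sum>n\<in>I. a n * z ^ n)" using a by (intro ext sums_unique2)
      also have "\<dots> = (\<Sum>n\<in>I. (\<lambda>z. a n * ?e n z))" by (rule ext) (simp add: sum_function_apply)
      also have "\<dots> \<in> cfun.span (?e ` I)"
        by (intro cfun.span_sum cfun.span_scale cfun.span_base) auto
      finally show "u \<in> cfun.span (?e ` I)" .
    qed
  qed
  also have "\<dots> = card I" by (rule card_image[OF inj])
  finally show ?thesis by (simp add: I_def)
qed

lemma singular_count_diagonal:
  assumes "diagonal_operator T \<mu>" "\<mu> \<longlonglongrightarrow> 0" "x > 0"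
  shows "singular_count x T = card {n. \<bar>\<mu> n\<bar> > x}"
  by (rule singular_count_eq_card[OF tendsto_rabs_zero[OF assms(2)] abs_ge_zero assms(3)
        dim_singular_space_diagonal[OF assms(1,2)]])

section \<open>Compactness of diagonal operators\<close>

lemma pointwise_convergent_subsequence:
  fixes a :: "nat \<Rightarrow> nat \<Rightarrow> complex"
  assumes "\<And>k n. norm (a k n) \<le> M n"
  obtains r b where "strict_mono (r :: nat \<Rightarrow> nat)" "\<And>n. (\<lambda>k. a (r k) n) \<longlonglongrightarrow> b n"
proof -
  \<comment> \<open>Cantor's diagonal argument: stage \<open>n\<close> makes the \<open>n\<close>-th
    coefficient converge, by Bolzano-Weierstrass.\<close>
  interpret subseqs "\<lambda>n s. convergent (\<lambda>k. a (s k) n)"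
  proof
    fix n and s :: "nat \<Rightarrow> nat"
    have "bounded (range (\<lambda>k. a (s k) n))" using assms by (auto simp: bounded_iff)
    from bounded_imp_convergent_subsequence[OF this]
    show "\<exists>r'. strict_mono r' \<and> convergent (\<lambda>k. a ((s \<circ> r') k) n)"
      by (auto simp: convergent_def o_def)
  qed
  have "convergent (\<lambda>k. a (diagseq k) n)" for n
  proof -
    have "convergent (\<lambda>k. a ((diagseq \<circ> ((+) (Suc n))) k) n)"
    proof (rule diagseq_holds)
      fix r s n assume "strict_mono (r :: nat \<Rightarrow> nat)" "convergent (\<lambda>k. a (s k) n)"
      from convergent_subseq_convergent[OF this(2,1)]
      show "convergent (\<lambda>k. a ((s \<circ> r) k) n)" by (simp add: o_def)
    qed
    thus ?thesis
      using convergent_ignore_initial_segment[of "\<lambda>k. a (diagseq k) n" "Suc n"] by (simp add: add.commute)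
  qed
  hence "\<exists>b. \<forall>n. (\<lambda>k. a (diagseq k) n) \<longlonglongrightarrow> b n" unfolding convergent_def by (rule choice[OF allI])
  with subseq_diagseq that show ?thesis by blast
qed

text \<open>A Hilbert-Schmidt argument. Boundedness of \<open>u\<close> bounds each Taylor
  coefficient separately, so a subsequence converges coefficientwise. The square-summable
  \<open>\<mu>\<close> then provides a majorant uniform in \<open>k\<close>, which turns this into
  convergence in norm of the images by Tannery's theorem.\<close>

lemma diagonal_operator_compact:
  assumes T: "diagonal_operator T \<mu>" and \<mu>: "summable (\<lambda>n. (\<mu> n)\<^sup>2)"
  shows "bargmann_compact T"
  unfolding bargmann_compact_def
proof (intro conjI allI impI)
  show "bargmann_linear T" by (rule diagonal_operator_linear[OF T])
  fix u :: "nat \<Rightarrow> complex \<Rightarrow> complex"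
  assume "(\<forall>k. u k \<in> bargmann) \<and> (\<exists>C. \<forall>k. gauss_norm (u k) \<le> C)"
  then obtain C where u: "\<And>k. u k \<in> bargmann" and C: "\<And>k. gauss_norm (u k) \<le> C" by blast
  have "\<forall>k. \<exists>a. \<forall>z. (\<lambda>n. a n * z ^ n) sums u k z" using bargmann_taylor[OF u] by metis
  then obtain a where a: "\<And>k z. (\<lambda>n. a k n * z ^ n) sums u k z" by metis
  have a_le: "pi * ((norm (a k n))\<^sup>2 * fact n) \<le> C\<^sup>2" for k n
  proof -
    note s = bargmann_coeffs(2)[OF a u, of k]
    have "pi * ((norm (a k n))\<^sup>2 * fact n) \<le> (\<Sum>n. pi * ((norm (a k n))\<^sup>2 * fact n))"
      using sum_le_suminf[OF sums_summable[OF s], of "{n}"] by simp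
    also have "\<dots> = (LINT z|gauss_measure. (norm (u k z))\<^sup>2)" by (rule sums_unique[OF s, symmetric])
    also have "\<dots> = (gauss_norm (u k))\<^sup>2" by (simp add: gauss_norm_def)
    also have "\<dots> \<le> C\<^sup>2" using C by (intro power_mono) (auto simp: gauss_norm_def)
    finally show ?thesis .
  qed
  have "norm (a k n) \<le> sqrt (C\<^sup>2 / (pi * fact n))" for k n
    using a_le[of k n] by (intro real_le_rsqrt) (simp add: field_simps)
  from pointwise_convergent_subsequence[of a "\<lambda>n. sqrt (C\<^sup>2 / (pi * fact n))", OF this]
  obtain r b where r: "strict_mono (r :: nat \<Rightarrow> nat)" and b: "\<And>n. (\<lambda>k. a (r k) n) \<longlonglongrightarrow> b n"
    by metis
  have b_le: "pi * ((norm (b n))\<^sup>2 * fact n) \<le> C\<^sup>2" for n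
    by (rule LIMSEQ_le_const2[of "\<lambda>k. pi * ((norm (a (r k) n))\<^sup>2 * fact n)"])
      (use a_le in \<open>auto intro!: tendsto_intros b\<close>)
  have "summable (\<lambda>n. (norm (of_real (\<mu> n) * b n))\<^sup>2 * fact n)"
  proof (rule summable_comparison_test')
    show "summable (\<lambda>n. (\<mu> n)\<^sup>2 * (C\<^sup>2 / pi))" using \<mu> by (rule summable_mult2)
    show "norm ((norm (of_real (\<mu> n) * b n))\<^sup>2 * fact n) \<le> (\<mu> n)\<^sup>2 * (C\<^sup>2 / pi)" for n
    proof -
      have "(norm (b n))\<^sup>2 * fact n \<le> C\<^sup>2 / pi" using b_le[of n] by (simp add: field_simps)
      hence "(\<mu> n)\<^sup>2 * ((norm (b n))\<^sup>2 * fact n) \<le> (\<mu> n)\<^sup>2 * (C\<^sup>2 / pi)" by (intro mult_left_mono) auto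
      thus ?thesis by (simp add: norm_mult power_mult_distrib mult.assoc)
    qed
  qed
  from bargmann_series_exists[OF this]
  obtain g where g: "g \<in> bargmann" and g_sums: "\<And>z. (\<lambda>n. of_real (\<mu> n) * b n * z ^ n) sums g z"
    by metis
  let ?d = "\<lambda>n k. pi * ((norm (of_real (\<mu> n) * (a (r k) n - b n)))\<^sup>2 * fact n)"
  have d: "(LINT z|gauss_measure. (norm (T (u (r k)) z - g z))\<^sup>2) = (\<Sum>n. ?d n k)" for k
  proof -
    note Tu = diagonal_operatorD[OF T u a, of "r k"]
    have "(\<lambda>n. (of_real (\<mu> n) * (a (r k) n - b n)) * z ^ n) sums (T (u (r k)) z - g z)" for z
      using sums_diff[OF Tu(2) g_sums, of z] by (simp add: algebra_simps)
    from bargmann_coeffs(2)[OF this bargmann_diff[OF Tu(1) g]] show ?thesis by (rule sums_unique)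
  qed
  have "(\<lambda>k. \<Sum>n. ?d n k) \<longlonglongrightarrow> (\<Sum>n. 0)"
  proof (rule tannerys_theorem[THEN conjunct2, THEN conjunct2])
    show "(\<lambda>k. ?d n k) \<longlonglongrightarrow> 0" for n
    proof -
      have "(\<lambda>k. ?d n k) \<longlonglongrightarrow> pi * ((norm (of_real (\<mu> n) * (b n - b n)))\<^sup>2 * fact n)"
        by (intro tendsto_intros b)
      thus ?thesis by simp
    qed
    \<comment> \<open>The factor 4:
      \<open>(x + y)\<^sup>2 \<le> 2 * x\<^sup>2 + 2 * y\<^sup>2\<close>, and each weighted square
      is at most \<open>C\<^sup>2\<close>.\<close>
    show "summable (\<lambda>n. (\<mu> n)\<^sup>2 * (4 * C\<^sup>2))" using \<mu> by (rule summable_mult2)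
    have "norm (?d n k) \<le> (\<mu> n)\<^sup>2 * (4 * C\<^sup>2)" for n k
    proof -
      define x y where "x = norm (a (r k) n)" and "y = norm (b n)"
      have "(norm (a (r k) n - b n))\<^sup>2 \<le> (x + y)\<^sup>2"
        unfolding x_def y_def by (intro power_mono norm_triangle_ineq4) auto
      also have "\<dots> \<le> 2 * x\<^sup>2 + 2 * y\<^sup>2" using sum_squares_bound[of x y] by (simp add: power2_sum)
      finally have "pi * fact n * (norm (a (r k) n - b n))\<^sup>2 \<le> pi * fact n * (2 * x\<^sup>2 + 2 * y\<^sup>2)"
        by (intro mult_left_mono) auto
      also have "\<dots> = 2 * (pi * (x\<^sup>2 * fact n)) + 2 * (pi * (y\<^sup>2 * fact n))" by (simp add: algebra_simps)
      also have "\<dots> \<le> 4 * C\<^sup>2" using a_le[of "r k" n] b_le[of n] unfolding x_def y_def by linarith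
      finally have "(\<mu> n)\<^sup>2 * (pi * fact n * (norm (a (r k) n - b n))\<^sup>2) \<le> (\<mu> n)\<^sup>2 * (4 * C\<^sup>2)"
        by (intro mult_left_mono) auto
      thus ?thesis by (simp add: norm_mult power_mult_distrib abs_mult mult_ac)
    qed
    thus "eventually (\<lambda>(n, k). norm (?d n k) \<le> (\<mu> n)\<^sup>2 * (4 * C\<^sup>2)) (at_top \<times>\<^sub>F sequentially)"
      by (intro always_eventually) auto
  qed simp
  hence "(\<lambda>k. sqrt (\<Sum>n. ?d n k)) \<longlonglongrightarrow> sqrt 0" by (intro tendsto_real_sqrt) simp
  hence "(\<lambda>k. gauss_norm (\<lambda>z. T (u (r k)) z - g z)) \<longlonglongrightarrow> 0"
    unfolding gauss_norm_def d by simp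
  with r g show "\<exists>r g. strict_mono (r :: nat \<Rightarrow> nat) \<and> g \<in> bargmann \<and>
      (\<lambda>k. gauss_norm (\<lambda>z. T (u (r k)) z - g z)) \<longlonglongrightarrow> 0" by blast
qed

section \<open>The oscillating symbol\<close>

lemma superexponential_bound_imp:
  fixes a :: "nat \<Rightarrow> real"
  assumes "c > 0" and a: "\<And>n. n \<ge> N \<Longrightarrow> \<bar>a n\<bar> \<le> exp (- (c * real n * ln n) + C * real n)"
  shows "a \<longlonglongrightarrow> 0" "summable (\<lambda>n. (a n)\<^sup>2)"
proof -
  \<comment> \<open>Eventually \<open>c * ln n\<close> exceeds \<open>C + 1\<close>, so the terms
    lie below \<open>exp (- n)\<close>.\<close>
  have "eventually (\<lambda>n. - (c * real n * ln n) + C * real n \<le> - real n) sequentially"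
    using assms(1) by real_asymp
  hence "eventually (\<lambda>n. norm ((a n)\<^sup>2) \<le> exp (-1) ^ n) sequentially"
    using eventually_ge_at_top[of N]
  proof eventually_elim
    case (elim n)
    have "\<bar>a n\<bar> \<le> exp (- real n)" using a[OF elim(2)] elim(1) by (meson exp_le_cancel_iff order.trans)
    hence "(a n)\<^sup>2 \<le> (exp (- real n))\<^sup>2" using power_mono[of "\<bar>a n\<bar>" _ 2] by simp
    also have "\<dots> \<le> exp (- real n)" by (simp add: power2_eq_square mult_le_cancel_left1)
    also have "\<dots> = exp (-1) ^ n" by (simp flip: exp_of_nat_mult)
    finally show ?case by simp
  qed
  thus s: "summable (\<lambda>n. (a n)\<^sup>2)"
    by (rule summable_comparison_test_ev) (auto intro: summable_geometric)
  from tendsto_real_sqrt[OF summable_LIMSEQ_zero[OF s]] show "a \<longlonglongrightarrow> 0"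
    by (simp add: tendsto_rabs_zero_iff)
qed

section \<open>Eigenvalues of the radial symbols\<close>

definition radial_eigenvalue :: "(real \<Rightarrow> real) \<Rightarrow> nat \<Rightarrow> real" where
  "radial_eigenvalue w n = (LBINT t:{0..}. w (sqrt t) * t ^ n * exp (- t)) / fact n"

lemma radial_toeplitz:
  fixes w :: "real \<Rightarrow> real"
  assumes "w \<in> borel_measurable borel" "\<And>r. r \<ge> 0 \<Longrightarrow> \<bar>w r\<bar> \<le> B" and "c > 0"
    and le: "\<And>n. n > 0 \<Longrightarrow> \<bar>radial_eigenvalue w n\<bar> \<le> exp (- (c * real n * ln n) + C * real n)"
  shows "bargmann_compact (toeplitz (\<lambda>z. w (norm z)))"
    and "\<And>x. x > 0 \<Longrightarrow> singular_count x (toeplitz (\<lambda>z. w (norm z))) = card {n. \<bar>radial_eigenvalue w n\<bar> > x}"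
    and "\<And>x. x > 0 \<Longrightarrow> finite {n. \<bar>radial_eigenvalue w n\<bar> > x}"
proof -
  have T: "diagonal_operator (toeplitz (\<lambda>z. w (norm z))) (radial_eigenvalue w)"
    using toeplitz_radial_diagonal[OF assms(1,2)] by (simp add: radial_eigenvalue_def[abs_def])
  have s: "radial_eigenvalue w \<longlonglongrightarrow> 0" "summable (\<lambda>n. (radial_eigenvalue w n)\<^sup>2)"
    using superexponential_bound_imp[OF assms(3), of 1 "radial_eigenvalue w" C] le by auto
  show "bargmann_compact (toeplitz (\<lambda>z. w (norm z)))" by (rule diagonal_operator_compact[OF T s(2)])
  fix x :: real assume x: "x > 0"
  show "singular_count x (toeplitz (\<lambda>z. w (norm z))) = card {n. \<bar>radial_eigenvalue w n\<bar> > x}"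
    by (rule singular_count_diagonal[OF T s(1) x])
  show "finite {n. \<bar>radial_eigenvalue w n\<bar> > x}"
    by (rule finite_superlevel_tendsto_0[OF tendsto_rabs_zero[OF s(1)] x])
qed

text \<open>The positive factor of \<open>osc_symbol\<close>. In \<open>t = r\<^sup>2\<close> its
  growing part \<open>exp t\<close> cancels the Gaussian weight and leaves
  \<open>exp (- (t powr p))\<close>.\<close>

definition envelope :: "real \<Rightarrow> real \<Rightarrow> real" where
  "envelope p r = exp (- (r powr (2 * p)) + r\<^sup>2)"

lemma envelope_bounds:
  assumes "p > 1" "r \<ge> 0"
  shows "0 < envelope p r" "envelope p r \<le> exp 1"
proof -
  have "- (r powr (2 * p)) + r\<^sup>2 \<le> 1"
  proof (cases "r \<le> 1")
    case True
    hence "r\<^sup>2 \<le> 1" using assms by (simp add: power_le_one)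
    thus ?thesis using powr_ge_zero[of r "2 * p"] by linarith
  next
    case False
    hence "r powr 2 \<le> r powr (2 * p)" using assms by (intro powr_mono) auto
    thus ?thesis using False by (simp add: powr_numeral)
  qed
  thus "0 < envelope p r" "envelope p r \<le> exp 1" by (simp_all add: envelope_def)
qed

lemma envelope_eigenvalue:
  assumes "p > 1"
  shows "radial_eigenvalue (\<lambda>r. envelope p r * s (r\<^sup>2)) n =
    (LBINT t:{0..}. t ^ n * exp (- (t powr p)) * s t) / fact n"
proof -
  have "(LBINT t:{0..}. (envelope p (sqrt t) * s ((sqrt t)\<^sup>2)) * t ^ n * exp (- t)) =
      (LBINT t:{0..}. t ^ n * exp (- (t powr p)) * s t)"
  proof (rule set_lebesgue_integral_cong)
    show "\<forall>t. t \<in> {0..} \<longrightarrow> (envelope p (sqrt t) * s ((sqrt t)\<^sup>2)) * t ^ n * exp (- t) = t ^ n * exp (- (t powr p)) * s t"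
    proof (intro allI impI)
      fix t :: real assume "t \<in> {0..}"
      hence t: "t \<ge> 0" by simp
      have "sqrt t powr (2 * p) = t powr p"
        using t by (simp add: powr_half_sqrt[symmetric] powr_powr)
      hence "envelope p (sqrt t) * exp (- t) = exp (- (t powr p))"
        using t by (simp add: envelope_def flip: exp_add)
      thus "(envelope p (sqrt t) * s ((sqrt t)\<^sup>2)) * t ^ n * exp (- t) = t ^ n * exp (- (t powr p)) * s t"
        using t by (simp add: mult_ac)
    qed
  qed simp
  thus ?thesis by (simp add: radial_eigenvalue_def)
qed

text \<open>All four symbols have the form \<open>envelope p r * s (r\<^sup>2)\<close> with \<open>s\<close> bounded by 1.\<close>

lemma envelope_toeplitz:
  fixes s :: "real \<Rightarrow> real"
  assumes p: "p > 1" and [measurable]: "s \<in> borel_measurable borel" and s: "\<And>t. \<bar>s t\<bar> \<le> 1"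
    and w_def: "w = (\<lambda>r. envelope p r * s (r\<^sup>2))"
  shows "\<exists>C. \<forall>n>0. \<bar>radial_eigenvalue w n\<bar> \<le> exp (- ((1 - 1 / p) * real n * ln n) + C * real n)"
    and "bargmann_compact (toeplitz (\<lambda>z. w (norm z)))"
    and "\<And>x. x > 0 \<Longrightarrow> singular_count x (toeplitz (\<lambda>z. w (norm z))) = card {n. \<bar>radial_eigenvalue w n\<bar> > x}"
    and "\<And>x. x > 0 \<Longrightarrow> finite {n. \<bar>radial_eigenvalue w n\<bar> > x}"
    and "\<And>n. n > 0 \<Longrightarrow> set_integrable lborel {0..} (\<lambda>t. t ^ n * exp (- (t powr p)) * s t)"
proof -
  obtain K where K: "K > 0" and int: "\<And>n f. n > 0 \<Longrightarrow> f \<in> borel_measurable borel \<Longrightarrow>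
       (\<And>t. t \<ge> 0 \<Longrightarrow> \<bar>f t\<bar> \<le> t ^ n * exp (- (t powr p))) \<Longrightarrow>
       set_integrable lborel {0..} f \<and> \<bar>LBINT t:{0..}. f t\<bar> \<le> K * (2 * real n / p) powr (real n / p)"
    using set_integral_power_times_exp_minus_powr_bound[OF p] by metis
  obtain C where C: "\<And>n. n > 0 \<Longrightarrow>
    K * (2 * real n / p) powr (real n / p) / fact n \<le> exp (- ((1 - 1 / p) * real n * ln n) + C * real n)"
    using moment_ratio_le[OF p K] by metis
  have meas: "w \<in> borel_measurable borel" unfolding w_def envelope_def by measurable
  have bound: "\<bar>w r\<bar> \<le> exp 1" if "r \<ge> 0" for r
    using mult_mono[OF envelope_bounds(2)[OF p that] s, of "r\<^sup>2"] envelope_bounds(1)[OF p that]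
    by (simp add: w_def abs_mult)
  have I: "set_integrable lborel {0..} (\<lambda>t. t ^ n * exp (- (t powr p)) * s t) \<and>
      \<bar>LBINT t:{0..}. t ^ n * exp (- (t powr p)) * s t\<bar> \<le> K * (2 * real n / p) powr (real n / p)" if "n > 0" for n
    by (rule int[OF that]) (use s in \<open>auto simp: abs_mult intro!: mult_left_le\<close>)
  have le: "\<bar>radial_eigenvalue w n\<bar> \<le> exp (- ((1 - 1 / p) * real n * ln n) + C * real n)" if "n > 0" for n
  proof -
    have "\<bar>radial_eigenvalue w n\<bar> \<le> K * (2 * real n / p) powr (real n / p) / fact n"
      unfolding w_def envelope_eigenvalue[OF p] using I[OF that] by (simp add: abs_divide divide_right_mono)
    also note C[OF that]
    finally show ?thesis .
  qed
  have c: "1 - 1 / p > 0" using p by simp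
  from le show "\<exists>C. \<forall>n>0. \<bar>radial_eigenvalue w n\<bar> \<le> exp (- ((1 - 1 / p) * real n * ln n) + C * real n)" by blast
  show "bargmann_compact (toeplitz (\<lambda>z. w (norm z)))" by (rule radial_toeplitz(1)[OF meas bound c le])
  show "singular_count x (toeplitz (\<lambda>z. w (norm z))) = card {n. \<bar>radial_eigenvalue w n\<bar> > x}" if "x > 0" for x
    by (rule radial_toeplitz(2)[OF meas bound c le that])
  show "finite {n. \<bar>radial_eigenvalue w n\<bar> > x}" if "x > 0" for x
    by (rule radial_toeplitz(3)[OF meas bound c le that])
  show "set_integrable lborel {0..} (\<lambda>t. t ^ n * exp (- (t powr p)) * s t)" if "n > 0" for n
    using I[OF that] by blast
qed

lemma singular_count_eventually:
  assumes "\<And>x. x > 0 \<Longrightarrow> singular_count x T = card {n. \<mu> n > x}"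
  shows "eventually (\<lambda>x. real (singular_count x T) = real (card {n. \<mu> n > x})) (at_right 0)"
  using assms eventually_at_right_less[of "0 :: real"] by (auto elim: eventually_mono)

text \<open>Covers the absolute value and both parts at once: each factor \<open>s\<close> dominates
  the positive part of a shifted sine, which gives the lower bound, and is at most 1, which gives
  the upper bound with the same leading term.\<close>

lemma signed_envelope_asymp:
  fixes s :: "real \<Rightarrow> real" and p q \<phi> :: real
  assumes p: "p > 1" and q: "q > 1" and [measurable]: "s \<in> borel_measurable borel"
    and s: "\<And>t. \<bar>s t\<bar> \<le> 1" and \<phi>: "0 \<le> \<phi>" "\<phi> \<le> pi" and ge: "\<And>t. max (sin (t powr q - \<phi>)) 0 \<le> s t"
  shows "bargmann_compact (toeplitz (\<lambda>z. envelope p (norm z) * s ((norm z)\<^sup>2)))"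
    and "(\<lambda>x. real (singular_count x (toeplitz (\<lambda>z. envelope p (norm z) * s ((norm z)\<^sup>2))))) \<sim>[at_right 0]
      (\<lambda>x. p / (p - 1) * (\<bar>ln x\<bar> / ln \<bar>ln x\<bar>))"
proof -
  define w where "w = (\<lambda>r. envelope p r * s (r\<^sup>2))"
  note W = envelope_toeplitz[OF p assms(3) s w_def]
  obtain C where C: "\<And>n. n > 0 \<Longrightarrow> \<bar>radial_eigenvalue w n\<bar> \<le> exp (- ((1 - 1 / p) * real n * ln n) + C * real n)"
    using W(1) by blast
  note cpt = W(2) and cnt = W(3) and fin = W(4) and int = W(5)
  show "bargmann_compact (toeplitz (\<lambda>z. envelope p (norm z) * s ((norm z)\<^sup>2)))"
    using cpt by (simp add: w_def)
  let ?h = "\<lambda>t. max (sin (t powr q - \<phi>)) 0"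
  obtain D N where D: "\<And>n. n \<ge> N \<Longrightarrow> set_integrable lborel {0..} (\<lambda>t. t ^ n * exp (- (t powr p)) * ?h t) \<Longrightarrow>
      exp (- ((1 - 1 / p) * real n * ln n) - D * real n) \<le> (LBINT t:{0..}. t ^ n * exp (- (t powr p)) * ?h t) / fact n"
    by (rule positive_part_moment_ge[OF p q \<phi>], rule that, blast)
  have lower: "exp (- ((1 - 1 / p) * real n * ln n) - D * real n) \<le> \<bar>radial_eigenvalue w n\<bar>" if n: "n \<ge> max N 1" for n
  proof -
    have inth: "set_integrable lborel {0..} (\<lambda>t. t ^ n * exp (- (t powr p)) * ?h t)"
      \<comment> \<open>The preceding lemma is applied a second time, with the comparison function
        in place of \<open>s\<close>, for its integrability clause.\<close>
      by (rule envelope_toeplitz(5)[OF p _ _ refl, of ?h]) (use n in auto)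
    have "exp (- ((1 - 1 / p) * real n * ln n) - D * real n) \<le> (LBINT t:{0..}. t ^ n * exp (- (t powr p)) * ?h t) / fact n"
      by (rule D) (use n inth in auto)
    also have "\<dots> \<le> (LBINT t:{0..}. t ^ n * exp (- (t powr p)) * s t) / fact n"
      by (intro divide_right_mono set_integral_mono inth int mult_left_mono ge) (use n in auto)
    also have "\<dots> = radial_eigenvalue w n" unfolding w_def by (rule envelope_eigenvalue[OF p, symmetric])
    finally show ?thesis by linarith
  qed
  \<comment> \<open>The counting lemma takes one constant for both bounds.\<close>
  define M where "M = max C D"
  have "(\<lambda>x. real (card {n. \<bar>radial_eigenvalue w n\<bar> > x})) \<sim>[at_right 0] (\<lambda>x. 1 / (1 - 1 / p) * (\<bar>ln x\<bar> / ln \<bar>ln x\<bar>))"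
  proof (rule superlevel_card_asymp_equiv[where N = "max N 1" and C = M])
    show "1 - 1 / p > 0" using p by simp
    fix n assume n: "n \<ge> max N 1"
    have "\<bar>radial_eigenvalue w n\<bar> \<le> exp (- ((1 - 1 / p) * real n * ln n) + C * real n)" using C n by simp
    also have "\<dots> \<le> exp (- ((1 - 1 / p) * real n * ln n) + M * real n)"
      by (simp add: M_def mult_right_mono)
    finally show "\<bar>radial_eigenvalue w n\<bar> \<le> exp (- ((1 - 1 / p) * real n * ln n) + M * real n)" .
    have "exp (- ((1 - 1 / p) * real n * ln n) - M * real n) \<le> exp (- ((1 - 1 / p) * real n * ln n) - D * real n)"
      by (simp add: M_def mult_right_mono)
    also note lower[OF n]
    finally show "exp (- ((1 - 1 / p) * real n * ln n) - M * real n) \<le> \<bar>radial_eigenvalue w n\<bar>" .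
  qed (rule fin)
  also have "1 / (1 - 1 / p) = p / (p - 1)" using p by (simp add: field_simps)
  finally have eq: "(\<lambda>x. real (card {n. \<bar>radial_eigenvalue w n\<bar> > x})) \<sim>[at_right 0]
      (\<lambda>x. p / (p - 1) * (\<bar>ln x\<bar> / ln \<bar>ln x\<bar>))" .
  have "eventually (\<lambda>x. real (singular_count x (toeplitz (\<lambda>z. w (norm z)))) = real (card {n. \<bar>radial_eigenvalue w n\<bar> > x})) (at_right 0)"
    by (rule singular_count_eventually) (rule cnt)
  from asymp_equiv_cong[OF this always_eventually, THEN iffD2, OF _ eq]
  have "(\<lambda>x. real (singular_count x (toeplitz (\<lambda>z. w (norm z))))) \<sim>[at_right 0]
      (\<lambda>x. p / (p - 1) * (\<bar>ln x\<bar> / ln \<bar>ln x\<bar>))" by simp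
  thus "(\<lambda>x. real (singular_count x (toeplitz (\<lambda>z. envelope p (norm z) * s ((norm z)\<^sup>2))))) \<sim>[at_right 0]
      (\<lambda>x. p / (p - 1) * (\<bar>ln x\<bar> / ln \<bar>ln x\<bar>))" by (simp add: w_def)
qed

text \<open>Two decay rates are combined. Compactness and the reduction to counting eigenvalues come
  from the absolute bound with exponent \<open>p\<close>; the sharper rate with exponent
  \<open>q\<close>, which determines the limsup, comes from the rotated contour.\<close>

lemma oscillating_envelope:
  fixes p q :: real
  assumes p: "p > 1" and q: "q > p"
  defines "T \<equiv> toeplitz (\<lambda>z. envelope p (norm z) * sin (((norm z)\<^sup>2) powr q))"
  shows "bargmann_compact T"
    and "Limsup (at_right 0) (\<lambda>x. ereal (real (singular_count x T) * (ln \<bar>ln x\<bar> / \<bar>ln x\<bar>))) \<le> ereal (q / (q - 1))"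
proof -
  define w where "w = (\<lambda>r. envelope p r * sin ((r\<^sup>2) powr q))"
  have s: "(\<lambda>t::real. sin (t powr q)) \<in> borel_measurable borel" by measurable
  have T: "T = toeplitz (\<lambda>z. w (norm z))" by (simp add: T_def w_def)
  have q1: "q > 1" using p q by simp
  note W = envelope_toeplitz[OF p s abs_sin_le_one w_def]
  note cpt = W(2) and cnt = W(3) and int = W(5)
  show "bargmann_compact T" using cpt by (simp add: T)
  obtain K where K: "K > 0" and bound: "\<And>n f. n > 0 \<Longrightarrow> f \<in> borel_measurable borel \<Longrightarrow>
       (\<And>t. t \<ge> 0 \<Longrightarrow> \<bar>f t\<bar> \<le> t ^ n * exp (- (t powr q))) \<Longrightarrow>
       set_integrable lborel {0..} f \<and> \<bar>LBINT t:{0..}. f t\<bar> \<le> K * (2 * real n / q) powr (real n / q)"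
    using set_integral_power_times_exp_minus_powr_bound[OF q1] by metis
  obtain C where C: "\<And>n. n > 0 \<Longrightarrow>
    K * (2 * real n / q) powr (real n / q) / fact n \<le> exp (- ((1 - 1 / q) * real n * ln n) + C * real n)"
    using moment_ratio_le[OF q1 K] by metis
  have le: "\<bar>radial_eigenvalue w n\<bar> \<le> exp (- ((1 - 1 / q) * real n * ln n) + C * real n)" if n: "n \<ge> 1" for n
  proof -
    have n0: "n > 0" using n by simp
    have b: "set_integrable lborel {0..} (\<lambda>t. t ^ n * exp (- (t powr q))) \<and>
        \<bar>LBINT t:{0..}. t ^ n * exp (- (t powr q))\<bar> \<le> K * (2 * real n / q) powr (real n / q)"
      by (rule bound[OF n0]) auto
    have "\<bar>LBINT t:{0..}. t ^ n * exp (- (t powr p)) * sin (t powr q)\<bar> \<le> K * (2 * real n / q) powr (real n / q)"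
      \<comment> \<open>The rotated integral is itself a moment, now with the weight
        \<open>exp (- (t powr q))\<close>, so the upper bound applies with \<open>q\<close> for
        \<open>p\<close>.\<close>
      using oscillatory_moment_le[OF p q n0 int[OF n0] conjunct1[OF b]] b by linarith
    hence "\<bar>radial_eigenvalue w n\<bar> \<le> K * (2 * real n / q) powr (real n / q) / fact n"
      unfolding w_def envelope_eigenvalue[OF p, of "\<lambda>t. sin (t powr q)"] by (simp add: abs_divide divide_right_mono)
    also note C[OF n0]
    finally show ?thesis .
  qed
  have "Limsup (at_right 0) (\<lambda>x. ereal (real (singular_count x T) * (ln \<bar>ln x\<bar> / \<bar>ln x\<bar>))) =
      Limsup (at_right 0) (\<lambda>x. ereal (real (card {n. \<bar>radial_eigenvalue w n\<bar> > x}) * (ln \<bar>ln x\<bar> / \<bar>ln x\<bar>)))"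
    unfolding T
  proof (rule Limsup_eq)
    have "eventually (\<lambda>x. real (singular_count x (toeplitz (\<lambda>z. w (norm z)))) = real (card {n. \<bar>radial_eigenvalue w n\<bar> > x})) (at_right 0)"
      by (rule singular_count_eventually) (rule cnt)
    thus "eventually (\<lambda>x. ereal (real (singular_count x (toeplitz (\<lambda>z. w (norm z)))) * (ln \<bar>ln x\<bar> / \<bar>ln x\<bar>)) =
        ereal (real (card {n. \<bar>radial_eigenvalue w n\<bar> > x}) * (ln \<bar>ln x\<bar> / \<bar>ln x\<bar>))) (at_right 0)"
      by eventually_elim simp
  qed
  also have "\<dots> \<le> ereal (1 / (1 - 1 / q))"
    by (rule Limsup_superlevel_card_le[where N = 1 and C = C]) (use le q1 in auto)
  also have "1 / (1 - 1 / q) = q / (q - 1)" using q1 by (simp add: field_simps)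
  finally show "Limsup (at_right 0) (\<lambda>x. ereal (real (singular_count x T) * (ln \<bar>ln x\<bar> / \<bar>ln x\<bar>))) \<le> ereal (q / (q - 1))" .
qed

lemma osc_symbol_eq:
  assumes "r \<ge> 0"
  shows "osc_symbol p q r = envelope p r * sin ((r\<^sup>2) powr q)"
proof -
  have "(r\<^sup>2) powr q = r powr (2 * q)"
    using assms by (cases "r = 0") (simp_all add: powr_powr flip: powr_numeral)
  thus ?thesis by (simp add: osc_symbol_def envelope_def)
qed

theorem theorem5p1:
  fixes p q :: real and V :: "complex \<Rightarrow> real"
  assumes "p > 1" and "q > p"
    and V_def: "V = (\<lambda>z. osc_symbol p q (norm z))"
  defines "Tabs \<equiv> toeplitz (\<lambda>z. \<bar>V z\<bar>)"
    and "Tpos \<equiv> toeplitz (\<lambda>z. max (V z) 0)"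
    and "Tneg \<equiv> toeplitz (\<lambda>z. max (- V z) 0)"
  shows "bargmann_compact (toeplitz V) \<and> bargmann_compact Tabs \<and>
      bargmann_compact Tpos \<and> bargmann_compact Tneg \<and>
      Limsup (at_right 0)
        (\<lambda>x. ereal (real (singular_count x (toeplitz V)) * (ln \<bar>ln x\<bar> / \<bar>ln x\<bar>)))
        \<le> ereal (q / (q - 1)) \<and>
      (\<lambda>x. real (singular_count x Tabs)) \<sim>[at_right 0] (\<lambda>x. real (singular_count x Tpos)) \<and>
      (\<lambda>x. real (singular_count x Tpos)) \<sim>[at_right 0] (\<lambda>x. real (singular_count x Tneg)) \<and>
      (\<lambda>x. real (singular_count x Tneg)) \<sim>[at_right 0]
        (\<lambda>x. p / (p - 1) * (\<bar>ln x\<bar> / ln \<bar>ln x\<bar>))"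
proof -
  have q: "q > 1" using assms(1,2) by simp
  let ?F = "\<lambda>x. p / (p - 1) * (\<bar>ln x\<bar> / ln \<bar>ln x\<bar>)"
  have V: "V = (\<lambda>z. envelope p (norm z) * sin (((norm z)\<^sup>2) powr q))"
    unfolding V_def by (simp add: osc_symbol_eq)
  have env: "envelope p (norm z) > 0" for z :: complex by (rule envelope_bounds(1)[OF assms(1)]) simp
  have abs: "(\<lambda>z. \<bar>V z\<bar>) = (\<lambda>z. envelope p (norm z) * \<bar>sin (((norm z)\<^sup>2) powr q)\<bar>)"
    unfolding V using env by (simp add: abs_mult less_imp_le)
  have pos: "(\<lambda>z. max (V z) 0) = (\<lambda>z. envelope p (norm z) * max (sin (((norm z)\<^sup>2) powr q)) 0)"
    unfolding V using env by (simp add: max_mult_distrib_left less_imp_le)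
  \<comment> \<open>The shift by \<open>pi\<close> turns \<open>- sin\<close> into a sine, so the
    negative part is the case \<open>\<phi> = pi\<close>.\<close>
  have neg: "(\<lambda>z. max (- V z) 0) = (\<lambda>z. envelope p (norm z) * max (sin (((norm z)\<^sup>2) powr q - pi)) 0)"
    unfolding V using env by (simp add: max_mult_distrib_left less_imp_le sin_diff)
  have A: "bargmann_compact Tabs" "(\<lambda>x. real (singular_count x Tabs)) \<sim>[at_right 0] ?F"
    unfolding Tabs_def abs
    by (rule signed_envelope_asymp[OF assms(1) q, where s = "\<lambda>t. \<bar>sin (t powr q)\<bar>" and \<phi> = 0]; simp)+
  have P: "bargmann_compact Tpos" "(\<lambda>x. real (singular_count x Tpos)) \<sim>[at_right 0] ?F"
    unfolding Tpos_def pos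
    by (rule signed_envelope_asymp[OF assms(1) q, where s = "\<lambda>t. max (sin (t powr q)) 0" and \<phi> = 0]; simp)+
  have N: "bargmann_compact Tneg" "(\<lambda>x. real (singular_count x Tneg)) \<sim>[at_right 0] ?F"
    unfolding Tneg_def neg
    by (rule signed_envelope_asymp[OF assms(1) q, where s = "\<lambda>t. max (sin (t powr q - pi)) 0" and \<phi> = pi]; simp)+
  show ?thesis
    using oscillating_envelope[OF assms(1,2)] A P N
      asymp_equiv_trans[OF A(2) asymp_equiv_symI[OF P(2)]] asymp_equiv_trans[OF P(2) asymp_equiv_symI[OF N(2)]]
    unfolding V[symmetric] by blast
qed

end
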